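(* Let $P$ be a proper Buchsteiner loop of order $32$. Then $1<A(P)<N(P)<Z_2(P)$ (all inclusions proper), $|Z_2(P)|=8$, $A(P)=Z(P)$, and there exists a unique power associative conjugacy closed subloop $Q$ of $P$ of index two such that $QZ_2(P)=P$ and $Q\cap Z_2(P)=N(P)=Z(Q)$. The group $Q/A(P)$ is noncommutative.
   Context: A Buchsteiner loop is a loop satisfying $x\backslash (xy\cdot z) = (y\cdot zx)/x$ for all $x,y,z$, where $\backslash$ and $/$ are left and right division. It is proper if it is not conjugacy closed. A loop is conjugacy closed if for all $x,y$ the conjugate $L_xL_yL_x^{-1}$ is a left translation and $R_xR_yR_x^{-1}$ is a right translation, where $L_x(y)=xy$, $R_x(y)=yx$. For a loop $Q$: the nucleus $N(Q)$ is the set of all $a$ such that $a(xy)=(ax)y$, $x(ay)=(xa)y$ and $x(ya)=(xy)a$ for all $x,y\in Q$; the centre $Z(Q)$ is the set of elements of $N(Q)$ commuting with all elements of $Q$; $Z_2(Q)$ is the second centre, i.e. the preimage in $Q$ of $Z(Q/Z(Q))$; $A(Q)$ is the least normal subloop $A$ such that $Q/A$ is a group. A loop is power associative if each of its elements generates a group. *)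

theory Defs
  imports "HOL-Algebra.Coset" "HOL-Algebra.Bij" "HOL.Hull"
begin

section \<open>Loops\<close>

locale loop =
  fixes G (structure)
  assumes m_closed: "\<lbrakk>x \<in> carrier G; y \<in> carrier G\<rbrakk> \<Longrightarrow> x \<otimes> y \<in> carrier G"
    and one_closed: "\<one> \<in> carrier G"
    and l_one: "x \<in> carrier G \<Longrightarrow> \<one> \<otimes> x = x"
    and r_one: "x \<in> carrier G \<Longrightarrow> x \<otimes> \<one> = x"
    and l_solve: "\<lbrakk>x \<in> carrier G; y \<in> carrier G\<rbrakk> \<Longrightarrow> \<exists>!z\<in>carrier G. x \<otimes> z = y"
    and r_solve: "\<lbrakk>x \<in> carrier G; y \<in> carrier G\<rbrakk> \<Longrightarrow> \<exists>!z\<in>carrier G. z \<otimes> x = y"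

text \<open>\<open>ldiv G x y\<close> is \<open>y\<close> divided by \<open>x\<close> on the left and
  \<open>rdiv G y x\<close> is \<open>y / x\<close>, so \<open>x\<close> is the divisor in both.\<close>

definition ldiv :: "('a, 'b) monoid_scheme \<Rightarrow> 'a \<Rightarrow> 'a \<Rightarrow> 'a"
  where "ldiv G x y = (THE z. z \<in> carrier G \<and> x \<otimes>\<^bsub>G\<^esub> z = y)"

definition rdiv :: "('a, 'b) monoid_scheme \<Rightarrow> 'a \<Rightarrow> 'a \<Rightarrow> 'a"
  where "rdiv G y x = (THE z. z \<in> carrier G \<and> z \<otimes>\<^bsub>G\<^esub> x = y)"

definition left_translation :: "('a, 'b) monoid_scheme \<Rightarrow> 'a \<Rightarrow> 'a \<Rightarrow> 'a"
  where "left_translation G x = (\<lambda>y\<in>carrier G. x \<otimes>\<^bsub>G\<^esub> y)"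

definition right_translation :: "('a, 'b) monoid_scheme \<Rightarrow> 'a \<Rightarrow> 'a \<Rightarrow> 'a"
  where "right_translation G x = (\<lambda>y\<in>carrier G. y \<otimes>\<^bsub>G\<^esub> x)"

text \<open>The conjugates of translations are formed in the symmetric group \<open>BijGroup (carrier G)\<close>,
  whose product is composition of functions (right factor applied first).\<close>

locale conjugacy_closed_loop = loop +
  assumes l_conj: "\<lbrakk>x \<in> carrier G; y \<in> carrier G\<rbrakk> \<Longrightarrow>
      left_translation G x \<otimes>\<^bsub>BijGroup (carrier G)\<^esub> left_translation G y
        \<otimes>\<^bsub>BijGroup (carrier G)\<^esub> inv\<^bsub>BijGroup (carrier G)\<^esub> (left_translation G x)
      \<in> left_translation G ` carrier G"
    and r_conj: "\<lbrakk>x \<in> carrier G; y \<in> carrier G\<rbrakk> \<Longrightarrow>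
      right_translation G x \<otimes>\<^bsub>BijGroup (carrier G)\<^esub> right_translation G y
        \<otimes>\<^bsub>BijGroup (carrier G)\<^esub> inv\<^bsub>BijGroup (carrier G)\<^esub> (right_translation G x)
      \<in> right_translation G ` carrier G"

locale buchsteiner_loop = loop +
  assumes buchsteiner: "\<lbrakk>x \<in> carrier G; y \<in> carrier G; z \<in> carrier G\<rbrakk> \<Longrightarrow>
    ldiv G x ((x \<otimes> y) \<otimes> z) = rdiv G (y \<otimes> (z \<otimes> x)) x"

definition proper_buchsteiner_loop :: "('a, 'b) monoid_scheme \<Rightarrow> bool"
  where "proper_buchsteiner_loop G \<longleftrightarrow> buchsteiner_loop G \<and> \<not> conjugacy_closed_loop G"

section \<open>Subloops and quotients\<close>

locale subloop =
  fixes H and G (structure)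
  assumes subset: "H \<subseteq> carrier G"
    and one_closed: "\<one> \<in> H"
    and m_closed: "\<lbrakk>x \<in> H; y \<in> H\<rbrakk> \<Longrightarrow> x \<otimes> y \<in> H"
    and ldiv_closed: "\<lbrakk>x \<in> H; y \<in> H\<rbrakk> \<Longrightarrow> ldiv G x y \<in> H"
    and rdiv_closed: "\<lbrakk>x \<in> H; y \<in> H\<rbrakk> \<Longrightarrow> rdiv G x y \<in> H"

text \<open>For a normal subloop \<open>H\<close> of a loop \<open>G\<close> the cosets of \<open>H\<close> multiply as complex products,
  so \<open>G Mod H\<close> from \<^theory>\<open>HOL-Algebra.Coset\<close> is the quotient loop.\<close>

locale normal_subloop = subloop +
  assumes coset_eq: "x \<in> carrier G \<Longrightarrow> x <# H = H #> x"
    and l_coset_assoc: "\<lbrakk>x \<in> carrier G; y \<in> carrier G\<rbrakk> \<Longrightarrow> x <# (y <# H) = (x \<otimes> y) <# H"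
    and r_coset_assoc: "\<lbrakk>x \<in> carrier G; y \<in> carrier G\<rbrakk> \<Longrightarrow> (H #> x) #> y = H #> (x \<otimes> y)"

definition nucleus :: "('a, 'b) monoid_scheme \<Rightarrow> 'a set"
  where "nucleus G = {a \<in> carrier G. \<forall>x\<in>carrier G. \<forall>y\<in>carrier G.
    a \<otimes>\<^bsub>G\<^esub> (x \<otimes>\<^bsub>G\<^esub> y) = (a \<otimes>\<^bsub>G\<^esub> x) \<otimes>\<^bsub>G\<^esub> y \<and>
    x \<otimes>\<^bsub>G\<^esub> (a \<otimes>\<^bsub>G\<^esub> y) = (x \<otimes>\<^bsub>G\<^esub> a) \<otimes>\<^bsub>G\<^esub> y \<and>
    x \<otimes>\<^bsub>G\<^esub> (y \<otimes>\<^bsub>G\<^esub> a) = (x \<otimes>\<^bsub>G\<^esub> y) \<otimes>\<^bsub>G\<^esub> a}"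

definition loop_centre :: "('a, 'b) monoid_scheme \<Rightarrow> 'a set"
  where "loop_centre G = {a \<in> nucleus G. \<forall>x\<in>carrier G. a \<otimes>\<^bsub>G\<^esub> x = x \<otimes>\<^bsub>G\<^esub> a}"

definition second_centre :: "('a, 'b) monoid_scheme \<Rightarrow> 'a set"
  where "second_centre G =
    {x \<in> carrier G. loop_centre G #>\<^bsub>G\<^esub> x \<in> loop_centre (G Mod loop_centre G)}"

text \<open>\<open>LEAST\<close> is with respect to inclusion; the least element exists in every loop.\<close>

definition associator_subloop :: "('a, 'b) monoid_scheme \<Rightarrow> 'a set"
  where "associator_subloop G = (LEAST A. normal_subloop A G \<and> group (G Mod A))"

definition power_associative :: "('a, 'b) monoid_scheme \<Rightarrow> bool"
  where "power_associative G \<longleftrightarrow>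
    (\<forall>x\<in>carrier G. group (G\<lparr>carrier := (\<lambda>H. subloop H G) hull {x}\<rparr>))"

end

theory Submission
  imports Defs "HOL-Library.Numeral_Type"
begin

text \<open>Write \<open>L\<^sub>x\<close> and \<open>R\<^sub>x\<close> for the translations. The Buchsteiner law says that
  \<open>(L\<^sub>x\<inverse>, R\<^sub>x, R\<^sub>x L\<^sub>x\<inverse>)\<close> is an autotopism for every \<open>x\<close>. Hence the left inner mappings
  \<open>(L\<^sub>x\<^sub>y)\<inverse> L\<^sub>x L\<^sub>y\<close> are pseudoautomorphisms. The discrepancy \<open>p x\<close> between the left and the
  right inverse of an element turns out to be nuclear, so the companions of the inner mappings are
  nuclear too and the inner mappings are automorphisms. A right multiplication that coincides with a left
  translation is the left translation by a nuclear element; this makes associators nuclear, and together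
  with the pentagon identity also commutators, so the quotient by the nucleus \<open>N\<close> is an abelian group.

  Now let the loop be proper of order 32. Expanding the commutator of \<open>x \<cdot> y\<close> and \<open>z\<close> shows that a central
  nucleus would make \<open>asc x y z\<close> symmetric in \<open>x\<close> and \<open>y\<close>, which is conjugacy closedness; so \<open>N\<close>
  is not central. If \<open>N\<close> had at least 8 elements, there would be too few cosets to violate that symmetry.
  Therefore \<open>card N = 4\<close>, and the centre, which contains all associators, has order 2. The
  commutator form modulo the centre takes values in a group of order 2, and on the centralizer \<open>W\<close>
  of \<open>N\<close>, of order 16, its radical is just \<open>N\<close>; its radical on the whole loop has order 8 and is the
  second centre. The subloop \<open>Q\<close> is \<open>W\<close>: a subloop of index two whose centre is \<open>N\<close> centralizes \<open>N\<close>
  and is therefore equal to \<open>W\<close>.\<close>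

text \<open>Division is total here: the arguments run on a loop that fills a whole type, and \<open>P\<close> is
  transported to the type \<open>32\<close> at the very end.\<close>

locale buchsteiner_algebra =
  fixes mult :: "'b \<Rightarrow> 'b \<Rightarrow> 'b" (infixl "\<cdot>" 70)
    and ld :: "'b \<Rightarrow> 'b \<Rightarrow> 'b"
    and rd :: "'b \<Rightarrow> 'b \<Rightarrow> 'b"
    and u1 :: 'b
  assumes mult_ld [simp]: "x \<cdot> ld x y = y"
    and ld_mult [simp]: "ld x (x \<cdot> y) = y"
    and rd_mult [simp]: "rd x y \<cdot> y = x"
    and mult_rd [simp]: "rd (x \<cdot> y) y = x"
    and unit_l [simp]: "u1 \<cdot> x = x"
    and unit_r [simp]: "x \<cdot> u1 = x"
    and law: "ld x ((x \<cdot> y) \<cdot> z) = rd (y \<cdot> (z \<cdot> x)) x"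
begin

section \<open>Cancellation, divisions and the opposite loop\<close>

lemma cancel_l [simp]: "x \<cdot> y = x \<cdot> z \<longleftrightarrow> y = z"
  by (metis ld_mult)

lemma cancel_r [simp]: "y \<cdot> x = z \<cdot> x \<longleftrightarrow> y = z"
  by (metis mult_rd)

lemma ld_self [simp]: "ld x x = u1" and rd_self [simp]: "rd x x = u1"
  and ld_unit [simp]: "ld u1 x = x" and rd_unit [simp]: "rd x u1 = x"
  by (metis ld_mult unit_r, metis mult_rd unit_l, metis ld_mult unit_l, metis mult_rd unit_r)

lemma ld_rd [simp]: "ld (rd x y) x = y" and rd_ld [simp]: "rd x (ld y x) = y"
  by (metis ld_mult rd_mult, metis mult_rd mult_ld)

lemma ld_eq_iff: "ld x y = z \<longleftrightarrow> y = x \<cdot> z" and rd_eq_iff: "rd y x = z \<longleftrightarrow> y = z \<cdot> x"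
  by auto

lemma buchsteiner_rd: "(x \<cdot> y) \<cdot> z = x \<cdot> rd (y \<cdot> (z \<cdot> x)) x"
  by (metis law mult_ld)

lemma buchsteiner_ld: "y \<cdot> (z \<cdot> x) = ld x ((x \<cdot> y) \<cdot> z) \<cdot> x"
  by (metis law rd_mult)

text \<open>Reversing the product exchanges the two sides of the law and the roles of
  \<open>y\<close> and \<open>z\<close>. Every result thus has a mirror image, obtained by
  instantiating it in the opposite loop.\<close>

lemma opposite: "buchsteiner_algebra (\<lambda>x y. y \<cdot> x) (\<lambda>x y. rd y x) (\<lambda>x y. ld y x) u1"
  by unfold_locales (simp_all add: law)

section \<open>Inverses and inner mappings\<close>

abbreviation lv :: "'b \<Rightarrow> 'b" where "lv x \<equiv> rd u1 x"

abbreviation rv :: "'b \<Rightarrow> 'b" where "rv x \<equiv> ld x u1"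

text \<open>\<open>h x y\<close> is the left inner mapping
  \<open>L\<^sub>x\<^sub>y\<inverse> L\<^sub>x L\<^sub>y\<close>, and \<open>k x y\<close> is the
  right inner mapping \<open>R\<^sub>x\<^sub>y\<inverse> R\<^sub>y R\<^sub>x\<close>.\<close>

definition h :: "'b \<Rightarrow> 'b \<Rightarrow> 'b \<Rightarrow> 'b" where "h x y z = ld (x \<cdot> y) (x \<cdot> (y \<cdot> z))"

definition k :: "'b \<Rightarrow> 'b \<Rightarrow> 'b \<Rightarrow> 'b" where "k x y z = rd ((z \<cdot> x) \<cdot> y) (x \<cdot> y)"

lemma mult_h: "(x \<cdot> y) \<cdot> h x y z = x \<cdot> (y \<cdot> z)"
  by (simp add: h_def)

lemma k_mult: "k x y z \<cdot> (x \<cdot> y) = (z \<cdot> x) \<cdot> y"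
  by (simp add: k_def)

text \<open>The law turns inner mappings into commutators of translations: \<open>h x y\<close> is
  \<open>R\<^sub>x\<inverse> L\<^sub>y\<inverse> R\<^sub>x L\<^sub>y\<close>, and by
  \<open>k_comm\<close> the mapping \<open>k x y\<close> is
  \<open>L\<^sub>y\<inverse> R\<^sub>x\<inverse> L\<^sub>y R\<^sub>x\<close>. Hence they are
  mutually inverse.\<close>

lemma h_comm: "(y \<cdot> u) \<cdot> x = y \<cdot> (h x y u \<cdot> x)"
  by (metis mult_h buchsteiner_rd ld_mult rd_mult)

lemma k_comm: "(y \<cdot> k x y z) \<cdot> x = y \<cdot> (z \<cdot> x)"
  by (metis k_mult buchsteiner_ld ld_mult mult_rd mult_ld)

lemma k_h [simp]: "k x y (h x y z) = z"
  by (metis h_comm k_comm cancel_l cancel_r)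

lemma h_k [simp]: "h x y (k x y z) = z"
  by (metis h_comm k_comm cancel_l cancel_r)

lemma h_unit [simp]: "h x y u1 = u1" and k_unit [simp]: "k x y u1 = u1"
  by (simp_all add: h_def k_def)

definition auto :: "('b \<Rightarrow> 'b) \<Rightarrow> bool" where "auto a \<longleftrightarrow> (\<forall>x y. a (x \<cdot> y) = a x \<cdot> a y)"

lemma autoD: "auto a \<Longrightarrow> a (x \<cdot> y) = a x \<cdot> a y" by (simp add: auto_def)

lemma auto_inverse: assumes "auto a" "\<And>x. a (b x) = x" "\<And>x. b (a x) = x" shows "auto b"
  unfolding auto_def by (metis assms autoD)

text \<open>The law as the autotopism \<open>(L\<^sub>x\<inverse>, R\<^sub>x, R\<^sub>x
  L\<^sub>x\<inverse>)\<close>; \<open>mult_div\<close> is the inverse autotopism.\<close>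

lemma div_mult: "ld x u \<cdot> (v \<cdot> x) = ld x (u \<cdot> v) \<cdot> x"
  by (metis buchsteiner_ld mult_ld)

lemma mult_div: "(x \<cdot> u) \<cdot> rd v x = x \<cdot> rd (u \<cdot> v) x"
  by (metis buchsteiner_rd rd_mult)

text \<open>The autotopisms of \<open>x\<close> and \<open>y\<close> followed by the inverse of that
  of \<open>x \<cdot> y\<close> compose to \<open>(a, k x y, c)\<close>. Evaluation at
  \<open>v = u1\<close> identifies \<open>c\<close> with \<open>a\<close>.\<close>

lemma k_pseudo:
  fixes x y defines "a \<equiv> \<lambda>u. (x \<cdot> y) \<cdot> ld y (ld x u)"
  shows "a u \<cdot> k x y v = a (u \<cdot> v)"
proof -
  define c where "c t = (x \<cdot> y) \<cdot> rd (ld y (ld x t \<cdot> x) \<cdot> y) (x \<cdot> y)" for t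
  have *: "a u \<cdot> k x y v = c (u \<cdot> v)" for u v
    unfolding a_def c_def k_def mult_div div_mult ..
  from *[of _ u1] have "a = c" by auto
  with * show ?thesis by simp
qed

lemma k_pseudo': "((x \<cdot> y) \<cdot> ld y (rv x)) \<cdot> k x y v = (x \<cdot> y) \<cdot> ld y (ld x v)"
  using k_pseudo[of x y u1 v] by simp

text \<open>By \<open>k_pseudo'\<close> the element \<open>(x \<cdot> y) \<cdot> ld y (rv x)\<close>
  is the companion of the pseudoautomorphism \<open>k x y\<close>. A companion in the left nucleus
  can be cancelled.\<close>

lemma k_auto_if:
  assumes "\<And>u v. ((x \<cdot> y) \<cdot> ld y (rv x)) \<cdot> (u \<cdot> v) = (((x \<cdot> y) \<cdot> ld y (rv x)) \<cdot> u) \<cdot> v"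
  shows "auto (k x y)" "auto (h x y)"
proof -
  define d where "d = (x \<cdot> y) \<cdot> ld y (rv x)"
  have d: "d \<cdot> k x y v = (x \<cdot> y) \<cdot> ld y (ld x v)" for v
    unfolding d_def by (rule k_pseudo')
  have "d \<cdot> k x y (u \<cdot> v) = (d \<cdot> k x y u) \<cdot> k x y v" for u v
    by (simp only: d k_pseudo)
  then have "d \<cdot> k x y (u \<cdot> v) = d \<cdot> (k x y u \<cdot> k x y v)" for u v
    unfolding assms[folded d_def] .
  then show *: "auto (k x y)" unfolding auto_def by simp
  show "auto (h x y)" by (rule auto_inverse[OF *]) auto
qed

subsection \<open>The automorphism \<open>ea\<close>\<close>

text \<open>An inner mapping for a pair with product \<open>u1\<close>, see \<open>ea_eq_h\<close>.
  Its companion is \<open>u1\<close>, so it is an automorphism before anything is known about the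
  nucleus. \<open>ei x\<close> is its inverse.\<close>

definition ea where "ea x u = x \<cdot> (rv x \<cdot> u)"

definition ei where "ei x u = (u \<cdot> lv x) \<cdot> x"

lemma rv_mult_mult: "rv x \<cdot> (u \<cdot> x) = ld x u \<cdot> x" by (metis div_mult unit_l)

lemma mult_mult_lv: "(x \<cdot> u) \<cdot> lv x = x \<cdot> rd u x" by (metis mult_div unit_r)

lemma ea_ei [simp]: "ea x (ei x u) = u"
  by (metis rv_mult_mult mult_mult_lv ea_def ei_def mult_ld mult_rd rd_mult ld_mult)

lemma ei_ea [simp]: "ei x (ea x u) = u"
  by (metis rv_mult_mult mult_mult_lv ea_def ei_def mult_ld mult_rd rd_mult ld_mult)

lemma ea_eq_h: "ea x u = h x (rv x) u" and ei_eq_k: "ei x u = k (lv x) x u"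
  by (simp_all add: h_def ea_def k_def ei_def)

lemma auto_ea: "auto (ea x)" and auto_ei: "auto (ei x)"
proof -
  have "auto (h x (rv x))" by (rule k_auto_if) simp
  then show 1: "auto (ea x)" by (simp add: auto_def ea_eq_h)
  show "auto (ei x)" by (rule auto_inverse[OF 1]) auto
qed

lemma ea_mult: "ea x (u \<cdot> v) = ea x u \<cdot> ea x v" and ei_mult: "ei x (u \<cdot> v) = ei x u \<cdot> ei x v"
  using auto_ea auto_ei by (auto simp: auto_def)

text \<open>\<open>ei x\<close> is \<open>k (lv x) x\<close>, whose inverse is
  \<open>h (lv x) x\<close>; so the left inverse can replace the right one.\<close>

lemma ea_eq: "ea x u = lv x \<cdot> (x \<cdot> u)"
proof -
  have "lv x \<cdot> (x \<cdot> u) = h (lv x) x u" by (simp add: h_def)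
  then show ?thesis using h_k[of "lv x" x "ea x u"] by (simp flip: ei_eq_k)
qed

lemma ei_eq: "ei x u = (u \<cdot> x) \<cdot> rv x"
proof -
  have "(u \<cdot> x) \<cdot> rv x = k x (rv x) u" by (simp add: k_def)
  then show ?thesis using k_h[of x "rv x" "ei x u"] by (simp flip: ea_eq_h)
qed

lemma ea_conj: "x \<cdot> (u \<cdot> x) = ea x ((x \<cdot> u) \<cdot> x)" by (simp add: ea_def rv_mult_mult)

lemma ea_conj': "ld x t \<cdot> x = ld x (ea x (t \<cdot> x))" by (metis ea_conj mult_ld ld_mult)

lemma ea_square: "ea x (x \<cdot> x) = x \<cdot> x" by (simp add: ea_def rv_mult_mult)

lemma ei_square: "ei x (x \<cdot> x) = x \<cdot> x" by (metis ea_square ei_ea)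

text \<open>\<open>ei x x\<close> is the double right inverse of \<open>x\<close>, so
  \<open>p x\<close> measures how far the left and right inverses differ; \<open>rv_eq\<close> makes
  this explicit.\<close>

definition p where "p x = ld x (ei x x)"

lemma mult_p: "x \<cdot> p x = ei x x" by (simp add: p_def)

lemma p_mult: "p x \<cdot> x = ea x x"
  using law[of x "lv x" x] by (simp add: p_def ea_eq ei_def)

lemma mult_rd_cancel: "x \<cdot> rd x (z \<cdot> x) = rd x z"
  using buchsteiner_ld[of "rd x (z \<cdot> x)" z x] by (metis rd_mult ld_eq_iff mult_rd unit_r unit_l cancel_r)

lemma ld_mult_cancel: "ld (x \<cdot> z) x \<cdot> x = ld z x"
  using buchsteiner_algebra.mult_rd_cancel[OF opposite] by simp

lemma ei_mult_square: "ei x x \<cdot> (x \<cdot> x) = (x \<cdot> x) \<cdot> x"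
proof -
  have "ld (ei x x) (x \<cdot> x) = ei x x" by (metis ei_mult ei_square ld_mult)
  then have "ei x x \<cdot> (x \<cdot> x) = ld (rv x) (x \<cdot> x)"
    by (metis ld_mult_cancel ei_eq)
  also have "\<dots> = (x \<cdot> x) \<cdot> x" by (metis rv_mult_mult ld_mult)
  finally show ?thesis .
qed

text \<open>The point is that the companion \<open>(x \<cdot> x) \<cdot> ld x (rv x)\<close> of
  \<open>kk x\<close> becomes \<open>u1\<close>.\<close>

lemma rv_square: "rv (x \<cdot> x) = ld x (rv x)"
proof -
  have 1: "rv x \<cdot> (x \<cdot> x) = x" by (simp add: rv_mult_mult)
  have "rv (x \<cdot> x) \<cdot> (ei x x \<cdot> (x \<cdot> x)) = ld (x \<cdot> x) (ei x x) \<cdot> (x \<cdot> x)" by (rule rv_mult_mult)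
  also have "\<dots> = x" by (simp add: ei_eq 1)
  finally have "rv (x \<cdot> x) = rd x ((x \<cdot> x) \<cdot> x)" by (metis ei_mult_square mult_rd)
  then show ?thesis by (metis mult_rd_cancel 1 mult_rd ld_mult)
qed

subsection \<open>The automorphism \<open>kk\<close>\<close>

abbreviation kk where "kk x \<equiv> k x x"

lemma kk_eq: "kk x u = (x \<cdot> x) \<cdot> ld x (ld x u)"
  using k_pseudo'[of x x u] by (simp flip: rv_square)

lemma auto_kk: "auto (kk x)"
  by (rule k_auto_if) (simp flip: rv_square)

lemma kk_mult: "kk x (u \<cdot> v) = kk x u \<cdot> kk x v" using auto_kk by (auto simp: auto_def)

lemma kk_self: "kk x x = ei x x" by (simp add: k_def ei_mult_square rd_eq_iff)

lemma kk_square: "kk x (x \<cdot> x) = x \<cdot> x" by (simp add: kk_eq)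

lemma kk_h: "kk x (h x x u) = u" by simp

text \<open>\<open>kk x\<close> is evaluated both by \<open>kk_eq\<close> and as an automorphism
  that fixes \<open>x \<cdot> x\<close> and sends \<open>x\<close> to \<open>ei x x\<close>.\<close>

lemma mult_mult_ei: "x \<cdot> (x \<cdot> u) = ei x x \<cdot> (ei x x \<cdot> u)"
proof -
  obtain v where v: "u = kk x v" by (metis kk_h)
  have "(x \<cdot> x) \<cdot> v = kk x (x \<cdot> (x \<cdot> v))" by (simp add: kk_eq)
  also have "\<dots> = ei x x \<cdot> (ei x x \<cdot> u)" by (simp add: kk_mult kk_self v)
  finally have 1: "(x \<cdot> x) \<cdot> v = ei x x \<cdot> (ei x x \<cdot> u)" .
  have "kk x (x \<cdot> (x \<cdot> u)) = (x \<cdot> x) \<cdot> kk x v" by (simp add: kk_eq v)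
  also have "\<dots> = kk x ((x \<cdot> x) \<cdot> v)" by (metis kk_mult kk_square)
  finally have "x \<cdot> (x \<cdot> u) = (x \<cdot> x) \<cdot> v" by (metis h_k k_h)
  with 1 show ?thesis by simp
qed

lemma mult_kk_mult: "x \<cdot> (kk x v \<cdot> x) = ea x (x \<cdot> (v \<cdot> x))"
  by (metis k_comm ea_conj)

lemma ld_kk_mult: "ld x (kk x v) \<cdot> x = ea x (ld x v \<cdot> x)"
proof -
  have "ld x (kk x v) = rd (x \<cdot> (ld x (ld x v) \<cdot> x)) x" by (simp add: kk_eq law)
  then show ?thesis by (simp add: ea_conj)
qed

lemma ea_mult_left: "ea x x \<cdot> (x \<cdot> u) = x \<cdot> (ei x x \<cdot> u)"
proof -
  \<comment> \<open>Eliminating \<open>kk\<close> between \<open>mult_kk_mult\<close> and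
    \<open>ld_kk_mult\<close> leaves an identity in \<open>ea x\<close> and the left translation by
    \<open>x\<close> alone.\<close>
  have *: "ea x (ld x (ea x (x \<cdot> w))) = x \<cdot> ea x (ld x (ea x w))" for w
  proof -
    define v where "v = rd w x"
    have "ld x (ea x (kk x v \<cdot> x)) = ea x (ld x (ea x (v \<cdot> x)))"
      using ld_kk_mult[of x v] by (simp only: ea_conj')
    then have "ea x (kk x v \<cdot> x) = x \<cdot> ea x (ld x (ea x w))"
      by (simp add: v_def ld_eq_iff)
    moreover have "kk x v \<cdot> x = ld x (ea x (x \<cdot> w))"
      using mult_kk_mult[of x v] by (metis ld_mult rd_mult v_def)
    ultimately show ?thesis by (simp add: v_def)
  qed
  have "ea x (ld x (ea x (x \<cdot> ei x (x \<cdot> u)))) = x \<cdot> ea x u"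
    by (simp add: *)
  then have "ld x (ea x (x \<cdot> ei x (x \<cdot> u))) = ei x (x \<cdot> ea x u)" by (metis ei_ea)
  then show ?thesis by (simp add: ei_mult ea_mult ld_eq_iff)
qed

text \<open>For \<open>s = u \<cdot> x\<close> and \<open>u = kk x v\<close> both sides are
  \<open>ea x (v \<cdot> x)\<close>.\<close>

lemma p_mult_eq: "p x \<cdot> s = x \<cdot> ld (ei x x) s"
proof -
  obtain u where s: "s = u \<cdot> x" by (metis rd_mult)
  have 1: "p x \<cdot> (u \<cdot> x) = ld x (ei x x \<cdot> u) \<cdot> x"
    using buchsteiner_ld[of "p x" u x] by (simp add: mult_p)
  obtain v where v: "u = kk x v" by (metis kk_h)
  have a: "ld x (ei x x \<cdot> u) \<cdot> x = ea x (v \<cdot> x)"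
    using ld_kk_mult[of x "x \<cdot> v"] by (simp add: kk_mult kk_self v)
  have "ea x x \<cdot> (ea x (v \<cdot> x)) = x \<cdot> (u \<cdot> x)"
    using mult_kk_mult[of x v] by (simp add: v ea_mult)
  then have "x \<cdot> (ei x x \<cdot> ld x (ea x (v \<cdot> x))) = x \<cdot> (u \<cdot> x)"
    by (metis ea_mult_left mult_ld)
  then have "x \<cdot> ld (ei x x) (u \<cdot> x) = ea x (v \<cdot> x)" by (metis cancel_l ld_mult mult_ld)
  with 1 a s show ?thesis by simp
qed

text \<open>From here to \<open>mult_p_assoc_right\<close>: every triple containing both
  \<open>x\<close> and \<open>p x\<close> associates. The second half is the first read in the
  opposite loop, which exchanges \<open>ea\<close> with \<open>ei\<close> and has the same
  \<open>p\<close>.\<close>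

lemma p_mult_mult: "p x \<cdot> (x \<cdot> u) = ea x x \<cdot> u"
proof -
  have "x \<cdot> u = ei x x \<cdot> (ei x x \<cdot> ld x u)" using mult_mult_ei[of x "ld x u"] by simp
  then have "p x \<cdot> (x \<cdot> u) = x \<cdot> (ei x x \<cdot> ld x u)" by (simp add: p_mult_eq)
  then show ?thesis using ea_mult_left[of x "ld x u"] by simp
qed

lemma mult_p_mult: "x \<cdot> (p x \<cdot> u) = ei x x \<cdot> u"
  by (simp add: p_mult_eq mult_mult_ei)

lemma p_mult_assoc_left: "p x \<cdot> (u \<cdot> x) = (p x \<cdot> u) \<cdot> x"
  using buchsteiner_ld[of "p x" u x] by (simp add: mult_p flip: mult_p_mult)

lemma opposite_ea: "buchsteiner_algebra.ea (\<lambda>x y. y \<cdot> x) (\<lambda>x y. rd y x) u1 x = ei x"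
  unfolding buchsteiner_algebra.ea_def[OF opposite] ei_def by auto

lemma opposite_ei: "buchsteiner_algebra.ei (\<lambda>x y. y \<cdot> x) (\<lambda>x y. ld y x) u1 x = ea x"
  unfolding buchsteiner_algebra.ei_def[OF opposite] ea_def by auto

lemma opposite_p: "buchsteiner_algebra.p (\<lambda>x y. y \<cdot> x) (\<lambda>x y. rd y x) (\<lambda>x y. ld y x) u1 x = p x"
  unfolding buchsteiner_algebra.p_def[OF opposite] opposite_ei by (simp flip: p_mult)

lemma mult_mult_p: "(u \<cdot> x) \<cdot> p x = u \<cdot> ei x x"
  using buchsteiner_algebra.p_mult_mult[OF opposite] by (simp add: opposite_ea opposite_p)

lemma mult_p_mult_right: "(u \<cdot> p x) \<cdot> x = u \<cdot> ea x x"
  using buchsteiner_algebra.mult_p_mult[OF opposite] by (simp add: opposite_ei opposite_p)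

lemma mult_p_assoc_right: "(x \<cdot> u) \<cdot> p x = x \<cdot> (u \<cdot> p x)"
  using buchsteiner_algebra.p_mult_assoc_left[OF opposite] by (simp add: opposite_p)

lemma ea_p: "ea x (p x) = p x"
proof -
  have "ea x (x \<cdot> ei x x) = ea x x \<cdot> x" by (simp add: ea_mult)
  also have "\<dots> = x \<cdot> ei x x" using ea_mult_left[of x u1] by simp
  finally have "ea x ((x \<cdot> x) \<cdot> p x) = (x \<cdot> x) \<cdot> p x" by (simp only: mult_mult_p)
  then show ?thesis unfolding ea_mult[of x "x \<cdot> x"] ea_square by simp
qed

lemma kk_p: "kk x v = ld (p x) (ea x v) \<cdot> p x"
proof -
  define w where "w = ld (p x) (ea x v)"
  have "(x \<cdot> kk x v) \<cdot> x = (ea x x \<cdot> ea x v) \<cdot> ea x x"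
    by (simp add: k_comm ea_conj ea_mult)
  also have "\<dots> = ((ea x x \<cdot> ea x v) \<cdot> p x) \<cdot> x" by (simp add: mult_p_mult_right)
  finally have "x \<cdot> kk x v = (ea x x \<cdot> (p x \<cdot> w)) \<cdot> p x" by (simp add: w_def)
  moreover have "ea x x \<cdot> (p x \<cdot> w) = x \<cdot> w"
  proof -
    have "ea x (x \<cdot> (p x \<cdot> ei x w)) = ea x (ei x x \<cdot> ei x w)" by (simp add: mult_p_mult)
    then show ?thesis by (simp add: ea_mult ea_p)
  qed
  ultimately show ?thesis by (simp add: mult_p_assoc_right w_def)
qed

text \<open>By \<open>kk_p\<close> the map \<open>t\<close> is \<open>kk x\<close> after
  \<open>ei x\<close>, hence an automorphism. It is also the third component of the autotopism of
  \<open>q\<close>, and comparing the two properties puts \<open>q\<close> into the middle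
  nucleus.\<close>

lemma p_assoc: "(a \<cdot> p x) \<cdot> s = a \<cdot> (p x \<cdot> s)"
proof -
  define q where "q = p x"
  define t where "t u = ld q u \<cdot> q" for u
  have "t u = kk x (ei x u)" for u by (simp add: t_def q_def kk_p)
  then have t: "t (u \<cdot> v) = t u \<cdot> t v" for u v by (simp add: ei_mult kk_mult)
  have tq: "t q = q" by (simp add: t_def)
  have 1: "ld q (v \<cdot> q) = ld q v \<cdot> q" for v
    using t[of v q] unfolding tq by (simp add: t_def)
  obtain v where s: "s = ld q (v \<cdot> q)" by (metis ld_mult rd_mult)
  have "a \<cdot> (v \<cdot> q) = t ((q \<cdot> a) \<cdot> v)" unfolding t_def by (metis div_mult ld_mult)
  also have "\<dots> = (a \<cdot> q) \<cdot> (ld q v \<cdot> q)" unfolding t[of "q \<cdot> a"] by (simp add: t_def)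
  finally show ?thesis by (simp add: s 1[symmetric] flip: q_def)
qed

subsection \<open>The nucleus\<close>

definition Nuc where
  "Nuc = {a. \<forall>u v. a \<cdot> (u \<cdot> v) = (a \<cdot> u) \<cdot> v \<and> u \<cdot> (a \<cdot> v) = (u \<cdot> a) \<cdot> v \<and> u \<cdot> (v \<cdot> a) = (u \<cdot> v) \<cdot> a}"

lemma Nuc_l: "a \<in> Nuc \<Longrightarrow> (a \<cdot> u) \<cdot> v = a \<cdot> (u \<cdot> v)"
  and Nuc_m: "a \<in> Nuc \<Longrightarrow> (u \<cdot> a) \<cdot> v = u \<cdot> (a \<cdot> v)"
  and Nuc_r: "a \<in> Nuc \<Longrightarrow> (u \<cdot> v) \<cdot> a = u \<cdot> (v \<cdot> a)"
  by (simp_all add: Nuc_def)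

text \<open>The law carries each one-sided nuclear identity to another one. So the left, middle and
  right nuclei coincide, and a single identity suffices in \<open>NucI_m\<close>,
  \<open>NucI_l\<close> and \<open>NucI_r\<close>.\<close>

lemma nuc_l_imp_m:
  assumes "\<And>u v. a \<cdot> (u \<cdot> v) = (a \<cdot> u) \<cdot> v" shows "u \<cdot> (a \<cdot> v) = (u \<cdot> a) \<cdot> v"
  using law[of u a v] by (simp add: assms ld_eq_iff)

lemma nuc_m_imp_l:
  assumes "\<And>u v. u \<cdot> (a \<cdot> v) = (u \<cdot> a) \<cdot> v" shows "a \<cdot> (u \<cdot> v) = (a \<cdot> u) \<cdot> v"
proof -
  have "ld v ((v \<cdot> a) \<cdot> u) = a \<cdot> u" by (simp flip: assms)
  then have "rd (a \<cdot> (u \<cdot> v)) v = a \<cdot> u" by (simp only: law)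
  then show ?thesis by (simp only: rd_eq_iff)
qed

lemma nuc_m_imp_r:
  assumes "\<And>u v. u \<cdot> (a \<cdot> v) = (u \<cdot> a) \<cdot> v" shows "u \<cdot> (v \<cdot> a) = (u \<cdot> v) \<cdot> a"
  using law[of u v a] by (simp add: assms ld_eq_iff)

lemma NucI_m: assumes "\<And>u v. u \<cdot> (a \<cdot> v) = (u \<cdot> a) \<cdot> v" shows "a \<in> Nuc"
  unfolding Nuc_def using assms nuc_m_imp_l[OF assms] nuc_m_imp_r[OF assms] by blast

lemma NucI_l: assumes "\<And>u v. a \<cdot> (u \<cdot> v) = (a \<cdot> u) \<cdot> v" shows "a \<in> Nuc"
  by (rule NucI_m) (rule nuc_l_imp_m[OF assms])

lemma opposite_Nuc_l:
  assumes "\<And>u v. u \<cdot> (v \<cdot> a) = (u \<cdot> v) \<cdot> a" shows "u \<cdot> (a \<cdot> v) = (u \<cdot> a) \<cdot> v"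
  by (rule buchsteiner_algebra.nuc_l_imp_m[OF opposite, symmetric]) (rule assms[symmetric])

lemma NucI_r: assumes "\<And>u v. u \<cdot> (v \<cdot> a) = (u \<cdot> v) \<cdot> a" shows "a \<in> Nuc"
  by (rule NucI_m) (rule opposite_Nuc_l[OF assms])

lemma Nuc_unit [simp]: "u1 \<in> Nuc" by (simp add: Nuc_def)

lemma Nuc_mult: "a \<in> Nuc \<Longrightarrow> b \<in> Nuc \<Longrightarrow> a \<cdot> b \<in> Nuc"
  by (rule NucI_l) (simp add: Nuc_l)

lemma Nuc_inv: assumes "a \<in> Nuc" shows "rv a \<in> Nuc" "rv a \<cdot> a = u1" "rv a \<cdot> (a \<cdot> u) = u" "a \<cdot> (rv a \<cdot> u) = u"
proof -
  show 3: "a \<cdot> (rv a \<cdot> u) = u" for u using Nuc_l[OF assms, of "rv a" u] by simp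
  have "a \<cdot> (rv a \<cdot> a) = a \<cdot> u1" by (simp only: 3 unit_r)
  then show "rv a \<cdot> a = u1" by (simp only: cancel_l)
  have "a \<cdot> (rv a \<cdot> (a \<cdot> u)) = a \<cdot> u" by (simp only: 3)
  then show "rv a \<cdot> (a \<cdot> u) = u" by (simp only: cancel_l)
  show "rv a \<in> Nuc"
  proof (rule NucI_l)
    fix u v
    have "a \<cdot> (rv a \<cdot> (u \<cdot> v)) = a \<cdot> (rv a \<cdot> u \<cdot> v)"
      using Nuc_l[OF assms, of "rv a \<cdot> u" v] by (simp only: 3)
    then show "rv a \<cdot> (u \<cdot> v) = rv a \<cdot> u \<cdot> v" by (simp only: cancel_l)
  qed
qed

lemma Nuc_cancel_left: assumes "a \<in> Nuc" "a \<cdot> b \<in> Nuc" shows "b \<in> Nuc"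
  using Nuc_mult[OF Nuc_inv(1)[OF assms(1)] assms(2)] by (simp only: Nuc_inv(3)[OF assms(1)])

lemma Nuc_cancel_right: assumes "a \<in> Nuc" "b \<cdot> a \<in> Nuc" shows "b \<in> Nuc"
  using Nuc_mult[OF assms(2) Nuc_inv(1)[OF assms(1)]] Nuc_m[OF assms(1), of b "rv a"] by simp

text \<open>For nuclear \<open>n\<close> this is conjugation by \<open>x\<close>; by
  \<open>cj_mult\<close> it is a right action of the loop on its nucleus.\<close>

definition cj where "cj n x = ld x (n \<cdot> x)"

lemma mult_cj: "x \<cdot> cj n x = n \<cdot> x" by (simp add: cj_def)

text \<open>The map \<open>b\<close>, which is
  \<open>R\<^sub>x R\<^sub>n R\<^sub>x\<inverse>\<close>, commutes with all left translations by the
  autotopism of \<open>x\<close>. Such a map is right multiplication by an element of the right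
  nucleus.\<close>

lemma cj_Nuc: assumes n: "n \<in> Nuc" shows "cj n x \<in> Nuc"
proof -
  define b where "b v = (rd v x \<cdot> n) \<cdot> x" for v
  have "ld x t \<cdot> b v = b (ld x t \<cdot> v)" for t v
  proof -
    have "ld x t \<cdot> b v = ld x ((t \<cdot> rd v x) \<cdot> n) \<cdot> x"
      by (simp add: b_def div_mult Nuc_r n)
    also have "\<dots> = (ld x (t \<cdot> rd v x) \<cdot> n) \<cdot> x"
      by (metis Nuc_r n ld_mult mult_ld)
    also have "ld x (t \<cdot> rd v x) = rd (ld x t \<cdot> v) x"
      by (metis div_mult rd_mult mult_rd)
    finally show ?thesis by (simp add: b_def)
  qed
  then have b: "u \<cdot> b v = b (u \<cdot> v)" for u v by (metis ld_mult)
  define m where "m = b u1"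
  have bm: "b u = u \<cdot> m" for u by (simp add: m_def b)
  have "m \<in> Nuc" by (rule NucI_r) (simp add: b flip: bm)
  moreover have "m = cj n x" using bm[of x] by (simp add: b_def cj_def ld_eq_iff)
  ultimately show ?thesis by simp
qed

lemma opposite_Nuc: "buchsteiner_algebra.Nuc (\<lambda>x y. y \<cdot> x) = Nuc"
  unfolding buchsteiner_algebra.Nuc_def[OF opposite] Nuc_def by auto

lemma cj_rd_Nuc: "n \<in> Nuc \<Longrightarrow> rd (x \<cdot> n) x \<in> Nuc"
  using buchsteiner_algebra.cj_Nuc[OF opposite, of n x]
  by (simp add: buchsteiner_algebra.cj_def[OF opposite] opposite_Nuc)

lemma p_Nuc: "p x \<in> Nuc" by (rule NucI_m) (simp add: p_assoc)

lemma rv_eq: "rv x = lv x \<cdot> p (lv x)"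
proof -
  have "ea (lv x) (rv x) = lv x" unfolding ea_def by simp
  then have "ei (lv x) (lv x) = rv x" using ei_ea[of "lv x" "rv x"] by (simp only:)
  then show ?thesis by (simp only: mult_p)
qed

lemma rv_mult_Nuc: "rv x \<cdot> x \<in> Nuc"
proof -
  have "rv x \<cdot> x = (lv x \<cdot> x) \<cdot> cj (p (lv x)) x"
    by (simp add: rv_eq[of x] Nuc_m p_Nuc Nuc_r cj_Nuc mult_cj del: rd_mult)
  then show ?thesis by (simp add: cj_Nuc p_Nuc)
qed

lemma mult_lv_Nuc: "x \<cdot> lv x \<in> Nuc"
  using buchsteiner_algebra.rv_mult_Nuc[OF opposite] by (simp add: opposite_Nuc)

text \<open>Up to the nuclear factor \<open>m\<close>, the element \<open>t\<close> is
  \<open>lv w\<close>. So \<open>w \<cdot> t\<close> is a conjugate of \<open>m\<close> times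
  \<open>w \<cdot> lv w\<close>.\<close>

lemma Nuc_commute: assumes m: "t \<cdot> w \<in> Nuc" shows "w \<cdot> t \<in> Nuc"
proof -
  define m where "m = t \<cdot> w"
  have mN: "m \<in> Nuc" using m by (simp add: m_def)
  have "(rv m \<cdot> t) \<cdot> w = u1" by (simp add: Nuc_l Nuc_inv mN flip: m_def)
  then have "lv w = rv m \<cdot> t" by (simp only: rd_eq_iff)
  then have "t = m \<cdot> lv w" using Nuc_inv(4)[OF mN, of t] by (simp only:)
  then have "w \<cdot> t = (rd (w \<cdot> m) w \<cdot> w) \<cdot> lv w" by (simp only: rd_mult Nuc_m[OF mN])
  also have "\<dots> = rd (w \<cdot> m) w \<cdot> (w \<cdot> lv w)" by (rule Nuc_l[OF cj_rd_Nuc[OF mN]])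
  also have "\<dots> \<in> Nuc" by (intro Nuc_mult cj_rd_Nuc mN mult_lv_Nuc)
  finally show ?thesis .
qed

text \<open>With \<open>lv x\<close> in place of \<open>rv x\<close> and the factors exchanged, the
  companion is \<open>rv y \<cdot> y\<close>. \<open>Nuc_commute\<close> undoes the exchange, and
  passing back to \<open>rv x\<close> costs the nuclear factor \<open>p (lv x)\<close>.\<close>

lemma companion_Nuc: "(x \<cdot> y) \<cdot> ld y (rv x) \<in> Nuc"
proof -
  define t where "t = ld y (lv x)"
  have "t \<cdot> (x \<cdot> y) = ld y (lv x \<cdot> x) \<cdot> y" unfolding t_def by (rule div_mult)
  then have "t \<cdot> (x \<cdot> y) \<in> Nuc" using rv_mult_Nuc[of y] by (simp only: rd_mult)
  then have 1: "(x \<cdot> y) \<cdot> t \<in> Nuc" by (rule Nuc_commute)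
  have "y \<cdot> (t \<cdot> p (lv x)) = (y \<cdot> t) \<cdot> p (lv x)" by (rule Nuc_r[OF p_Nuc, symmetric])
  also have "\<dots> = rv x" unfolding t_def mult_ld by (rule rv_eq[symmetric])
  finally have "ld y (rv x) = t \<cdot> p (lv x)" by (metis ld_mult)
  then have "(x \<cdot> y) \<cdot> ld y (rv x) = ((x \<cdot> y) \<cdot> t) \<cdot> p (lv x)"
    by (simp only: Nuc_r[OF p_Nuc])
  then show ?thesis using Nuc_mult[OF 1 p_Nuc] by (simp only:)
qed

lemma auto_k: "auto (k x y)" and auto_h: "auto (h x y)"
  by (rule k_auto_if(1), rule Nuc_l[OF companion_Nuc, symmetric])
    (rule k_auto_if(2), rule Nuc_l[OF companion_Nuc, symmetric])

lemma k_multiplicative: "k x y (u \<cdot> v) = k x y u \<cdot> k x y v"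
  and h_multiplicative: "h x y (u \<cdot> v) = h x y u \<cdot> h x y v"
  by (rule autoD[OF auto_k], rule autoD[OF auto_h])

subsection \<open>Right multiplications\<close>

text \<open>The right multiplication group, generated by the right translations and their
  inverses.\<close>

inductive RM :: "('b \<Rightarrow> 'b) \<Rightarrow> bool" where
  RM_id: "RM (\<lambda>u. u)"
| RM_mult: "RM g \<Longrightarrow> RM (\<lambda>u. g u \<cdot> x)"
| RM_rd: "RM g \<Longrightarrow> RM (\<lambda>u. rd (g u) x)"

lemma RM_comp: assumes "RM g" and f: "RM f" shows "RM (\<lambda>u. g (f u))"
  using assms(1)
proof induction
  case RM_id show ?case by (rule f)
next
  case (RM_mult g x) show ?case by (rule RM.RM_mult[OF RM_mult.IH])
next
  case (RM_rd g x) show ?case by (rule RM.RM_rd[OF RM_rd.IH])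
qed

text \<open>Left inner mappings belong to the right multiplication group because they are the
  inverses of right inner mappings.\<close>

lemma RM_h: "RM (h x y)" and RM_k: "RM (k x y)"
proof -
  have "h x y u = rd (rd (u \<cdot> (x \<cdot> y)) y) x" for u
    using k_mult[of x y "h x y u"] by simp
  then have "h x y = (\<lambda>u. rd (rd (u \<cdot> (x \<cdot> y)) y) x)" by auto
  moreover have "RM \<dots>" by (rule RM_rd[OF RM_rd[OF RM_mult[OF RM_id]]])
  ultimately show "RM (h x y)" by simp
  have "k x y = (\<lambda>u. rd ((u \<cdot> x) \<cdot> y) (x \<cdot> y))" by (auto simp: k_def)
  moreover have "RM \<dots>" by (rule RM_rd[OF RM_mult[OF RM_mult[OF RM_id]]])
  ultimately show "RM (k x y)" by simp
qed

text \<open>Left translations normalize the right multiplication group: \<open>L\<^sub>z\<close>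
  conjugates \<open>R\<^sub>x\<close> to right multiplication by \<open>rd x z\<close> followed by
  right division by \<open>lv z\<close>.\<close>

lemma RM_conj:
  assumes "RM g" shows "RM (\<lambda>u. z \<cdot> g (ld z u))"
  using assms
proof induction
  case RM_id then show ?case by (simp add: RM.RM_id)
next
  have *: "(z \<cdot> (a \<cdot> x)) \<cdot> lv z = (z \<cdot> a) \<cdot> rd x z" for a x
    by (simp add: mult_mult_lv mult_div)
  { case (RM_mult g x)
    have "z \<cdot> (g (ld z u) \<cdot> x) = rd ((z \<cdot> g (ld z u)) \<cdot> rd x z) (lv z)" for u
      by (metis * mult_rd)
    with RM.RM_rd[OF RM.RM_mult[OF RM_mult.IH]] show ?case by simp
  next
    case (RM_rd g x)
    have "z \<cdot> rd (g (ld z u)) x = rd ((z \<cdot> g (ld z u)) \<cdot> lv z) (rd x z)" for u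
      by (metis * mult_rd rd_mult)
    with RM.RM_rd[OF RM.RM_mult[OF RM_rd.IH]] show ?case by simp }
qed

text \<open>Collecting all right translations into a single one costs a factor \<open>k\<close> or
  \<open>h\<close> at each step, and those are automorphisms.\<close>

lemma RM_auto:
  assumes "RM g" shows "\<exists>a. auto a \<and> (\<forall>u. g u = a u \<cdot> g u1)"
  using assms
proof induction
  case RM_id then show ?case by (intro exI[of _ "\<lambda>u. u"]) (simp add: auto_def)
next
  case (RM_mult g x)
  then obtain a where a: "auto a" "\<And>u. g u = a u \<cdot> g u1" by blast
  have "auto (\<lambda>u. k (g u1) x (a u))" using a(1) auto_k unfolding auto_def by simp
  moreover have "g u \<cdot> x = k (g u1) x (a u) \<cdot> (g u1 \<cdot> x)" for u
    by (subst a(2)) (rule k_mult[symmetric])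
  ultimately show ?case by blast
next
  case (RM_rd g x)
  then obtain a where a: "auto a" "\<And>u. g u = a u \<cdot> g u1" by blast
  define c where "c = rd (g u1) x"
  have "auto (\<lambda>u. h c x (a u))" using a(1) auto_h unfolding auto_def by simp
  moreover have "rd (g u) x = h c x (a u) \<cdot> c" for u
    using k_mult[of c x "h c x (a u)"] a(2)[of u] by (simp add: c_def rd_eq_iff)
  ultimately show ?case unfolding c_def by blast
qed

text \<open>The automorphism \<open>a\<close> from \<open>RM_auto\<close> fixes \<open>t\<close> and
  exchanges the factors of \<open>Y \<cdot> t\<close>. Applied to
  \<open>b \<cdot> (t \<cdot> s)\<close>, rewritten by the autotopism of \<open>t\<close>, it yields
  the middle nuclear identity.\<close>

lemma RM_Nuc:
  assumes "RM (\<lambda>u. t \<cdot> u)" shows "t \<in> Nuc"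
proof -
  obtain a where a: "auto a" and t: "\<And>u. t \<cdot> u = a u \<cdot> t" using RM_auto[OF assms] by auto
  have at: "a t = t" using t[of t] by simp
  have aY: "a (Y \<cdot> t) = t \<cdot> Y" for Y by (simp only: autoD[OF a] at t)
  show ?thesis
  proof (rule NucI_m)
    fix b s
    have "b \<cdot> (t \<cdot> s) = b \<cdot> (a s \<cdot> t)" by (simp only: t)
    also have "\<dots> = ld t ((t \<cdot> b) \<cdot> a s) \<cdot> t" using div_mult[of t "t \<cdot> b" "a s"] by simp
    finally have "a (b \<cdot> (t \<cdot> s)) = (t \<cdot> b) \<cdot> a s" by (simp only: aY mult_ld)
    also have "\<dots> = a ((b \<cdot> t) \<cdot> s)" by (simp only: autoD[OF a] at t)
    finally have "t \<cdot> (b \<cdot> (t \<cdot> s)) = t \<cdot> ((b \<cdot> t) \<cdot> s)" by (simp only: t)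
    then show "b \<cdot> (t \<cdot> s) = (b \<cdot> t) \<cdot> s" by simp
  qed
qed

text \<open>With \<open>t \<cdot> z = h x y z\<close>, left translation by \<open>t\<close> becomes
  a product of inner mappings and a conjugate by \<open>L\<^sub>z\<close> of inner mappings, hence a
  right multiplication.\<close>

lemma h_rd_Nuc: "rd (h x y z) z \<in> Nuc"
proof (rule RM_Nuc)
  define t where "t = rd (h x y z) z"
  have "t \<cdot> v = h x y (z \<cdot> k x y (h t z (ld z v)))" for v
  proof -
    have "t \<cdot> (z \<cdot> ld z v) = (t \<cdot> z) \<cdot> h t z (ld z v)" by (simp add: mult_h)
    then show ?thesis by (simp add: h_multiplicative) (simp add: t_def)
  qed
  then have "(\<lambda>v. t \<cdot> v) = (\<lambda>v. h x y (z \<cdot> k x y (h t z (ld z v))))" by auto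
  moreover have "RM \<dots>" by (rule RM_comp[OF RM_h RM_conj[OF RM_comp[OF RM_k RM_h]]])
  ultimately show "RM (\<lambda>v. rd (h x y z) z \<cdot> v)" by (simp add: t_def)
qed

subsection \<open>Conjugation on the nucleus\<close>

lemma cj_unit [simp]: "cj u1 x = u1" "cj n u1 = n" by (simp_all add: cj_def)

lemma cj_cancel [simp]: "cj m x = cj n x \<longleftrightarrow> m = n"
  unfolding cj_def[of m] ld_eq_iff mult_cj by (rule cancel_r)

lemma cj_eq_unit [simp]: "cj n x = u1 \<longleftrightarrow> n = u1"
  using cj_cancel[of n x u1] by (simp del: cj_cancel)

lemma cj_mult: assumes n: "n \<in> Nuc" shows "cj n (x \<cdot> y) = cj (cj n x) y"
proof -
  have 1: "cj n x \<in> Nuc" by (rule cj_Nuc[OF n])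
  have "(x \<cdot> y) \<cdot> cj (cj n x) y = x \<cdot> (cj n x \<cdot> y)"
    by (simp only: Nuc_r[OF cj_Nuc[OF 1]] mult_cj)
  also have "\<dots> = n \<cdot> (x \<cdot> y)" by (simp only: mult_cj Nuc_l[OF n] flip: Nuc_m[OF 1])
  finally show ?thesis unfolding cj_def[of n "x \<cdot> y"] ld_eq_iff by (rule sym)
qed

lemma cj_prod: assumes m: "m \<in> Nuc" and n: "n \<in> Nuc" shows "cj (m \<cdot> n) x = cj m x \<cdot> cj n x"
proof -
  have "x \<cdot> (cj m x \<cdot> cj n x) = (m \<cdot> x) \<cdot> cj n x"
    by (simp only: mult_cj flip: Nuc_m[OF cj_Nuc[OF m]])
  also have "\<dots> = (m \<cdot> n) \<cdot> x" by (simp only: mult_cj Nuc_l[OF m])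
  finally show ?thesis unfolding cj_def[of "m \<cdot> n"] ld_eq_iff by (rule sym)
qed

lemma cj_surj: assumes "n \<in> Nuc" obtains m where "m \<in> Nuc" "cj m x = n"
  by (rule that[OF cj_rd_Nuc[OF assms, of x]]) (simp add: cj_def)

text \<open>The centre of the nucleus as a group; the centre of the loop is
  \<open>ZQ\<close>.\<close>

definition ZN where "ZN = {a \<in> Nuc. \<forall>n\<in>Nuc. a \<cdot> n = n \<cdot> a}"

lemma ZN_I: "a \<in> Nuc \<Longrightarrow> (\<And>n. n \<in> Nuc \<Longrightarrow> a \<cdot> n = n \<cdot> a) \<Longrightarrow> a \<in> ZN"
  unfolding ZN_def by blast

lemma ZN_Nuc: "a \<in> ZN \<Longrightarrow> a \<in> Nuc" by (simp add: ZN_def)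

lemma ZN_comm: "a \<in> ZN \<Longrightarrow> n \<in> Nuc \<Longrightarrow> a \<cdot> n = n \<cdot> a" unfolding ZN_def by blast

lemma ZN_mult: assumes "a \<in> ZN" "b \<in> ZN" shows "a \<cdot> b \<in> ZN"
proof -
  have "(a \<cdot> b) \<cdot> n = n \<cdot> (a \<cdot> b)" if n: "n \<in> Nuc" for n
  proof -
    have "(a \<cdot> b) \<cdot> n = a \<cdot> (n \<cdot> b)" by (simp only: Nuc_l[OF ZN_Nuc[OF assms(1)]] ZN_comm[OF assms(2) n])
    also have "\<dots> = (n \<cdot> a) \<cdot> b" by (simp only: ZN_comm[OF assms(1) n] flip: Nuc_l[OF ZN_Nuc[OF assms(1)]])
    finally show ?thesis by (simp only: Nuc_l[OF n])
  qed
  then show ?thesis by (rule ZN_I[OF Nuc_mult[OF ZN_Nuc[OF assms(1)] ZN_Nuc[OF assms(2)]]])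
qed

lemma cj_ZN: assumes a: "a \<in> ZN" shows "cj a x \<in> ZN"
proof -
  have "cj a x \<cdot> n = n \<cdot> cj a x" if n: "n \<in> Nuc" for n
  proof -
    obtain m where m: "m \<in> Nuc" "cj m x = n" by (rule cj_surj[OF n])
    have "cj a x \<cdot> cj m x = cj m x \<cdot> cj a x"
      unfolding cj_prod[OF ZN_Nuc[OF a] m(1), symmetric] cj_prod[OF m(1) ZN_Nuc[OF a], symmetric] ZN_comm[OF a m(1)] ..
    then show ?thesis by (simp only: m)
  qed
  then show ?thesis by (rule ZN_I[OF cj_Nuc[OF ZN_Nuc[OF a]]])
qed

lemma cj_by_Nuc: assumes "a \<in> ZN" "n \<in> Nuc" shows "cj a n = a"
  unfolding cj_def ZN_comm[OF assms] by (rule ld_mult)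

lemma ZN_assoc: "a \<in> ZN \<Longrightarrow> (a \<cdot> b) \<cdot> c = a \<cdot> (b \<cdot> c)" by (rule Nuc_l[OF ZN_Nuc])

lemma ZN_com: "a \<in> ZN \<Longrightarrow> b \<in> ZN \<Longrightarrow> a \<cdot> b = b \<cdot> a" by (rule ZN_comm[OF _ ZN_Nuc])

lemma ZN_lcom: assumes "a \<in> ZN" "b \<in> ZN" shows "a \<cdot> (b \<cdot> c) = b \<cdot> (a \<cdot> c)"
  by (simp only: ZN_com[OF assms] flip: ZN_assoc[OF assms(1)] ZN_assoc[OF assms(2)])
lemmas ZN_ac = ZN_assoc ZN_com ZN_lcom

subsection \<open>Associators\<close>

text \<open>The factor that corrects \<open>(x \<cdot> y) \<cdot> z\<close> to
  \<open>x \<cdot> (y \<cdot> z)\<close>, see \<open>mult_asc\<close>. Defined through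
  \<open>h\<close>, it is nuclear by \<open>h_rd_Nuc\<close>.\<close>

definition asc where "asc x y z = ld z (h x y z)"

lemma h_asc: "h x y z = z \<cdot> asc x y z" by (simp add: asc_def)

lemma asc_Nuc: "asc x y z \<in> Nuc"
  using cj_Nuc[OF h_rd_Nuc, of x y z z] by (simp add: cj_def asc_def)

lemma mult_asc: "x \<cdot> (y \<cdot> z) = ((x \<cdot> y) \<cdot> z) \<cdot> asc x y z"
  by (simp only: Nuc_r[OF asc_Nuc] mult_h flip: h_asc)

lemma h_Nuc: assumes "n \<in> Nuc" shows "h x y n = n"
  by (simp add: h_def flip: Nuc_r[OF assms])

text \<open>\<open>h x y\<close> is multiplicative and fixes the nucleus pointwise; it is applied to
  both sides of \<open>z \<cdot> n = m \<cdot> z\<close>.\<close>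

lemma asc_ZN: "asc x y z \<in> ZN"
proof -
  have "asc x y z \<cdot> n = n \<cdot> asc x y z" if n: "n \<in> Nuc" for n
  proof -
    define m where "m = rd (z \<cdot> n) z"
    have m: "m \<in> Nuc" "z \<cdot> n = m \<cdot> z" using cj_rd_Nuc[OF n] by (simp_all add: m_def)
    have "z \<cdot> (asc x y z \<cdot> n) = h x y (z \<cdot> n)"
      by (simp only: h_multiplicative h_Nuc[OF n] h_asc[of x y z] Nuc_m[OF asc_Nuc])
    also have "\<dots> = m \<cdot> (z \<cdot> asc x y z)"
      by (simp only: m h_multiplicative h_Nuc[OF m(1)] flip: h_asc)
    also have "\<dots> = z \<cdot> (n \<cdot> asc x y z)"
      by (simp only: flip: Nuc_l[OF m(1)] m(2)) (simp only: Nuc_m[OF n])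
    finally show ?thesis by simp
  qed
  then show ?thesis by (rule ZN_I[OF asc_Nuc])
qed

text \<open>This is \<open>h_comm\<close> written in associators.\<close>

lemma asc_cyc: "asc y u x \<cdot> cj (asc x y u) x = u1"
proof -
  define a where "a = cj (asc x y u) x"
  have a: "a \<in> Nuc" unfolding a_def by (rule cj_Nuc[OF asc_Nuc])
  have "h x y u \<cdot> x = (u \<cdot> x) \<cdot> a"
    by (simp only: h_asc Nuc_m[OF asc_Nuc] Nuc_r[OF a]) (simp only: a_def mult_cj)
  then have "(y \<cdot> u) \<cdot> x = (y \<cdot> (u \<cdot> x)) \<cdot> a" by (simp only: h_comm[of y u x] Nuc_r[OF a])
  also have "\<dots> = ((y \<cdot> u) \<cdot> x) \<cdot> (asc y u x \<cdot> a)" by (simp only: mult_asc[of y u x] Nuc_r[OF a])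
  finally have "((y \<cdot> u) \<cdot> x) \<cdot> u1 = ((y \<cdot> u) \<cdot> x) \<cdot> (asc y u x \<cdot> a)" by (simp only: unit_r)
  then show ?thesis unfolding a_def cancel_l by simp
qed

text \<open>Multiplicativity of \<open>h x y\<close>.\<close>

lemma asc_mult3: "asc x y (z \<cdot> w) = cj (asc x y z) w \<cdot> asc x y w"
proof -
  have "(z \<cdot> w) \<cdot> (cj (asc x y z) w \<cdot> asc x y w) = (z \<cdot> (asc x y z \<cdot> w)) \<cdot> asc x y w"
    by (simp only: mult_cj Nuc_r[OF cj_Nuc[OF asc_Nuc]] flip: Nuc_m[OF cj_Nuc[OF asc_Nuc]])
  also have "\<dots> = h x y (z \<cdot> w)"
    by (simp only: h_multiplicative h_asc[of x y z] h_asc[of x y w] Nuc_m[OF asc_Nuc[of x y z]]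
        flip: Nuc_r[OF asc_Nuc[of x y w]])
  finally show ?thesis by (simp add: h_asc)
qed

text \<open>Two applications of \<open>asc_cyc\<close>.\<close>

lemma asc_rot: "asc x y z = cj (asc y z x) (y \<cdot> z)"
proof -
  have "cj (asc z x y \<cdot> cj (asc y z x) y) z = u1" by (simp only: asc_cyc cj_unit)
  then have "cj (asc z x y) z \<cdot> cj (asc y z x) (y \<cdot> z) = u1"
    by (simp only: cj_prod[OF asc_Nuc cj_Nuc[OF asc_Nuc]] cj_mult[OF asc_Nuc])
  moreover have "cj (asc z x y) z \<cdot> asc x y z = u1"
    using asc_cyc[of x y z] ZN_com[OF asc_ZN[of x y z] cj_ZN[OF asc_ZN[of z x y]], of z] by (simp only:)
  ultimately have "cj (asc z x y) z \<cdot> asc x y z = cj (asc z x y) z \<cdot> cj (asc y z x) (y \<cdot> z)"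
    by (simp only:)
  then show ?thesis by (simp only: cancel_l)
qed

text \<open>Two routes through the bracketings of \<open>x\<close>, \<open>y\<close>,
  \<open>z\<close>, \<open>w\<close> are compared; \<open>cj (asc x y z) w\<close> occurs on both,
  by \<open>asc_mult3\<close>, and cancels.\<close>

lemma asc_pentagon: "asc x (y \<cdot> z) w \<cdot> asc y z w = asc (x \<cdot> y) z w \<cdot> asc x y w"
proof -
  define T where "T = ((x \<cdot> y) \<cdot> z) \<cdot> w"
  have 1: "x \<cdot> (y \<cdot> (z \<cdot> w)) = T \<cdot> (asc (x \<cdot> y) z w \<cdot> asc x y (z \<cdot> w))"
    unfolding mult_asc[of x y "z \<cdot> w"] mult_asc[of "x \<cdot> y" z w] T_def by (rule Nuc_r[OF asc_Nuc])
  have "(x \<cdot> (y \<cdot> z)) \<cdot> w = T \<cdot> cj (asc x y z) w"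
    unfolding T_def Nuc_r[OF cj_Nuc[OF asc_Nuc]] mult_cj mult_asc[of x y z] by (rule Nuc_m[OF asc_Nuc])
  then have "x \<cdot> ((y \<cdot> z) \<cdot> w) = T \<cdot> (cj (asc x y z) w \<cdot> asc x (y \<cdot> z) w)"
    unfolding mult_asc[of x "y \<cdot> z" w] by (simp only: Nuc_r[OF asc_Nuc])
  then have 2: "x \<cdot> (y \<cdot> (z \<cdot> w)) = T \<cdot> ((cj (asc x y z) w \<cdot> asc x (y \<cdot> z) w) \<cdot> asc y z w)"
    unfolding mult_asc[of y z w] by (simp only: flip: Nuc_r[OF asc_Nuc])
  from 1 2 have "(cj (asc x y z) w \<cdot> asc x (y \<cdot> z) w) \<cdot> asc y z w = asc (x \<cdot> y) z w \<cdot> asc x y (z \<cdot> w)"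
    by simp
  then have "cj (asc x y z) w \<cdot> (asc x (y \<cdot> z) w \<cdot> asc y z w) = cj (asc x y z) w \<cdot> (asc (x \<cdot> y) z w \<cdot> asc x y w)"
    by (simp only: asc_mult3 ZN_ac asc_ZN cj_ZN ZN_mult)
  then show ?thesis by simp
qed

lemma asc_mult1: "asc (x \<cdot> y) z w = cj (asc z w x) (y \<cdot> (z \<cdot> w)) \<cdot> asc y z w"
proof -
  have "asc (x \<cdot> y) z w = cj (cj (asc z w x) y \<cdot> asc z w y) (z \<cdot> w)"
    by (simp only: asc_rot[of "x \<cdot> y" z w] asc_mult3)
  also have "\<dots> = cj (cj (asc z w x) y) (z \<cdot> w) \<cdot> cj (asc z w y) (z \<cdot> w)"
    by (rule cj_prod[OF cj_Nuc[OF asc_Nuc] asc_Nuc])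
  finally show ?thesis by (simp only: cj_mult[OF asc_Nuc, of _ _ _ y] flip: asc_rot)
qed

lemma asc_mult2: "asc x (y \<cdot> z) w = cj (asc z w x) (y \<cdot> (z \<cdot> w)) \<cdot> asc x y w"
proof -
  have "asc y z w \<cdot> asc x (y \<cdot> z) w = asc y z w \<cdot> (cj (asc z w x) (y \<cdot> (z \<cdot> w)) \<cdot> asc x y w)"
    using asc_pentagon[of x y z w] by (simp only: asc_mult1 ZN_ac asc_ZN cj_ZN ZN_mult)
  then show ?thesis by simp
qed

text \<open>A second expansion in the middle argument, through \<open>asc_cyc\<close> and
  \<open>asc_mult3\<close>. Its comparison with \<open>asc_mult2\<close> drives
  \<open>commutator_Nuc\<close>.\<close>

lemma asc_mult2': "asc x (y \<cdot> z) w \<cdot> cj (asc w x y) (z \<cdot> w) = asc x z w"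
proof -
  have "asc x (y \<cdot> z) w \<cdot> (cj (asc w x y) (z \<cdot> w) \<cdot> cj (asc w x z) w) = u1"
    using asc_cyc[of x "y \<cdot> z" w]
    by (simp only: asc_mult3 cj_prod[OF cj_Nuc[OF asc_Nuc] asc_Nuc] cj_mult[OF asc_Nuc, of _ _ _ z])
  then have "cj (asc w x z) w \<cdot> (asc x (y \<cdot> z) w \<cdot> cj (asc w x y) (z \<cdot> w)) = cj (asc w x z) w \<cdot> asc x z w"
    using asc_cyc[of x z w] by (simp only: ZN_ac asc_ZN cj_ZN ZN_mult)
  then show ?thesis by simp
qed

text \<open>Expanding \<open>asc (x' \<cdot> x) y (z \<cdot> z')\<close> in the first and in the third argument shows that
  the action of the quotient by the nucleus on associators is commutative.\<close>

lemma cj_asc_commute: "cj (asc x y z) (s \<cdot> b) = cj (asc x y z) (b \<cdot> s)"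
proof -
  \<comment> \<open>\<open>w\<close> and \<open>c\<close> are \<open>s\<close> and \<open>b\<close>
    moved to the left of \<open>z\<close> and of \<open>y \<cdot> (w \<cdot> z)\<close>; on nuclear
    elements \<open>w'\<close> and \<open>c'\<close> trade their actions for those of
    \<open>s\<close> and \<open>b\<close>.\<close>
  define w where "w = rd (z \<cdot> s) z"
  have w: "w \<cdot> z = z \<cdot> s" by (simp add: w_def)
  define c where "c = rd ((y \<cdot> (w \<cdot> z)) \<cdot> b) (y \<cdot> (w \<cdot> z))"
  have c: "c \<cdot> (y \<cdot> (w \<cdot> z)) = (y \<cdot> (w \<cdot> z)) \<cdot> b" by (simp add: c_def)
  have c': "cj (cj (cj (cj n c) y) w) z = cj (cj (cj (cj n y) w) z) b" if n: "n \<in> Nuc" for n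
    using arg_cong[OF c, of "cj n"] n by (simp only: cj_mult cj_Nuc)
  have w': "cj (cj n w) z = cj (cj n z) s" if n: "n \<in> Nuc" for n
    using arg_cong[OF w, of "cj n"] n by (simp only: cj_mult cj_Nuc)
  have 1: "asc (x \<cdot> c) y (w \<cdot> z)
      = (cj (cj (asc x y w) z) b \<cdot> cj (asc x y z) b) \<cdot> asc c y (w \<cdot> z)"
    unfolding asc_mult1[of x c] c cj_mult[OF asc_Nuc] asc_rot[of x y "w \<cdot> z", symmetric]
    unfolding cj_mult[OF asc_Nuc, symmetric] asc_rot[of x y "w \<cdot> z", symmetric]
      asc_mult3 cj_prod[OF cj_Nuc[OF asc_Nuc] asc_Nuc] ..
  have 2: "asc (x \<cdot> c) y (w \<cdot> z)
      = (cj (cj (asc x y w) z) b \<cdot> cj (cj (asc y z x) c) (y \<cdot> z)) \<cdot> asc c y (w \<cdot> z)"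
  proof -
    have a: "cj (cj (cj (asc y w x) c) (y \<cdot> w)) z = cj (cj (asc x y w) z) b"
      unfolding asc_rot[of x y w] by (simp only: cj_mult asc_Nuc cj_Nuc c')
    have "asc (x \<cdot> c) y (w \<cdot> z) = (cj (cj (cj (asc y w x) c) (y \<cdot> w)) z \<cdot> cj (asc c y w) z)
        \<cdot> (cj (cj (asc y z x) c) (y \<cdot> z) \<cdot> asc c y z)"
      unfolding asc_mult3 asc_mult1[of x c] cj_mult[OF asc_Nuc, of _ _ _ c]
        cj_prod[OF cj_Nuc[OF cj_Nuc[OF asc_Nuc]] asc_Nuc] ..
    then show ?thesis unfolding a asc_mult3 by (simp only: ZN_ac asc_ZN cj_ZN ZN_mult)
  qed
  from 1 2 have "cj (asc x y z) b = cj (cj (asc y z x) c) (y \<cdot> z)" by simp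
  then have "cj (asc x y z) (b \<cdot> s) = cj (cj (cj (cj (asc y z x) c) y) z) s"
    by (simp only: cj_mult asc_Nuc cj_Nuc)
  also have "\<dots> = cj (cj (cj (asc y z x) c) (y \<cdot> w)) z"
    by (simp only: cj_mult asc_Nuc cj_Nuc w')
  also have "\<dots> = cj (cj (cj (cj (asc y z x) y) w) z) b"
    by (simp only: cj_mult asc_Nuc cj_Nuc c')
  also have "\<dots> = cj (asc x y z) (s \<cdot> b)"
    unfolding asc_rot[of x y z] by (simp only: cj_mult asc_Nuc cj_Nuc w')
  finally show ?thesis ..
qed

text \<open>Exchanging \<open>y\<close> and \<open>z\<close> inside an associator has no effect, so
  the commutator \<open>c\<close> contributes nothing there; all associators starting with
  \<open>c\<close> vanish.\<close>

lemma commutator_Nuc: "ld (z \<cdot> y) (y \<cdot> z) \<in> Nuc"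
proof -
  define c where "c = ld (z \<cdot> y) (y \<cdot> z)"
  have c: "(z \<cdot> y) \<cdot> c = y \<cdot> z" by (simp add: c_def)
  \<comment> \<open>\<open>asc_mult2\<close> expands the left side and \<open>asc_mult2'\<close> the
    right one; they agree by \<open>cj_asc_commute\<close>.\<close>
  have swap: "asc x (y \<cdot> z) w = asc x (z \<cdot> y) w" for x w
  proof -
    define a where "a = asc z w x"
    have a: "a \<in> Nuc" unfolding a_def by (rule asc_Nuc)
    have "cj a (y \<cdot> (z \<cdot> w)) = cj a (z \<cdot> (y \<cdot> w))"
      using cj_asc_commute[of z w x y z] by (simp only: cj_mult cj_Nuc a flip: a_def)
    moreover have "cj (asc w x z \<cdot> cj a z) (y \<cdot> w) = u1"
      using asc_cyc[of w x z] by (simp only: a_def cj_unit)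
    ultimately have 1: "cj (asc w x z) (y \<cdot> w) \<cdot> cj a (y \<cdot> (z \<cdot> w)) = u1"
      by (simp only: cj_prod[OF asc_Nuc cj_Nuc[OF a]] cj_mult[OF a, of z])
    have "cj (asc w x z) (y \<cdot> w) \<cdot> asc x (y \<cdot> z) w
        = (cj (asc w x z) (y \<cdot> w) \<cdot> cj a (y \<cdot> (z \<cdot> w))) \<cdot> asc x y w"
      unfolding asc_mult2 a_def by (rule ZN_assoc[OF cj_ZN[OF asc_ZN], symmetric])
    also have "\<dots> = cj (asc w x z) (y \<cdot> w) \<cdot> asc x (z \<cdot> y) w"
      unfolding 1 using asc_mult2'[of x z y w] by (simp only: unit_l ZN_com asc_ZN cj_ZN)
    finally show ?thesis by (simp only: cancel_l)
  qed
  have "asc c w x = u1" for w x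
  proof -
    have "asc x ((z \<cdot> y) \<cdot> c) w = asc x (z \<cdot> y) w" by (simp only: c swap)
    then have "cj (asc c w x) ((z \<cdot> y) \<cdot> (c \<cdot> w)) \<cdot> asc x (z \<cdot> y) w = u1 \<cdot> asc x (z \<cdot> y) w"
      by (simp only: asc_mult2 unit_l)
    then show ?thesis by (simp only: cancel_r cj_eq_unit)
  qed
  then have "c \<in> Nuc" by (intro NucI_l) (simp add: mult_asc[of c])
  then show ?thesis by (simp only: c_def)
qed

lemma asc_unit3: assumes "n \<in> Nuc" shows "asc x y n = u1"
  by (simp add: asc_def h_Nuc[OF assms])

lemma asc_unit2: assumes "n \<in> Nuc" shows "asc x n y = u1"
  by (simp add: mult_asc asc_rot[of x n y] asc_rot[of n y x] asc_unit3[OF assms])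

lemma asc_unit1: assumes "n \<in> Nuc" shows "asc n x y = u1"
  by (simp add: asc_rot[of n x y] asc_unit3[OF assms])

lemma asc_mult1': "asc (x \<cdot> y) z w = cj (asc x z w) y \<cdot> asc y z w"
  unfolding asc_mult1 cj_asc_commute[of z w x y] cj_mult[OF asc_Nuc, of _ _ _ "z \<cdot> w"] asc_rot[symmetric] ..

text \<open>This and its two companions make associators functions on the quotient by the nucleus,
  which is commutative by \<open>commutator_Nuc\<close>.\<close>

lemma asc_coset1: assumes "n \<in> Nuc" shows "asc (x \<cdot> n) y z = asc x y z"
  by (simp add: asc_mult1' asc_unit1 cj_by_Nuc[OF asc_ZN] assms)

lemma asc_coset2: assumes "n \<in> Nuc" shows "asc x (y \<cdot> n) z = asc x y z"
  by (simp add: asc_mult2 asc_unit1[OF assms])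

lemma asc_coset3: assumes "n \<in> Nuc" shows "asc x y (z \<cdot> n) = asc x y z"
  by (simp add: asc_mult3 asc_unit3 cj_by_Nuc[OF asc_ZN] assms)

section \<open>Commutators and their interplay with associators\<close>

definition cm where "cm x y = ld (y \<cdot> x) (x \<cdot> y)"

lemma cm_Nuc: "cm x y \<in> Nuc" unfolding cm_def by (rule commutator_Nuc)

lemma mult_cm: "x \<cdot> y = (y \<cdot> x) \<cdot> cm x y" by (simp add: cm_def)

lemma asc_mult2_right: "asc x (y \<cdot> z) w = cj (asc x y w) z \<cdot> asc x z w"
proof -
  have "asc x (y \<cdot> z) w = asc x (z \<cdot> y) w" unfolding mult_cm[of y z] by (rule asc_coset2[OF cm_Nuc])
  then show ?thesis
    unfolding asc_mult2[of x z y] cj_asc_commute[of y w x z] cj_mult[OF asc_Nuc, of _ _ _ "y \<cdot> w"] asc_rot[symmetric] .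
qed

text \<open>\<open>z \<cdot> w\<close> and \<open>w \<cdot> z\<close> lie in the same coset of the
  nucleus, so the two expansions agree.\<close>

lemma asc_commute3: "cj (asc x y z) w \<cdot> asc x y w = cj (asc x y w) z \<cdot> asc x y z"
  using asc_coset3[OF cm_Nuc, of x y "w \<cdot> z" z w] unfolding mult_cm[of z w, symmetric] asc_mult3 .

lemma asc_commute2: "cj (asc x z y) w \<cdot> asc x w y = cj (asc x w y) z \<cdot> asc x z y"
  using asc_coset2[OF cm_Nuc, of x "w \<cdot> z" z w y] unfolding mult_cm[of z w, symmetric] asc_mult2_right .

lemma asc_inverse: "asc x y z \<cdot> cj (asc x y z) (x \<cdot> (y \<cdot> z)) = u1"
proof -
  have "cj (asc y z x \<cdot> cj (asc x y z) x) (y \<cdot> z) = u1" by (simp only: asc_cyc cj_unit)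
  then show ?thesis
    by (simp only: cj_prod[OF asc_Nuc cj_Nuc[OF asc_Nuc]] cj_mult[OF asc_Nuc, of _ _ _ x] flip: asc_rot)
qed

text \<open>In \<open>x \<cdot> (y \<cdot> z)\<close> the element \<open>z\<close> is moved past
  \<open>y\<close> and then past \<open>x\<close>; the result is compared with moving it past
  \<open>x \<cdot> y\<close> at once.\<close>

lemma cm_mult:
  "cm (x \<cdot> y) z \<cdot> (asc z x y \<cdot> asc x y z) = (cj (cm x z) y \<cdot> cm y z) \<cdot> asc x z y"
proof -
  define T where "T = z \<cdot> (x \<cdot> y)"
  have "(x \<cdot> z) \<cdot> y = (((z \<cdot> x) \<cdot> y) \<cdot> cj (cm x z) y)"
    unfolding mult_cm[of x z] Nuc_r[OF cj_Nuc[OF cm_Nuc]] mult_cj by (rule Nuc_m[OF cm_Nuc])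
  then have 1: "x \<cdot> (z \<cdot> y) = ((z \<cdot> x) \<cdot> y) \<cdot> (cj (cm x z) y \<cdot> asc x z y)"
    unfolding mult_asc[of x z y] by (simp only: Nuc_r[OF asc_Nuc])
  have 2: "T = ((z \<cdot> x) \<cdot> y) \<cdot> asc z x y" unfolding T_def by (rule mult_asc)
  have "x \<cdot> (y \<cdot> z) = (x \<cdot> (z \<cdot> y)) \<cdot> cm y z" unfolding mult_cm[of y z] by (rule Nuc_r[OF cm_Nuc, symmetric])
  also have "\<dots> = ((z \<cdot> x) \<cdot> y) \<cdot> ((cj (cm x z) y \<cdot> asc x z y) \<cdot> cm y z)"
    unfolding 1 by (rule Nuc_r[OF cm_Nuc])
  also have "(cj (cm x z) y \<cdot> asc x z y) \<cdot> cm y z = (cj (cm x z) y \<cdot> cm y z) \<cdot> asc x z y"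
    unfolding Nuc_l[OF cj_Nuc[OF cm_Nuc]] ZN_comm[OF asc_ZN cm_Nuc] ..
  finally have 3: "x \<cdot> (y \<cdot> z) = ((z \<cdot> x) \<cdot> y) \<cdot> ((cj (cm x z) y \<cdot> cm y z) \<cdot> asc x z y)" .
  have "x \<cdot> (y \<cdot> z) = (T \<cdot> cm (x \<cdot> y) z) \<cdot> asc x y z"
    unfolding mult_asc[of x y z] mult_cm[of "x \<cdot> y" z] T_def ..
  also have "\<dots> = ((z \<cdot> x) \<cdot> y) \<cdot> ((asc z x y \<cdot> cm (x \<cdot> y) z) \<cdot> asc x y z)"
    unfolding 2 Nuc_r[OF asc_Nuc[of x y z]] Nuc_m[OF asc_Nuc[of z x y]] ..
  also have "(asc z x y \<cdot> cm (x \<cdot> y) z) \<cdot> asc x y z = cm (x \<cdot> y) z \<cdot> (asc z x y \<cdot> asc x y z)"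
    unfolding ZN_comm[OF asc_ZN cm_Nuc] by (rule Nuc_l[OF cm_Nuc])
  finally show ?thesis using 3 by simp
qed

lemma cm_coset:
  assumes n: "n \<in> Nuc" shows "n \<cdot> cm (u \<cdot> n) z = cm u z \<cdot> cj n z"
proof -
  have "(u \<cdot> n) \<cdot> z = ((z \<cdot> u) \<cdot> cm u z) \<cdot> cj n z"
    unfolding mult_cm[of u z, symmetric] Nuc_m[OF n] Nuc_r[OF cj_Nuc[OF n]] mult_cj ..
  also have "\<dots> = (z \<cdot> u) \<cdot> (cm u z \<cdot> cj n z)" by (rule Nuc_m[OF cm_Nuc])
  finally have "(z \<cdot> (u \<cdot> n)) \<cdot> cm (u \<cdot> n) z = (z \<cdot> u) \<cdot> (cm u z \<cdot> cj n z)"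
    by (simp only: flip: mult_cm)
  then have "(z \<cdot> u) \<cdot> (n \<cdot> cm (u \<cdot> n) z) = (z \<cdot> u) \<cdot> (cm u z \<cdot> cj n z)"
    by (simp only: Nuc_m[OF n] flip: Nuc_r[OF n])
  then show ?thesis by (simp only: cancel_l)
qed

text \<open>The centre of the loop; by \<open>ZQ_iff\<close> the fixed points of conjugation in the
  nucleus.\<close>

definition ZQ where "ZQ = {a \<in> Nuc. \<forall>x. a \<cdot> x = x \<cdot> a}"

lemma ZQ_iff: "a \<in> ZQ \<longleftrightarrow> a \<in> Nuc \<and> (\<forall>x. cj a x = a)"
  unfolding ZQ_def cj_def ld_eq_iff by blast

lemma ZQ_Nuc: "a \<in> ZQ \<Longrightarrow> a \<in> Nuc" by (simp add: ZQ_iff)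

lemma cj_ZQ: "a \<in> ZQ \<Longrightarrow> cj a x = a" by (simp add: ZQ_iff)

lemma ZQ_ZN: "a \<in> ZQ \<Longrightarrow> a \<in> ZN"
  by (rule ZN_I) (auto simp: ZQ_def)

lemma asc_central:
  assumes "\<And>x y z. asc x y z \<in> ZQ"
  shows asc_central_square: "asc x y z \<cdot> asc x y z = u1"
    and asc_central_cyc: "asc y z x = asc x y z"
  using asc_inverse[of x y z] asc_rot[of x y z] by (simp_all add: cj_ZQ assms)

text \<open>\<open>cm (x \<cdot> y) z\<close> and \<open>cm (y \<cdot> x) z\<close> are both
  expanded by \<open>cm_mult\<close>; \<open>cm_coset\<close> relates them, because
  \<open>x \<cdot> y\<close> is \<open>(y \<cdot> x) \<cdot> cm x y\<close>.\<close>

lemma cm_swap: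
  assumes asc: "\<And>x y z. asc x y z \<in> ZQ"
  shows "cm x y \<cdot> ((cj (cm x z) y \<cdot> cm y z) \<cdot> asc x z y)
       = ((cj (cm y z) x \<cdot> cm x z) \<cdot> asc y z x) \<cdot> cj (cm x y) z"
proof -
  have *: "cm (x \<cdot> y) z = (cj (cm x z) y \<cdot> cm y z) \<cdot> asc x z y" for x y
  proof -
    have "asc z x y \<cdot> asc x y z = u1"
      by (simp only: asc_central_cyc[OF asc, of x y z] asc_central_square[OF asc])
    then show ?thesis using cm_mult[of x y z] by simp
  qed
  show ?thesis
    using cm_coset[OF cm_Nuc, of x y "y \<cdot> x" z] unfolding mult_cm[of x y, symmetric] * .
qed

text \<open>Central commutators cancel from \<open>cm_swap\<close>, and only associators
  remain.\<close>

lemma asc_symmetric_if_cm_central: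
  assumes asc: "\<And>x y z. asc x y z \<in> ZQ" and cm: "\<And>x y. cm x y \<in> ZQ"
  shows "asc x y z = asc y x z"
proof -
  note Z = asc[THEN ZQ_ZN] cm[THEN ZQ_ZN]
  have "(cm x y \<cdot> (cm x z \<cdot> cm y z)) \<cdot> asc x z y = (cm x y \<cdot> (cm x z \<cdot> cm y z)) \<cdot> asc y z x"
    using cm_swap[OF asc, of x y z] by (simp only: cj_ZQ[OF cm] ZN_ac Z ZN_mult)
  then have "asc y z x = asc x z y" by (simp only: cancel_l)
  also have "asc x z y = asc y x z" by (rule asc_central_cyc[OF asc])
  finally have "asc y z x = asc y x z" .
  moreover have "asc y z x = asc x y z" by (rule asc_central_cyc[OF asc])
  ultimately show ?thesis by (simp only:)
qed

end

text \<open>\<open>proper\<close> is a consequence of the failure of conjugacy closedness: by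
  \<open>lcc\<close> and \<open>rcc\<close>, associators symmetric in the first two places would
  give conjugacy closedness.\<close>

locale proper_buchsteiner_32 = buchsteiner_algebra mult ld rd u1
  for mult :: "'b \<Rightarrow> 'b \<Rightarrow> 'b" (infixl "\<cdot>" 70) and ld rd u1 +
  assumes card_32: "card (UNIV :: 'b set) = 32"
    and proper: "\<exists>x y z. asc x y z \<noteq> asc y x z"
begin

lemma fin [simp, intro]: "finite (A :: 'b set)"
  by (rule finite_subset[OF subset_UNIV]) (rule card_ge_0_finite, simp add: card_32)

lemma card_le_32: "card (A :: 'b set) \<le> 32"
  using card_mono[OF fin subset_UNIV, of A] by (simp add: card_32)

section \<open>Counting with cosets of the nucleus\<close>

definition coset where "coset x = (\<lambda>n. x \<cdot> n) ` Nuc"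

lemma mem_coset: "y \<in> coset x \<longleftrightarrow> ld x y \<in> Nuc"
  unfolding coset_def by (auto simp: image_iff) (metis mult_ld)

lemma card_coset: "card (coset x) = card Nuc"
  unfolding coset_def by (rule card_image) (simp add: inj_on_def)

lemma coset_self: "x \<in> coset x" by (simp add: mem_coset)

lemma coset_mult: assumes n: "n \<in> Nuc" shows "coset (x \<cdot> n) = coset x"
proof -
  have "ld (x \<cdot> n) y = rv n \<cdot> ld x y" for y
    unfolding ld_eq_iff Nuc_m[OF n] by (simp add: Nuc_inv(4)[OF n])
  moreover have "rv n \<cdot> l \<in> Nuc \<longleftrightarrow> l \<in> Nuc" for l
    by (rule iffI) (erule Nuc_cancel_left[OF Nuc_inv(1)[OF n]], erule Nuc_mult[OF Nuc_inv(1)[OF n]])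
  ultimately show ?thesis by (simp add: set_eq_iff mem_coset)
qed

lemma coset_eq: assumes "y \<in> coset x" shows "coset y = coset x"
  using assms coset_mult[of "ld x y" x] by (simp add: mem_coset)

lemma card_Nuc_dvd: "card Nuc dvd 32"
proof -
  have "card Nuc * card (range coset) = card (\<Union> (range coset))"
  proof (rule card_partition)
    show "finite (range coset)" by (rule finite_imageI[OF fin])
    show "card c = card Nuc" if "c \<in> range coset" for c using that card_coset by blast
    show "c \<inter> d = {}" if "c \<in> range coset" "d \<in> range coset" "c \<noteq> d" for c d
      using that coset_eq by blast
  qed (rule fin)
  also have "\<Union> (range coset) = UNIV" using coset_self by blast
  finally show ?thesis unfolding card_32 by (metis dvd_triv_left)
qed

text \<open>If \<open>u\<close> is outside \<open>S\<close>, its translate of \<open>S\<close> is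
  disjoint from \<open>S\<close> and of the same size, which is too much for 32 elements.\<close>

lemma closed_UNIV:
  assumes "\<And>u s. s \<in> S \<Longrightarrow> u \<cdot> s \<in> S \<Longrightarrow> u \<in> S" and "card S > 16" shows "S = (UNIV :: 'b set)"
proof (rule ccontr)
  assume "S \<noteq> UNIV"
  then obtain u where u: "u \<notin> S" by blast
  have "card (S \<union> (\<cdot>) u ` S) = card S + card ((\<cdot>) u ` S)"
    by (rule card_Un_disjoint) (use assms(1) u in auto)
  also have "card ((\<cdot>) u ` S) = card S" by (rule card_image) (simp add: inj_on_def)
  finally show False using card_le_32[of "S \<union> (\<cdot>) u ` S"] assms(2) by simp
qed

lemma three_cosets:
  assumes S: "\<And>x n. x \<in> S \<Longrightarrow> n \<in> Nuc \<Longrightarrow> x \<cdot> n \<in> S"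
    and "x \<in> S" "y \<in> S" "z \<in> S" "y \<notin> coset x" "z \<notin> coset x" "z \<notin> coset y"
  shows "3 * card Nuc \<le> card S"
proof -
  have disj: "coset u \<inter> coset v = {}" if "v \<notin> coset u" for u v
    using that coset_eq coset_self by blast
  have "card ((coset x \<union> coset y) \<union> coset z) = (card (coset x) + card (coset y)) + card (coset z)"
    using disj[OF assms(5)] disj[OF assms(6)] disj[OF assms(7)]
    by (subst card_Un_disjoint, simp, simp, blast)+ simp
  moreover have "coset x \<subseteq> S" "coset y \<subseteq> S" "coset z \<subseteq> S"
    unfolding coset_def using S assms(2-4) by auto
  ultimately show ?thesis using card_mono[of S "(coset x \<union> coset y) \<union> coset z"] by (simp add: card_coset)
qed

lemma four_cosets:
  assumes S: "\<And>x n. x \<in> S \<Longrightarrow> n \<in> Nuc \<Longrightarrow> x \<cdot> n \<in> S"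
    and "w \<in> S" "x \<in> S" "y \<in> S" "z \<in> S"
    and "x \<notin> coset w" "y \<notin> coset w" "z \<notin> coset w" "y \<notin> coset x" "z \<notin> coset x" "z \<notin> coset y"
    and "card S = 4 * card Nuc"
  shows "S = ((coset w \<union> coset x) \<union> coset y) \<union> coset z"
proof (rule card_subset_eq[symmetric, OF fin])
  have disj: "coset u \<inter> coset v = {}" if "v \<notin> coset u" for u v
    using that coset_eq coset_self by blast
  have "card (((coset w \<union> coset x) \<union> coset y) \<union> coset z)
      = ((card (coset w) + card (coset x)) + card (coset y)) + card (coset z)"
    using assms(6-11)[THEN disj]
    by (subst card_Un_disjoint, simp, simp, blast)+ simp
  then show "card (((coset w \<union> coset x) \<union> coset y) \<union> coset z) = card S"
    using assms(12) by (simp add: card_coset)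
  show "((coset w \<union> coset x) \<union> coset y) \<union> coset z \<subseteq> S"
    unfolding coset_def using S assms(2-5) by auto
qed

section \<open>The order of the nucleus\<close>

lemma asc_not_symmetric: "\<not> (\<forall>x y z. asc x y z = asc y x z)" using proper by blast

text \<open>With 8 or more nuclear elements, three cosets fill over half of the loop. A set of
  arguments with symmetric associators is then everything as soon as it contains three
  cosets.\<close>

lemma card_Nuc_less_8: "card Nuc < 8"
proof (rule ccontr)
  assume "\<not> card Nuc < 8"
  then have big: "3 * card Nuc > 16" by simp
  show False
  proof (cases "\<exists>a. a \<cdot> a \<notin> Nuc")
    case True
    then obtain a where a: "a \<cdot> a \<notin> Nuc" by blast
    then have a': "a \<notin> Nuc" using Nuc_mult by blast
    have cosets: "a \<notin> coset u1" "a \<cdot> a \<notin> coset u1" "a \<cdot> a \<notin> coset a"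
      using a a' by (simp_all add: mem_coset)
    \<comment> \<open>The expansions in the first and second argument have the same shape, so
      \<open>S\<close> contains the cosets of \<open>u1\<close>, \<open>a\<close> and
      \<open>a \<cdot> a\<close>. The set \<open>T\<close> then repeats the argument with
      \<open>a\<close> replaced by an arbitrary element.\<close>
    define S where "S = {y. \<forall>z. asc a y z = asc y a z}"
    have "S = UNIV"
    proof (rule closed_UNIV)
      show "u \<in> S" if "s \<in> S" "u \<cdot> s \<in> S" for u s
        using that by (simp add: S_def asc_mult2_right asc_mult1')
      have "3 * card Nuc \<le> card S"
        by (rule three_cosets[OF _ _ _ _ cosets])
          (auto simp: S_def asc_mult2_right asc_mult1' asc_unit1 asc_unit2 asc_coset1 asc_coset2)
      then show "card S > 16" using big by simp
    qed
    then have Sa: "asc a y z = asc y a z" for y z unfolding S_def by blast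
    define T where "T = {x. \<forall>y z. asc x y z = asc y x z}"
    have "T = UNIV"
    proof (rule closed_UNIV)
      show "u \<in> T" if "s \<in> T" "u \<cdot> s \<in> T" for u s
        using that by (simp add: T_def asc_mult2_right asc_mult1')
      have "3 * card Nuc \<le> card T"
        by (rule three_cosets[OF _ _ _ _ cosets])
          (auto simp: T_def Sa asc_mult2_right asc_mult1' asc_unit1 asc_unit2 asc_coset1 asc_coset2)
      then show "card T > 16" using big by simp
    qed
    then show False using asc_not_symmetric unfolding T_def by blast
  next
    case False
    \<comment> \<open>Nuclear squares make the associator cyclic, which puts the cosets of
      \<open>u1\<close>, \<open>x\<close> and \<open>y\<close> into \<open>S\<close> for the fixed
      \<open>x\<close> and \<open>y\<close>.\<close>
    then have sq: "a \<cdot> a \<in> Nuc" for a by blast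
    have inv: "cj (asc x y z) x \<cdot> asc x y z = u1" for x y z
      using asc_unit1[OF sq, of x y z] by (simp only: asc_mult1')
    have cyc: "asc y z x = asc x y z" for x y z
    proof -
      have "cj (asc x y z) x \<cdot> asc y z x = u1"
        using asc_cyc[of y z x] ZN_com[OF asc_ZN cj_ZN[OF asc_ZN], of y z x x y z x] by (simp only:)
      then have "cj (asc x y z) x \<cdot> asc y z x = cj (asc x y z) x \<cdot> asc x y z" by (simp only: inv)
      then show ?thesis by (simp only: cancel_l)
    qed
    obtain x y z where xyz: "asc x y z \<noteq> asc y x z" using proper by blast
    define S where "S = {z. asc x y z = asc y x z}"
    have cosets: "x \<notin> coset u1" "y \<notin> coset u1" "y \<notin> coset x"
    proof -
      show "x \<notin> coset u1" "y \<notin> coset u1" using xyz asc_unit1 asc_unit2 by (auto simp: mem_coset)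
      have "asc x (x \<cdot> n) z = asc (x \<cdot> n) x z" if "n \<in> Nuc" for n
        using that by (simp add: asc_coset1 asc_coset2)
      from this[of "ld x y"] show "y \<notin> coset x" using xyz by (auto simp: mem_coset)
    qed
    have "S = UNIV"
    proof (rule closed_UNIV)
      show "u \<in> S" if "s \<in> S" "u \<cdot> s \<in> S" for u s
        using that by (simp add: S_def asc_mult3)
      have "3 * card Nuc \<le> card S"
      proof (rule three_cosets[OF _ _ _ _ cosets])
        show "v \<cdot> n \<in> S" if "v \<in> S" "n \<in> Nuc" for v n using that by (simp add: S_def asc_coset3)
        show "u1 \<in> S" "x \<in> S" "y \<in> S"
          using cyc[of x y x] cyc[of y x y] cyc[of x x y] cyc[of y y x] by (simp_all add: S_def asc_unit3)
      qed
      then show "card S > 16" using big by simp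
    qed
    then show False using xyz unfolding S_def by blast
  qed
qed

lemma Nuc_not_central: "\<not> Nuc \<subseteq> ZQ"
proof
  assume "Nuc \<subseteq> ZQ"
  then have "asc x y z = asc y x z" for x y z
    using asc_symmetric_if_cm_central asc_Nuc cm_Nuc by blast
  then show False using proper by blast
qed

text \<open>The order is a divisor of 32 below 8. A nucleus of order at most 2 has only trivial
  conjugations and would be central.\<close>

lemma card_Nuc: "card Nuc = 4"
proof -
  have "card Nuc \<noteq> 3" "card Nuc \<noteq> 5" "card Nuc \<noteq> 6" "card Nuc \<noteq> 7" "card Nuc \<noteq> 0"
    using card_Nuc_dvd by (auto dest: dvd_imp_le)
  moreover have "card Nuc > 2"
  proof (rule ccontr)
    assume "\<not> card Nuc > 2"
    then have 2: "card Nuc \<le> 2" by simp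
    have "cj n x = n" if n: "n \<in> Nuc" for n x
    proof (rule ccontr)
      assume ne: "cj n x \<noteq> n"
      then have "n \<noteq> u1" by auto
      then have "u1 \<noteq> n" "u1 \<noteq> cj n x" using cj_eq_unit[of n x] by metis+
      then have "card {u1, n, cj n x} = 3" using ne[symmetric] by simp
      moreover have "{u1, n, cj n x} \<subseteq> Nuc" using n cj_Nuc by auto
      ultimately show False using 2 card_mono[of Nuc "{u1, n, cj n x}"] by simp
    qed
    then show False using Nuc_not_central unfolding ZQ_iff subset_iff by blast
  qed
  ultimately show ?thesis using card_Nuc_less_8 by linarith
qed

lemma Nuc_commute': assumes a: "a \<in> Nuc" and b: "b \<in> Nuc" shows "a \<cdot> b = b \<cdot> a"
proof (rule ccontr)
  assume ne: "a \<cdot> b \<noteq> b \<cdot> a"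
  have 1: "a \<noteq> u1" "b \<noteq> u1" "a \<noteq> b" using ne by auto
  have 2: "v \<cdot> w \<noteq> u1" if "v \<in> Nuc" "v \<cdot> w \<noteq> w \<cdot> v" for v w
  proof
    assume "v \<cdot> w = u1"
    then have "w = rv v" using ld_mult[of v w] by simp
    then show False using that Nuc_inv(2)[OF that(1)] by simp
  qed
  have 3: "a \<cdot> b \<noteq> u1" "b \<cdot> a \<noteq> u1" using 2[OF a] 2[OF b] ne by auto
  have 4: "a \<cdot> b \<noteq> a" "b \<cdot> a \<noteq> b" using 1 cancel_l[of _ _ u1] by (auto simp del: cancel_l)
  have 5: "a \<cdot> b \<noteq> b" "b \<cdot> a \<noteq> a" using 1 cancel_r[of a b u1] cancel_r[of b a u1] by (auto simp del: cancel_r)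
  have "distinct [u1, a, b, a \<cdot> b, b \<cdot> a]" using ne 1 3 4 5 by (auto simp: eq_commute)
  then have "card (set [u1, a, b, a \<cdot> b, b \<cdot> a]) = 5" by (simp only: distinct_card) simp
  moreover have "set [u1, a, b, a \<cdot> b, b \<cdot> a] \<subseteq> Nuc" using a b Nuc_mult by auto
  ultimately show False using card_mono[OF fin, of "set [u1, a, b, a \<cdot> b, b \<cdot> a]" Nuc] card_Nuc by simp
qed

lemma Nuc_ZN: "a \<in> Nuc \<Longrightarrow> a \<in> ZN"
  by (rule ZN_I) (auto intro: Nuc_commute')

section \<open>The conjugation action on the nucleus and its kernel \<open>W\<close>\<close>

lemma orbit_stabilizer:
  assumes n: "n \<in> Nuc" shows "card (range (cj n)) * card {y. cj n y = n} = 32"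
proof -
  define F where "F m = {y. cj n y = m}" for m
  have card_F: "card (F m) = card (F n)" if m: "m \<in> range (cj n)" for m
  proof -
    obtain y where y: "m = cj n y" using m by blast
    have "F m = (\<lambda>w. w \<cdot> y) ` F n"
    proof (intro Set.set_eqI iffI)
      fix v assume "v \<in> F m"
      then have "cj n (rd v y \<cdot> y) = cj n y" by (simp add: F_def y)
      then have "cj n (rd v y) = n" by (simp only: cj_mult[OF n] cj_cancel)
      then have "rd v y \<in> F n" by (simp add: F_def)
      then have "rd v y \<cdot> y \<in> (\<lambda>w. w \<cdot> y) ` F n" by (rule imageI)
      then show "v \<in> (\<lambda>w. w \<cdot> y) ` F n" by simp
    next
      fix v assume "v \<in> (\<lambda>w. w \<cdot> y) ` F n"
      then show "v \<in> F m" by (auto simp: F_def y cj_mult[OF n])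
    qed
    then show ?thesis by (simp add: card_image inj_on_def)
  qed
  have "card (\<Union>m\<in>range (cj n). F m) = (\<Sum>m\<in>range (cj n). card (F m))"
    by (rule card_UN_disjoint) (auto simp: F_def)
  also have "(\<Union>m\<in>range (cj n). F m) = UNIV" by (auto simp: F_def)
  also have "(\<Sum>m\<in>range (cj n). card (F m)) = card (range (cj n)) * card (F n)"
    using card_F by simp
  finally show ?thesis by (simp add: F_def card_32)
qed

definition W where "W = {x. \<forall>n\<in>Nuc. cj n x = n}"

lemma cj_orbit: "cj n x \<in> range (cj (cj n y))" if "n \<in> Nuc"
proof -
  have "cj n x = cj (cj n y) (ld y x)" by (simp flip: cj_mult[OF that])
  then show ?thesis by blast
qed

text \<open>A noncentral \<open>n0\<close> has an orbit of size 2, and the remaining nontrivial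
  element \<open>s\<close> is fixed by every conjugation.\<close>

lemma Nuc_structure:
  obtains s n0 n1 where "Nuc = {u1, s, n0, n1}" "ZQ = {u1, s}" "distinct [u1, s, n0, n1]"
    "s \<cdot> s = u1" "s \<cdot> n0 = n1" "s \<cdot> n1 = n0" "range (cj n0) = {n0, n1}"
proof -
  obtain n0 t where n0: "n0 \<in> Nuc" and t: "cj n0 t \<noteq> n0"
    using Nuc_not_central unfolding subset_iff ZQ_iff by blast
  define n1 where "n1 = cj n0 t"
  have n0u: "n0 \<noteq> u1" using t by auto
  have rsub: "range (cj n) \<subseteq> Nuc - {u1}" if "n \<in> Nuc" "n \<noteq> u1" for n
    using that cj_Nuc[OF that(1)] cj_eq_unit[of n] by blast
  have c3: "card (Nuc - {u1}) = 3" by (simp add: card_Nuc)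
  \<comment> \<open>Orbit sizes divide 32, so the three nontrivial elements cannot form one
    orbit.\<close>
  have "card (range (cj n0)) \<noteq> 3"
  proof
    assume "card (range (cj n0)) = 3"
    then have "3 * card {y. cj n0 y = n0} = 32" using orbit_stabilizer[OF n0] by simp
    then show False by presburger
  qed
  moreover have "card (range (cj n0)) \<le> 3" using card_mono[OF fin rsub[OF n0 n0u]] c3 by simp
  ultimately have "card (range (cj n0)) \<le> 2" by simp
  moreover have sub: "{n0, n1} \<subseteq> range (cj n0)" using cj_unit(2)[of n0] unfolding n1_def by (metis empty_subsetI insert_subset rangeI)
  moreover have n01: "card {n0, n1} = 2" using t by (simp add: n1_def eq_commute)
  ultimately have r: "range (cj n0) = {n0, n1}" by (metis card_seteq fin)
  have "card ((Nuc - {u1}) - {n0, n1}) = 1"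
    using card_Diff_subset[of "{n0, n1}" "Nuc - {u1}"] sub rsub[OF n0 n0u] n01 c3 by auto
  then obtain s where s: "(Nuc - {u1}) - {n0, n1} = {s}" by (rule card_1_singletonE)
  have s2: "{n0, n1} \<subseteq> Nuc - {u1}" using sub rsub[OF n0 n0u] by (rule order_trans)
  have "Nuc = {u1} \<union> ({n0, n1} \<union> ((Nuc - {u1}) - {n0, n1}))" using s2 Nuc_unit by blast
  then have Nuc_eq: "Nuc = {u1, s, n0, n1}" unfolding s by blast
  have n1u: "n1 \<noteq> u1" using s2 by blast
  have "s \<in> (Nuc - {u1}) - {n0, n1}" unfolding s by (rule singletonI)
  moreover have "n0 \<noteq> n1" using t unfolding n1_def by (rule not_sym)
  ultimately have dist: "distinct [u1, s, n0, n1]" using n0u n1u by auto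
  have sN: "s \<in> Nuc" unfolding Nuc_eq by auto
  \<comment> \<open>An image of \<open>s\<close> in the orbit of \<open>n0\<close> would, by
    \<open>cj_orbit\<close>, put \<open>s\<close> itself into that orbit.\<close>
  have sfix: "cj s x = s" for x
  proof -
    have "cj s x \<in> Nuc" "cj s x \<noteq> u1" using cj_Nuc[OF sN] dist by auto
    moreover have "cj s x \<notin> {n0, n1}"
    proof
      assume "cj s x \<in> {n0, n1}"
      then obtain y where "cj s x = cj n0 y" using r by blast
      moreover have "cj s u1 \<in> range (cj (cj s x))" by (rule cj_orbit[OF sN])
      ultimately obtain z where "s = cj (cj n0 y) z" by auto
      then have "s = cj n0 (y \<cdot> z)" by (simp only: cj_mult[OF n0])
      then have "s \<in> {n0, n1}" using r by blast
      then show False using dist by auto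
    qed
    ultimately show ?thesis unfolding Nuc_eq by blast
  qed
  have "n1 \<notin> ZQ"
  proof
    assume "n1 \<in> ZQ"
    then have "range (cj n1) = {n1}" by (auto simp: cj_ZQ)
    moreover have "cj n0 u1 \<in> range (cj n1)" unfolding n1_def by (rule cj_orbit[OF n0])
    ultimately show False using dist by auto
  qed
  moreover have "n0 \<notin> ZQ" using t cj_ZQ by blast
  moreover have "s \<in> ZQ" using sN sfix by (simp add: ZQ_iff)
  moreover have "u1 \<in> ZQ" by (simp add: ZQ_iff)
  ultimately have ZQ_eq: "ZQ = {u1, s}" using ZQ_Nuc Nuc_eq by blast
  \<comment> \<open>\<open>s \<cdot> s\<close> is fixed as well, so it is \<open>u1\<close> or
    \<open>s\<close>, and cancellation excludes \<open>s\<close>.\<close>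
  have "cj (s \<cdot> s) x = s \<cdot> s" for x by (simp add: cj_prod sN sfix)
  then have "s \<cdot> s \<in> ZQ" using sN Nuc_mult by (simp add: ZQ_iff)
  moreover have nes: "s \<cdot> v \<noteq> s" if "v \<noteq> u1" for v using that cancel_l[of s v u1] by simp
  ultimately have ss: "s \<cdot> s = u1" using dist unfolding ZQ_eq by auto
  have ne: "s \<cdot> v \<noteq> v" for v using dist cancel_r[of s v u1] by (simp add: eq_commute)
  have neu: "s \<cdot> v \<noteq> u1" if "v \<noteq> s" for v using that cancel_l[of s v s] by (simp add: ss)
  have sn0: "s \<cdot> n0 = n1"
    using Nuc_mult[OF sN n0] dist ne[of n0] nes[of n0] neu[of n0] unfolding Nuc_eq by auto
  have "s \<cdot> n1 = n0"
    unfolding sn0[symmetric] Nuc_l[OF sN, symmetric] ss by simp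
  then show thesis using that[OF Nuc_eq ZQ_eq dist ss sn0 _ r] by blast
qed

lemma ZQ_unit [simp]: "u1 \<in> ZQ" by (simp add: ZQ_iff)

lemma ZQ_mult: "a \<in> ZQ \<Longrightarrow> b \<in> ZQ \<Longrightarrow> a \<cdot> b \<in> ZQ"
  by (simp add: ZQ_iff Nuc_mult cj_prod)

lemma ZQ_square: assumes "a \<in> ZQ" shows "a \<cdot> a = u1"
proof -
  obtain s where "ZQ = {u1, s}" "s \<cdot> s = u1" by (rule Nuc_structure)
  then have "a = u1 \<or> a = s" "s \<cdot> s = u1" using assms by blast+
  then show ?thesis by (elim disjE) (simp_all only: unit_l)
qed

text \<open>\<open>ZQ\<close> has index two in the nucleus, so membership behaves like a parity. The
  proof runs through the multiplication table.\<close>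

lemma ZQ_parity: assumes a: "a \<in> Nuc" and b: "b \<in> Nuc" shows "a \<cdot> b \<in> ZQ \<longleftrightarrow> (a \<in> ZQ \<longleftrightarrow> b \<in> ZQ)"
proof -
  obtain s n0 n1 where N: "Nuc = {u1, s, n0, n1}" and Z: "ZQ = {u1, s}" and d: "distinct [u1, s, n0, n1]"
    and p: "s \<cdot> s = u1" "s \<cdot> n0 = n1" "s \<cdot> n1 = n0" by (rule Nuc_structure)
  have N': "s \<in> Nuc" "n0 \<in> Nuc" "n1 \<in> Nuc" unfolding N by auto
  have c: "n0 \<cdot> s = n1" "n1 \<cdot> s = n0" using Nuc_commute' N' p by simp_all
  have q: "n0 \<cdot> n0 \<in> {u1, s}"
  proof -
    have "n0 \<cdot> n0 \<noteq> n0" "n0 \<cdot> n0 \<noteq> n1"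
      using d cancel_l[of n0 n0 u1] cancel_l[of n0 n0 s] unfolding c by auto
    then show ?thesis using Nuc_mult[OF N'(2) N'(2)] unfolding N by blast
  qed
  have r: "n0 \<cdot> n1 = s \<cdot> (n0 \<cdot> n0)" "n1 \<cdot> n0 = s \<cdot> (n0 \<cdot> n0)"
    using Nuc_commute'[OF N'(2,3)] p(2) Nuc_l[OF N'(1), of n0 n0] by simp_all
  have "n1 \<cdot> n1 = s \<cdot> (n0 \<cdot> n1)" using p(2) Nuc_l[OF N'(1), of n0 n1] by simp
  then have q': "n0 \<cdot> n1 \<in> {u1, s}" "n1 \<cdot> n0 \<in> {u1, s}" "n1 \<cdot> n1 \<in> {u1, s}"
    using q r p by (simp_all only: insert_iff empty_iff) (elim disjE; simp)+
  have "a = u1 \<or> a = s \<or> a = n0 \<or> a = n1" "b = u1 \<or> b = s \<or> b = n0 \<or> b = n1"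
    using a b unfolding N by blast+
  moreover have d': "s \<noteq> u1" "n0 \<noteq> u1" "n1 \<noteq> u1" "n0 \<noteq> s" "n1 \<noteq> s" using d by auto
  ultimately show ?thesis using q q' unfolding Z by (elim disjE) (simp_all add: p c d' d'[symmetric])
qed

lemma cj_ZQ_iff: assumes "a \<in> Nuc" shows "cj a x \<in> ZQ \<longleftrightarrow> a \<in> ZQ"
proof
  assume "cj a x \<in> ZQ"
  moreover have "cj a u1 \<in> range (cj (cj a x))" by (rule cj_orbit[OF assms])
  ultimately show "a \<in> ZQ" using cj_ZQ by force
qed (simp add: cj_ZQ)

text \<open>Since \<open>n1 = s \<cdot> n0\<close> with central \<open>s\<close>, the action is
  determined by the image of \<open>n0\<close>; every element outside \<open>W\<close> swaps
  \<open>n0\<close> and \<open>n1\<close>.\<close>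

lemma Nuc_action:
  obtains s n0 n1 where "Nuc = {u1, s, n0, n1}" "ZQ = {u1, s}" "distinct [u1, s, n0, n1]"
    "\<And>v. v \<notin> W \<Longrightarrow> cj n0 v = n1" "\<And>v. v \<notin> W \<Longrightarrow> cj n1 v = n0"
    "W = {v. cj n0 v = n0}" "range (cj n0) = {n0, n1}"
proof -
  obtain s n0 n1 where N: "Nuc = {u1, s, n0, n1}" and Z: "ZQ = {u1, s}" and d: "distinct [u1, s, n0, n1]"
    and p: "s \<cdot> s = u1" "s \<cdot> n0 = n1" "s \<cdot> n1 = n0" and r: "range (cj n0) = {n0, n1}" by (rule Nuc_structure)
  have sZ: "s \<in> ZQ" and n0N: "n0 \<in> Nuc" using Z N by auto
  have 1: "cj n1 v = s \<cdot> cj n0 v" for v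
    using cj_prod[OF ZQ_Nuc[OF sZ] n0N, of v] by (simp add: p cj_ZQ[OF sZ])
  have W: "W = {v. cj n0 v = n0}"
  proof (intro Set.set_eqI iffI)
    fix v assume "v \<in> {v. cj n0 v = n0}"
    then show "v \<in> W" unfolding W_def N using cj_ZQ[OF sZ] 1[of v] p(2) by simp
  qed (use n0N in \<open>simp add: W_def\<close>)
  have 2: "cj n0 v = n1" if v: "v \<notin> W" for v using v r unfolding W by blast
  show thesis by (rule that[OF N Z d 2 _ W r]) (simp_all only: 1 2 p not_False_eq_True)
qed

lemma cj_W: "x \<in> W \<Longrightarrow> n \<in> Nuc \<Longrightarrow> cj n x = n" by (simp add: W_def)

lemma cj_not_W: assumes x: "x \<notin> W" and y: "y \<notin> W" and n: "n \<in> Nuc"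
  shows "cj n x = cj n y" and "n \<notin> ZQ \<Longrightarrow> cj n x \<noteq> n" and "cj (cj n x) y = n"
proof -
  obtain s n0 n1 where N: "Nuc = {u1, s, n0, n1}" and Z: "ZQ = {u1, s}" and d: "distinct [u1, s, n0, n1]"
    and *: "\<And>v. v \<notin> W \<Longrightarrow> cj n0 v = n1" "\<And>v. v \<notin> W \<Longrightarrow> cj n1 v = n0" by (rule Nuc_action) blast
  have s: "cj s v = s" for v by (rule cj_ZQ) (simp add: Z)
  have n': "n = u1 \<or> n = s \<or> n = n0 \<or> n = n1" using n unfolding N by blast
  show "cj n x = cj n y" using n' by (elim disjE) (simp_all only: * x y s cj_unit not_False_eq_True)
  show "cj (cj n x) y = n" using n' by (elim disjE) (simp_all only: * x y s cj_unit not_False_eq_True)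
  have d': "n0 \<noteq> n1" "n1 \<noteq> n0" using d by auto
  show "cj n x \<noteq> n" if "n \<notin> ZQ"
    using n' that d' unfolding Z by (elim disjE) (simp_all add: * x)
qed

lemma card_W: "card W = 16"
proof -
  obtain s n0 n1 where "W = {v. cj n0 v = n0}" "range (cj n0) = {n0, n1}" "distinct [u1, s, n0, n1]"
    and "Nuc = {u1, s, n0, n1}" by (rule Nuc_action) blast
  then show ?thesis using orbit_stabilizer[of n0] by simp
qed

text \<open>Two swaps cancel; this is the statement that \<open>W\<close> is a subloop of index two,
  in parity form.\<close>

lemma W_mult: "x \<cdot> y \<in> W \<longleftrightarrow> (x \<in> W \<longleftrightarrow> y \<in> W)"
proof -
  obtain n where n: "n \<in> Nuc" "n \<notin> ZQ" using Nuc_not_central by blast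
  have 1: "v \<in> W \<longleftrightarrow> cj n v = n" for v
    using cj_W[of v n] cj_not_W(2)[of v v n] n by blast
  have 2: "cj n (x \<cdot> y) = cj (cj n x) y" by (rule cj_mult[OF n(1)])
  show ?thesis
  proof (cases "x \<in> W")
    case True then show ?thesis using 1 2 cj_W[of x n] n by simp
  next
    case False
    have "y \<notin> W \<Longrightarrow> cj (cj n x) y = n" by (rule cj_not_W(3)[OF False _ n(1)])
    moreover have "y \<in> W \<Longrightarrow> cj (cj n x) y \<noteq> n"
      using cj_W[OF _ cj_Nuc[OF n(1)]] cj_not_W(2)[OF False False n] by simp
    ultimately show ?thesis using False 1[of "x \<cdot> y"] 2 by auto
  qed
qed

lemma Nuc_W: "Nuc \<subseteq> W"
  unfolding W_def using cj_by_Nuc[OF Nuc_ZN] by blast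

subsection \<open>Associators are central\<close>

lemma ZQ_if_cj:
  assumes a: "a \<in> Nuc" and b: "\<And>w. b w \<in> Nuc" and ab: "\<And>w. cj a w \<cdot> b w = b w \<cdot> a"
  shows "a \<in> ZQ"
proof -
  have "b w \<cdot> cj a w = b w \<cdot> a" for w
    using ab[of w] unfolding Nuc_commute'[OF cj_Nuc[OF a] b] .
  then show ?thesis using a by (simp add: ZQ_iff)
qed

text \<open>In \<open>asc_commute3\<close> an argument from \<open>W\<close> acts trivially, which
  leaves \<open>asc x y z\<close> fixed under all conjugations.\<close>

lemma asc_W3: assumes "z \<in> W" shows "asc x y z \<in> ZQ"
  by (rule ZQ_if_cj[OF asc_Nuc, where b = "\<lambda>w. asc x y w"])
    (use asc_commute3[of x y z] in \<open>simp_all add: asc_Nuc cj_W[OF assms]\<close>)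

lemma asc_W2: assumes "y \<in> W" shows "asc x y z \<in> ZQ"
  by (rule ZQ_if_cj[OF asc_Nuc, where b = "\<lambda>w. asc x w z"])
    (use asc_commute2[of x y z] in \<open>simp_all add: asc_Nuc cj_W[OF assms]\<close>)

lemma square_Nuc_if: assumes "\<And>y z. asc (x \<cdot> x) y z = u1" shows "x \<cdot> x \<in> Nuc"
  by (rule NucI_l) (simp add: mult_asc[of "x \<cdot> x"] assms)

lemma asc_cube_if: assumes m: "x \<cdot> x \<in> Nuc" shows "x \<cdot> x = cj (x \<cdot> x) x \<cdot> asc x x x"
proof -
  have "x \<cdot> (x \<cdot> x) = x \<cdot> (cj (x \<cdot> x) x \<cdot> asc x x x)"
    unfolding mult_asc[of x x x] mult_cj[of x "x \<cdot> x", symmetric] Nuc_m[OF cj_Nuc[OF m]] ..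
  then show ?thesis by (simp only: cancel_l)
qed

text \<open>A noncentral associator is first reduced to one of the form \<open>asc z z z\<close>.
  That one forces \<open>z \<cdot> z\<close> to be nuclear, and then \<open>asc_cube_if\<close>
  contradicts its parity.\<close>

lemma asc_ZQ: "asc x y z \<in> ZQ"
proof (rule ccontr)
  assume a: "asc x y z \<notin> ZQ"
  have y: "y \<notin> W" and z: "z \<notin> W" using a asc_W2 asc_W3 by blast+
  \<comment> \<open>\<open>y\<close> and \<open>z\<close> differ by an element of \<open>W\<close>,
    whose associators are central by \<open>asc_W2\<close>; so \<open>z\<close> may replace
    \<open>y\<close>, and similarly \<open>x\<close>.\<close>
  define v where "v = ld z y"
  have v: "y = z \<cdot> v" "v \<in> W" using y z W_mult[of z v] by (auto simp: v_def)
  have "asc x z z \<notin> ZQ"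
    using a asc_W2[OF v(2), of x z] ZQ_parity[OF asc_Nuc asc_Nuc, of x z z x v z]
    by (simp add: v asc_mult2_right cj_W asc_Nuc)
  moreover have "asc x z z = cj (asc z z x) (z \<cdot> z)" by (rule asc_rot)
  ultimately have b: "asc z z x \<notin> ZQ" by (simp add: cj_ZQ_iff asc_Nuc)
  have x: "x \<notin> W" using b asc_W3 by blast
  define w where "w = ld z x"
  have w: "x = z \<cdot> w" "w \<in> W" using x z W_mult[of z w] by (auto simp: w_def)
  define q where "q = asc z z z"
  have qN: "q \<in> Nuc" unfolding q_def by (rule asc_Nuc)
  have q: "q \<notin> ZQ"
    using b asc_W3[OF w(2), of z z] ZQ_parity[OF asc_Nuc asc_Nuc, of z z z z z w]
    by (simp add: w asc_mult3 cj_W asc_Nuc q_def)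
  \<comment> \<open>Outside \<open>W\<close> all elements act alike, so \<open>z\<close> may replace
    \<open>z \<cdot> (z \<cdot> z)\<close> in \<open>asc_inverse\<close>.\<close>
  have "z \<cdot> (z \<cdot> z) \<notin> W" using z W_mult by blast
  then have q1: "q \<cdot> cj q z = u1"
    using asc_inverse[of z z z] cj_not_W(1)[OF z _ qN] by (simp flip: q_def)
  have inv: "u \<cdot> cj u z = u1" if u: "u \<in> Nuc" for u
  proof (cases "u \<in> ZQ")
    case True then show ?thesis by (simp add: cj_ZQ ZQ_square)
  next
    \<comment> \<open>Every noncentral nuclear element is \<open>q\<close> times a central one, so
      the identity for \<open>q\<close> extends to it.\<close>
    case False
    define t where "t = rd u q"
    have t: "u = t \<cdot> q" by (simp add: t_def)
    then have tN: "t \<in> Nuc" using Nuc_cancel_right[OF qN] u by simp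
    have tZ: "t \<in> ZQ" using ZQ_parity[OF tN qN] False q by (simp add: t)
    have "u \<cdot> cj u z = (t \<cdot> t) \<cdot> (q \<cdot> cj q z)"
      unfolding t cj_prod[OF tN qN] cj_ZQ[OF tZ]
      by (simp only: ZN_ac Nuc_ZN tN qN cj_Nuc ZN_mult)
    then show ?thesis by (simp add: ZQ_square[OF tZ] q1)
  qed
  have "asc (z \<cdot> z) u t = u1" for u t
    unfolding asc_mult1' using inv[OF asc_Nuc] Nuc_commute'[OF asc_Nuc cj_Nuc[OF asc_Nuc]] by simp
  then have m: "z \<cdot> z \<in> Nuc" by (rule square_Nuc_if)
  \<comment> \<open>\<open>z \<cdot> z\<close> and its conjugate have the same parity, so their
    quotient \<open>q\<close> would be central.\<close>
  have "z \<cdot> z \<in> ZQ \<longleftrightarrow> (z \<cdot> z \<in> ZQ \<longleftrightarrow> q \<in> ZQ)"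
    using ZQ_parity[OF cj_Nuc[OF m] qN, of z] asc_cube_if[OF m] cj_ZQ_iff[OF m] by (simp flip: q_def)
  then show False using q by blast
qed

lemma asc_square: "asc x y z \<cdot> asc x y z = u1" by (rule ZQ_square[OF asc_ZQ])

lemma asc_cyclic: "asc y z x = asc x y z" by (rule asc_central_cyc[OF asc_ZQ])

lemma asc_add: "asc (x \<cdot> y) z w = asc x z w \<cdot> asc y z w"
  "asc x (y \<cdot> z) w = asc x y w \<cdot> asc x z w"
  "asc x y (z \<cdot> w) = asc x y z \<cdot> asc x y w"
  by (simp_all add: asc_mult1' asc_mult2_right asc_mult3 cj_ZQ asc_ZQ)

lemma square_Nuc: "x \<cdot> x \<in> Nuc"
  by (rule square_Nuc_if) (simp add: asc_add asc_square)

lemma asc_cube_W: assumes "x \<in> W" shows "asc x x x = u1"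
  using asc_cube_if[OF square_Nuc, of x] cj_W[OF assms square_Nuc, of x] cancel_l[of "x \<cdot> x" u1 "asc x x x"] by simp

lemma ex_asc: "\<exists>x y z. asc x y z \<noteq> u1"
  using proper by metis

text \<open>Its negation is an alternating trilinear form modulo the nucleus with values in a group
  of order 2: \<open>asc_sym_mult\<close> is additivity, \<open>asc_sym_cyc\<close> and
  \<open>asc_sym_refl\<close> give the rest.\<close>

definition asc_sym where "asc_sym x y z \<longleftrightarrow> asc x y z = asc y x z"

lemma asc_sym_mult: "asc_sym (x \<cdot> y) z w \<longleftrightarrow> (asc_sym x z w \<longleftrightarrow> asc_sym y z w)"
proof -
  obtain s where Z: "ZQ = {u1, s}" and s: "s \<cdot> s = u1" and d: "s \<noteq> u1"
    by (rule Nuc_structure) auto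
  have *: "a = u1 \<or> a = s" if "a \<in> ZQ" for a using that unfolding Z by blast
  show ?thesis
    unfolding asc_sym_def asc_add
    using *[OF asc_ZQ[of x z w]] *[OF asc_ZQ[of y z w]] *[OF asc_ZQ[of z x w]] *[OF asc_ZQ[of z y w]]
    by (elim disjE) (simp_all add: s d d[symmetric])
qed

lemma asc_sym_sym: "asc_sym y x z \<longleftrightarrow> asc_sym x y z" by (auto simp: asc_sym_def)

lemma asc_sym_cyc: "asc_sym y z x \<longleftrightarrow> asc_sym x y z"
  using asc_cyclic[of y z x] asc_cyclic[of z y x] asc_cyclic[of y x z] asc_cyclic[of x z y]
  unfolding asc_sym_def by metis

lemma asc_sym_refl [simp]: "asc_sym x x z" "asc_sym x y x" "asc_sym x y y"
  using asc_sym_cyc[of x x y] asc_sym_cyc[of x y x] asc_sym_cyc[of y y x] asc_sym_cyc[of y x y] by (auto simp: asc_sym_def)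

lemma asc_sym_mult2: "asc_sym z (x \<cdot> y) w \<longleftrightarrow> (asc_sym z x w \<longleftrightarrow> asc_sym z y w)"
  using asc_sym_mult asc_sym_sym by blast

lemma asc_sym_mult3: "asc_sym z w (x \<cdot> y) \<longleftrightarrow> (asc_sym z w x \<longleftrightarrow> asc_sym z w y)"
  using asc_sym_mult asc_sym_cyc by blast

lemma asc_sym_Nuc: "n \<in> Nuc \<Longrightarrow> asc_sym n x y" by (simp add: asc_sym_def asc_unit1 asc_unit2)

lemma asc_sym_Nuc2: "n \<in> Nuc \<Longrightarrow> asc_sym x n y" by (simp add: asc_sym_def asc_unit1 asc_unit2)

lemma asc_sym_Nuc3: "n \<in> Nuc \<Longrightarrow> asc_sym x y n" by (simp add: asc_sym_def asc_unit3)

lemma not_asc_sym_cosets: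
  assumes "\<not> asc_sym x y z" shows "x \<notin> coset u1" "y \<notin> coset u1" "y \<notin> coset x"
proof -
  show "x \<notin> coset u1" "y \<notin> coset u1" using assms asc_sym_Nuc[of x y z] asc_sym_Nuc[of y x z] asc_sym_sym[of x y z]
    by (auto simp: mem_coset)
  have "asc_sym x (x \<cdot> n) z" if "n \<in> Nuc" for n using asc_sym_Nuc2[OF that] by (simp add: asc_sym_mult2)
  from this[of "ld x y"] show "y \<notin> coset x" using assms by (auto simp: mem_coset)
qed

lemma W_cosets:
  assumes x: "x \<in> W" and y: "y \<in> W" and xy: "\<not> asc_sym x y z"
  shows "W = ((coset u1 \<union> coset x) \<union> coset y) \<union> coset (x \<cdot> y)"
proof (rule four_cosets)
  have 1: "\<not> asc_sym x (x \<cdot> y) z" "\<not> asc_sym y (x \<cdot> y) z"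
    using xy asc_sym_sym[of y x z] by (simp_all add: asc_sym_mult2)
  show "x \<notin> coset u1" "y \<notin> coset u1" "y \<notin> coset x" by (rule not_asc_sym_cosets[OF xy])+
  show "x \<cdot> y \<notin> coset u1" "x \<cdot> y \<notin> coset x" by (rule not_asc_sym_cosets[OF 1(1)])+
  show "x \<cdot> y \<notin> coset y" by (rule not_asc_sym_cosets[OF 1(2)])
  show "v \<cdot> n \<in> W" if "v \<in> W" "n \<in> Nuc" for v n using that Nuc_W by (auto simp: W_mult)
qed (use x y Nuc_W in \<open>auto simp: W_mult card_W card_Nuc\<close>)

text \<open>\<open>W\<close> has only four cosets of the nucleus, so it would be generated by
  \<open>x\<close> and \<open>y\<close> modulo \<open>Nuc\<close>; an alternating trilinear form
  vanishes on two generators.\<close>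

lemma asc_sym_W: assumes "x \<in> W" "y \<in> W" "z \<in> W" shows "asc_sym x y z"
proof (rule ccontr)
  assume n: "\<not> asc_sym x y z"
  have c: "asc_sym x y v" if "v \<in> coset u" "asc_sym x y u" for u v
    using that asc_sym_mult3[of x y u "ld u v"] asc_sym_Nuc3[of "ld u v" x y] by (simp add: mem_coset)
  have "z \<in> ((coset u1 \<union> coset x) \<union> coset y) \<union> coset (x \<cdot> y)"
    using assms(3) W_cosets[OF assms(1,2) n] by simp
  then have "asc_sym x y z" using c by (auto simp: asc_sym_mult3 asc_sym_Nuc3)
  with n show False ..
qed

lemma ex_W_not_asc_sym:
  obtains x y t where "x \<in> W" "y \<in> W" "t \<notin> W" "\<not> asc_sym x y t"
proof -
  have red: "\<exists>x y. x \<in> W \<and> y \<in> W \<and> \<not> asc_sym x y t" if t: "t \<notin> W" and n: "\<not> asc_sym x y t" for x y t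
  proof -
    have "\<exists>x'. x' \<in> W \<and> (\<forall>y. asc_sym x' y t \<longleftrightarrow> asc_sym x y t)" for x
    proof (cases "x \<in> W")
      case False
      have "asc_sym t y t" for y by simp
      \<comment> \<open>As a product of two outside elements \<open>x \<cdot> t\<close> lies in
        \<open>W\<close>. The extra \<open>t\<close> changes nothing, because the form vanishes when
        two arguments coincide.\<close>
      then show ?thesis using False t by (intro exI[of _ "x \<cdot> t"]) (simp add: W_mult asc_sym_mult)
    qed blast
    then show ?thesis using n asc_sym_sym by metis
  qed
  obtain x y z where n: "\<not> asc_sym x y z" using proper unfolding asc_sym_def by blast
  then have "x \<notin> W \<or> y \<notin> W \<or> z \<notin> W" using asc_sym_W by blast
  then have "\<exists>x y t. t \<notin> W \<and> \<not> asc_sym x y t" using n asc_sym_cyc by blast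
  then show thesis using red that by blast
qed

subsection \<open>Commutators modulo the centre\<close>

definition qcomm where "qcomm x y \<longleftrightarrow> cm x y \<in> ZQ"

text \<open>The associators in \<open>cm_mult\<close> are central and conjugation preserves parity.
  Commutators thus give a bilinear form with values in \<open>Nuc\<close> modulo
  \<open>ZQ\<close>.\<close>

lemma qcomm_mult: "qcomm (x \<cdot> y) z \<longleftrightarrow> (qcomm x z \<longleftrightarrow> qcomm y z)"
proof -
  have "cm (x \<cdot> y) z \<in> ZQ \<longleftrightarrow> cm (x \<cdot> y) z \<cdot> (asc z x y \<cdot> asc x y z) \<in> ZQ"
    using ZQ_parity[OF cm_Nuc Nuc_mult[OF asc_Nuc asc_Nuc]] ZQ_mult[OF asc_ZQ asc_ZQ] by simp
  also have "\<dots> \<longleftrightarrow> cj (cm x z) y \<cdot> cm y z \<in> ZQ"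
    unfolding cm_mult using ZQ_parity[OF Nuc_mult[OF cj_Nuc[OF cm_Nuc] cm_Nuc] asc_Nuc] asc_ZQ by simp
  also have "\<dots> \<longleftrightarrow> (cm x z \<in> ZQ \<longleftrightarrow> cm y z \<in> ZQ)"
    unfolding ZQ_parity[OF cj_Nuc[OF cm_Nuc] cm_Nuc] cj_ZQ_iff[OF cm_Nuc] ..
  finally show ?thesis unfolding qcomm_def .
qed

lemma qcomm_sym: "qcomm y x \<longleftrightarrow> qcomm x y"
proof -
  have "(x \<cdot> y) \<cdot> (cm y x \<cdot> cm x y) = (y \<cdot> x) \<cdot> cm x y"
    unfolding Nuc_r[OF cm_Nuc, symmetric] mult_cm[of y x, symmetric] ..
  also have "\<dots> = (x \<cdot> y) \<cdot> u1" unfolding mult_cm[of x y, symmetric] unit_r ..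
  finally have "cm y x \<cdot> cm x y \<in> ZQ" unfolding cancel_l by simp
  then show ?thesis unfolding qcomm_def ZQ_parity[OF cm_Nuc cm_Nuc] .
qed

lemma qcomm_self [simp]: "qcomm x x" by (simp add: qcomm_def cm_def)

lemma qcomm_Nuc: assumes n: "n \<in> Nuc" shows "qcomm n x" "qcomm x n"
proof -
  have "x \<cdot> cj n x = x \<cdot> (n \<cdot> cm n x)"
    unfolding mult_cj mult_cm[of n x] by (rule Nuc_m[OF n])
  then have "cj n x = n \<cdot> cm n x" unfolding cancel_l .
  then show "qcomm n x"
    using cj_ZQ_iff[OF n, of x] ZQ_parity[OF n cm_Nuc, of n x] unfolding qcomm_def
    by (cases "n \<in> ZQ") simp_all
  then show "qcomm x n" by (simp only: qcomm_sym)
qed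

lemma qcomm_mult2: "qcomm z (x \<cdot> y) \<longleftrightarrow> (qcomm z x \<longleftrightarrow> qcomm z y)"
  unfolding qcomm_sym[of _ z, symmetric] by (rule qcomm_mult) 

text \<open>If \<open>cm x y\<close> were central, all conjugations in \<open>cm_swap\<close> would
  be trivial, as \<open>x\<close> and \<open>y\<close> act trivially on the nucleus. The commutators
  would cancel and leave symmetric associators.\<close>

lemma not_qcomm_if_not_asc_sym: assumes x: "x \<in> W" and y: "y \<in> W" and S: "\<not> asc_sym x y t" shows "\<not> qcomm x y"
proof
  assume "qcomm x y"
  then have c: "cj (cm x y) t = cm x y" unfolding qcomm_def by (rule cj_ZQ)
  have "(cm x y \<cdot> (cm x t \<cdot> cm y t)) \<cdot> asc x t y = (cm x y \<cdot> (cm x t \<cdot> cm y t)) \<cdot> asc y t x"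
    using cm_swap[OF asc_ZQ, of x y t] unfolding c cj_W[OF x cm_Nuc] cj_W[OF y cm_Nuc]
    by (simp only: ZN_ac Nuc_ZN cm_Nuc asc_Nuc ZN_mult)
  then have "asc x t y = asc y t x" unfolding cancel_l .
  then show False using S asc_cyclic[of x t y] asc_cyclic[of y t x] unfolding asc_sym_def by simp
qed

text \<open>The radical of the commutator form; \<open>second_centre_eq\<close> identifies it with
  the second centre.\<close>

definition ZQ2 where "ZQ2 = {x. \<forall>y. qcomm x y}"

lemma Nuc_ZQ2: "Nuc \<subseteq> ZQ2" unfolding ZQ2_def using qcomm_Nuc by blast

text \<open>\<open>W\<close> is generated modulo \<open>Nuc\<close> by \<open>x\<close> and
  \<open>y\<close>, which do not commute modulo the centre, so the form is nondegenerate there. An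
  outside element orthogonal to both is orthogonal to \<open>W\<close> and to itself, hence to
  everything.\<close>

lemma ZQ2_structure:
  obtains w1 w2 t where "w1 \<in> W" "w2 \<in> W" "\<not> qcomm w1 w2" "t \<in> ZQ2" "t \<notin> W"
    "\<And>x. x \<in> W \<Longrightarrow> qcomm x w1 \<Longrightarrow> qcomm x w2 \<Longrightarrow> x \<in> Nuc"
proof -
  obtain x y t where x: "x \<in> W" and y: "y \<in> W" and t: "t \<notin> W" and S: "\<not> asc_sym x y t"
    by (rule ex_W_not_asc_sym)
  have xy: "\<not> qcomm x y" by (rule not_qcomm_if_not_asc_sym[OF x y S])
  have yx: "\<not> qcomm y x" using xy qcomm_sym by blast
  have W: "W = ((coset u1 \<union> coset x) \<union> coset y) \<union> coset (x \<cdot> y)" by (rule W_cosets[OF x y S])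
  have cos: "qcomm v z \<longleftrightarrow> qcomm u z" if "v \<in> coset u" for u v z
    using that qcomm_mult[of u "ld u v" z] qcomm_Nuc(1)[of "ld u v" z] by (simp add: mem_coset)
  have N: "v \<in> Nuc" if v: "v \<in> W" and vx: "qcomm v x" and vy: "qcomm v y" for v
  proof -
    have "v \<notin> coset x" using cos[of v x y] vy xy by blast
    moreover have "v \<notin> coset y" using cos[of v y x] vx yx by blast
    moreover have "v \<notin> coset (x \<cdot> y)" using cos[of v "x \<cdot> y" x] vx yx by (auto simp: qcomm_mult)
    ultimately show ?thesis using v unfolding W by (simp add: mem_coset)
  qed
  \<comment> \<open>\<open>t\<close> is corrected first by \<open>y\<close>, then by
    \<open>x\<close>, until it is orthogonal to both. The corrections lie in \<open>W\<close>, so it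
    stays outside \<open>W\<close>.\<close>
  define t1 where "t1 = (if qcomm t x then t else t \<cdot> y)"
  have t1: "t1 \<notin> W" "qcomm t1 x" using t y yx by (auto simp: t1_def W_mult qcomm_mult)
  define t2 where "t2 = (if qcomm t1 y then t1 else t1 \<cdot> x)"
  have t2: "t2 \<notin> W" "qcomm t2 x" "qcomm t2 y" using t1 x xy by (auto simp: t2_def W_mult qcomm_mult)
  have tW: "qcomm t2 v" if "v \<in> W" for v
  proof -
    have "qcomm t2 v \<longleftrightarrow> qcomm t2 u" if "v \<in> coset u" for u
      using cos[OF that, of t2] qcomm_sym by blast
    then show ?thesis using that t2 qcomm_Nuc(2)[of v t2] unfolding W
      by (auto simp: qcomm_mult2 mem_coset)
  qed
  have "qcomm t2 v" for v
  proof (cases "v \<in> W")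
    case False
    have "ld t2 v \<in> W" using W_mult[of t2 "ld t2 v"] t2(1) False by simp
    then have "qcomm t2 (t2 \<cdot> ld t2 v)" using tW by (simp add: qcomm_mult2 del: mult_ld)
    then show ?thesis by simp
  qed (rule tW)
  then have "t2 \<in> ZQ2" unfolding ZQ2_def by blast
  then show thesis using that x y xy t2(1) N by blast
qed

lemma ZQ2_W: "ZQ2 \<inter> W = Nuc"
proof -
  obtain w1 w2 where "\<And>x. x \<in> W \<Longrightarrow> qcomm x w1 \<Longrightarrow> qcomm x w2 \<Longrightarrow> x \<in> Nuc" by (rule ZQ2_structure) blast
  then show ?thesis using Nuc_ZQ2 Nuc_W unfolding ZQ2_def by blast
qed

lemma card_ZQ2: "card ZQ2 = 8"
proof -
  obtain t where t: "t \<in> ZQ2" "t \<notin> W" by (rule ZQ2_structure) blast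
  have "ZQ2 = Nuc \<union> coset t"
  proof (intro Set.set_eqI iffI)
    fix x assume x: "x \<in> ZQ2"
    show "x \<in> Nuc \<union> coset t"
    proof (cases "x \<in> W")
      case False
      have "ld t x \<in> W" using W_mult[of t "ld t x"] t(2) False by simp
      moreover have "qcomm (ld t x) y" for y
        using x t(1) qcomm_mult[of t "ld t x" y] by (simp add: ZQ2_def)
      ultimately have "ld t x \<in> Nuc" using ZQ2_W unfolding ZQ2_def by blast
      then show ?thesis by (simp add: mem_coset)
    qed (use x ZQ2_W in blast)
  next
    fix x assume "x \<in> Nuc \<union> coset t"
    moreover have "x \<in> ZQ2" if "x \<in> coset t"
    proof -
      have "qcomm x y" for y
        using that t(1) qcomm_mult[of t "ld t x" y] qcomm_Nuc(1)[of "ld t x" y] by (simp add: ZQ2_def mem_coset)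
      then show ?thesis unfolding ZQ2_def by blast
    qed
    ultimately show "x \<in> ZQ2" using Nuc_ZQ2 by blast
  qed
  moreover have "Nuc \<inter> coset t = {}"
  proof -
    have "x \<notin> W" if "x \<in> coset t" for x
      using that t(2) Nuc_W W_mult[of t "ld t x"] by (auto simp: mem_coset)
    then show ?thesis using Nuc_W by blast
  qed
  ultimately show ?thesis by (simp add: card_Un_disjoint card_coset card_Nuc)
qed

lemma W_ZQ2: obtains w z where "w \<in> W" "z \<in> ZQ2" "y = w \<cdot> z"
proof (cases "y \<in> W")
  case True
  then show thesis using that[of y u1] subsetD[OF Nuc_ZQ2 Nuc_unit] by simp
next
  case False
  obtain t where t: "t \<in> ZQ2" "t \<notin> W" by (rule ZQ2_structure) blast
  have "rd y t \<in> W" using W_mult[of "rd y t" t] t(2) False by simp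
  then show thesis using that[of "rd y t" t] t(1) by simp
qed

lemma W_centre: assumes "x \<in> W" "\<And>w. w \<in> W \<Longrightarrow> x \<cdot> w = w \<cdot> x" shows "x \<in> Nuc"
proof -
  obtain w1 w2 where w: "w1 \<in> W" "w2 \<in> W"
    and *: "\<And>x. x \<in> W \<Longrightarrow> qcomm x w1 \<Longrightarrow> qcomm x w2 \<Longrightarrow> x \<in> Nuc" by (rule ZQ2_structure) blast
  have "qcomm x w" if "w \<in> W" for w using assms(2)[OF that] by (simp add: qcomm_def cm_def)
  then show ?thesis using * assms(1) w by blast
qed

end

section \<open>Conjugacy closedness from symmetric associators\<close>

context buchsteiner_algebra begin

text \<open>The conjugate of \<open>L\<^sub>y\<close> by \<open>L\<^sub>x\<close> is the left
  translation by \<open>rd (x \<cdot> y) x\<close>. This element lies in the nuclear coset of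
  \<open>y\<close>, so it has the same associators. \<open>rcc\<close> is the right-hand
  version.\<close>

lemma lcc:
  assumes "asc x y u = asc y x u" shows "x \<cdot> (y \<cdot> u) = rd (x \<cdot> y) x \<cdot> (x \<cdot> u)"
proof -
  define m where "m = rd (x \<cdot> cm x y) x"
  have m: "m \<in> Nuc" unfolding m_def by (rule cj_rd_Nuc[OF cm_Nuc])
  have "x \<cdot> y = (y \<cdot> m) \<cdot> x"
    unfolding mult_cm[of x y] Nuc_m[OF m] Nuc_r[OF cm_Nuc] by (simp add: m_def)
  then have w: "rd (x \<cdot> y) x = y \<cdot> m" by simp
  have "rd (x \<cdot> y) x \<cdot> (x \<cdot> u) = ((x \<cdot> y) \<cdot> u) \<cdot> asc (rd (x \<cdot> y) x) x u"
    by (simp add: mult_asc[of "rd (x \<cdot> y) x"])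
  also have "asc (rd (x \<cdot> y) x) x u = asc x y u" unfolding w assms by (rule asc_coset1[OF m])
  finally show ?thesis unfolding mult_asc[of x y u] by (rule sym)
qed

lemma rcc:
  assumes "asc x y u = asc y x u" shows "(u \<cdot> y) \<cdot> x = (u \<cdot> x) \<cdot> ld x (y \<cdot> x)"
proof -
  define w where "w = ld x (y \<cdot> x)"
  have w: "w = y \<cdot> cm y x" unfolding w_def ld_eq_iff mult_cm[of y x] by (rule Nuc_r[OF cm_Nuc])
  have "asc u x w = asc u x y" unfolding w by (rule asc_coset3[OF cm_Nuc])
  also have "\<dots> = asc u y x"
    unfolding asc_rot[of u x y] asc_rot[of u y x] assms by (rule cj_asc_commute)
  finally have "u \<cdot> (y \<cdot> x) = ((u \<cdot> x) \<cdot> w) \<cdot> asc u y x"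
    using mult_asc[of u x w] by (simp add: w_def)
  then have "((u \<cdot> y) \<cdot> x) \<cdot> asc u y x = ((u \<cdot> x) \<cdot> w) \<cdot> asc u y x" unfolding mult_asc[of u y x] .
  then show ?thesis unfolding w_def cancel_r .
qed

end

section \<open>Loops on a carrier, their subloops and cosets\<close>

context loop begin

lemma cancel_left: assumes "x \<in> carrier G" "y \<in> carrier G" "z \<in> carrier G" shows "x \<otimes> y = x \<otimes> z \<longleftrightarrow> y = z"
  using l_solve[OF assms(1) m_closed[OF assms(1,2)]] assms by metis

lemma cancel_right: assumes "x \<in> carrier G" "y \<in> carrier G" "z \<in> carrier G" shows "y \<otimes> x = z \<otimes> x \<longleftrightarrow> y = z"
  using r_solve[OF assms(1) m_closed[OF assms(2,1)]] assms by metis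

lemma ldiv_eqI: assumes "x \<in> carrier G" "z \<in> carrier G" "x \<otimes> z = y" shows "ldiv G x y = z"
  unfolding ldiv_def using assms cancel_left by (intro the_equality) auto

lemma rdiv_eqI: assumes "x \<in> carrier G" "z \<in> carrier G" "z \<otimes> x = y" shows "rdiv G y x = z"
  unfolding rdiv_def using assms cancel_right by (intro the_equality) auto

lemma ldiv: assumes "x \<in> carrier G" "y \<in> carrier G" shows "ldiv G x y \<in> carrier G" "x \<otimes> ldiv G x y = y"
proof -
  obtain z where "z \<in> carrier G" "x \<otimes> z = y" using l_solve[OF assms] by blast
  moreover from this have "ldiv G x y = z" by (rule ldiv_eqI[OF assms(1)])
  ultimately show "ldiv G x y \<in> carrier G" "x \<otimes> ldiv G x y = y" by simp_all
qed

lemma rdiv: assumes "x \<in> carrier G" "y \<in> carrier G" shows "rdiv G y x \<in> carrier G" "rdiv G y x \<otimes> x = y"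
proof -
  obtain z where "z \<in> carrier G" "z \<otimes> x = y" using r_solve[OF assms] by blast
  moreover from this have "rdiv G y x = z" by (rule rdiv_eqI[OF assms(1)])
  ultimately show "rdiv G y x \<in> carrier G" "rdiv G y x \<otimes> x = y" by simp_all
qed

lemma left_translation_Bij: assumes "x \<in> carrier G" shows "left_translation G x \<in> Bij (carrier G)"
proof -
  have "bij_betw (\<lambda>y. x \<otimes> y) (carrier G) (carrier G)"
    using assms ldiv m_closed cancel_left
    by (intro bij_betwI[where g = "ldiv G x"]) (auto intro: ldiv_eqI)
  then have "bij_betw (left_translation G x) (carrier G) (carrier G)"
    by (rule bij_betw_cong[THEN iffD1, rotated]) (simp add: left_translation_def)
  then show ?thesis by (simp add: Bij_def left_translation_def)
qed

lemma right_translation_Bij: assumes "x \<in> carrier G" shows "right_translation G x \<in> Bij (carrier G)"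
proof -
  have "bij_betw (\<lambda>y. y \<otimes> x) (carrier G) (carrier G)"
    using assms rdiv m_closed cancel_right
    by (intro bij_betwI[where g = "\<lambda>y. rdiv G y x"]) (auto intro: rdiv_eqI)
  then have "bij_betw (right_translation G x) (carrier G) (carrier G)"
    by (rule bij_betw_cong[THEN iffD1, rotated]) (simp add: right_translation_def)
  then show ?thesis by (simp add: Bij_def right_translation_def)
qed

text \<open>Replaces the inverse in the symmetric group by an equation between compositions.\<close>

lemma conjugate_eq:
  assumes "a \<in> Bij S" "b \<in> Bij S" "c \<in> Bij S" "compose S a b = compose S c a"
  shows "a \<otimes>\<^bsub>BijGroup S\<^esub> b \<otimes>\<^bsub>BijGroup S\<^esub> inv\<^bsub>BijGroup S\<^esub> a = c"
proof -
  interpret BG: group "BijGroup S" by (rule group_BijGroup)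
  have c: "a \<in> carrier (BijGroup S)" "b \<in> carrier (BijGroup S)" "c \<in> carrier (BijGroup S)"
    using assms by (simp_all add: BijGroup_def)
  have "a \<otimes>\<^bsub>BijGroup S\<^esub> b = c \<otimes>\<^bsub>BijGroup S\<^esub> a" using assms by (simp add: BijGroup_def)
  then show ?thesis using c by (simp add: BG.m_assoc)
qed

lemma conjugacy_closedI:
  assumes l: "\<And>x y. x \<in> carrier G \<Longrightarrow> y \<in> carrier G \<Longrightarrow>
      \<exists>w\<in>carrier G. \<forall>u\<in>carrier G. x \<otimes> (y \<otimes> u) = w \<otimes> (x \<otimes> u)"
    and r: "\<And>x y. x \<in> carrier G \<Longrightarrow> y \<in> carrier G \<Longrightarrow>
      \<exists>w\<in>carrier G. \<forall>u\<in>carrier G. (u \<otimes> y) \<otimes> x = (u \<otimes> x) \<otimes> w"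
  shows "conjugacy_closed_loop G"
proof
  fix x y assume x: "x \<in> carrier G" and y: "y \<in> carrier G"
  from l[OF x y] obtain w where w: "w \<in> carrier G" "\<forall>u\<in>carrier G. x \<otimes> (y \<otimes> u) = w \<otimes> (x \<otimes> u)" by blast
  have "compose (carrier G) (left_translation G x) (left_translation G y)
      = compose (carrier G) (left_translation G w) (left_translation G x)"
    using w x y m_closed by (auto simp: compose_def left_translation_def fun_eq_iff)
  then have "left_translation G x \<otimes>\<^bsub>BijGroup (carrier G)\<^esub> left_translation G y
        \<otimes>\<^bsub>BijGroup (carrier G)\<^esub> inv\<^bsub>BijGroup (carrier G)\<^esub> (left_translation G x) = left_translation G w"
    by (intro conjugate_eq left_translation_Bij x y w(1))
  then show "left_translation G x \<otimes>\<^bsub>BijGroup (carrier G)\<^esub> left_translation G y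
        \<otimes>\<^bsub>BijGroup (carrier G)\<^esub> inv\<^bsub>BijGroup (carrier G)\<^esub> (left_translation G x)
      \<in> left_translation G ` carrier G" using w(1) by simp
  from r[OF x y] obtain w where w: "w \<in> carrier G" "\<forall>u\<in>carrier G. (u \<otimes> y) \<otimes> x = (u \<otimes> x) \<otimes> w" by blast
  have "compose (carrier G) (right_translation G x) (right_translation G y)
      = compose (carrier G) (right_translation G w) (right_translation G x)"
    using w x y m_closed by (auto simp: compose_def right_translation_def fun_eq_iff)
  then have "right_translation G x \<otimes>\<^bsub>BijGroup (carrier G)\<^esub> right_translation G y
        \<otimes>\<^bsub>BijGroup (carrier G)\<^esub> inv\<^bsub>BijGroup (carrier G)\<^esub> (right_translation G x) = right_translation G w"
    by (intro conjugate_eq right_translation_Bij x y w(1))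
  then show "right_translation G x \<otimes>\<^bsub>BijGroup (carrier G)\<^esub> right_translation G y
        \<otimes>\<^bsub>BijGroup (carrier G)\<^esub> inv\<^bsub>BijGroup (carrier G)\<^esub> (right_translation G x)
      \<in> right_translation G ` carrier G" using w(1) by simp
qed

lemma subloop_loop:
  assumes "subloop H G" shows "loop (G\<lparr>carrier := H\<rparr>)"
proof -
  interpret H: subloop H G by (rule assms)
  note H = H.subset[THEN subsetD]
  have l: "\<exists>!z\<in>H. x \<otimes> z = y" if xy: "x \<in> H" "y \<in> H" for x y
  proof (rule ex1I)
    show "ldiv G x y \<in> H \<and> x \<otimes> ldiv G x y = y"
      using ldiv(2)[OF H H, OF xy] H.ldiv_closed[OF xy] by simp
    show "z = ldiv G x y" if "z \<in> H \<and> x \<otimes> z = y" for z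
      using ldiv_eqI[OF H H, OF xy(1), of z y] that by simp
  qed
  have r: "\<exists>!z\<in>H. z \<otimes> x = y" if xy: "x \<in> H" "y \<in> H" for x y
  proof (rule ex1I)
    show "rdiv G y x \<in> H \<and> rdiv G y x \<otimes> x = y"
      using rdiv(2)[OF H H, OF xy] H.rdiv_closed[OF xy(2,1)] by simp
    show "z = rdiv G y x" if "z \<in> H \<and> z \<otimes> x = y" for z
      using rdiv_eqI[OF H H, OF xy(1), of z y] that by simp
  qed
  show ?thesis
    by (rule loop.intro) (simp_all add: l r H H.m_closed H.one_closed l_one r_one)
qed

lemma subloop_div:
  assumes H: "subloop H G" and xy: "x \<in> H" "y \<in> H"
  shows "ldiv (G\<lparr>carrier := H\<rparr>) x y = ldiv G x y" "rdiv (G\<lparr>carrier := H\<rparr>) y x = rdiv G y x"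
proof -
  interpret H: subloop H G by (rule H)
  interpret HL: loop "G\<lparr>carrier := H\<rparr>" by (rule subloop_loop[OF H])
  note c = H.subset[THEN subsetD]
  show "ldiv (G\<lparr>carrier := H\<rparr>) x y = ldiv G x y"
    by (rule HL.ldiv_eqI) (simp_all add: xy H.ldiv_closed ldiv(2)[OF c c])
  show "rdiv (G\<lparr>carrier := H\<rparr>) y x = rdiv G y x"
    by (rule HL.rdiv_eqI) (simp_all add: xy H.rdiv_closed rdiv(2)[OF c c])
qed

lemma associative_loop_group:
  assumes "\<And>x y z. x \<in> carrier G \<Longrightarrow> y \<in> carrier G \<Longrightarrow> z \<in> carrier G \<Longrightarrow> (x \<otimes> y) \<otimes> z = x \<otimes> (y \<otimes> z)"
  shows "group G"
proof (rule groupI)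
  show "\<exists>y\<in>carrier G. y \<otimes> x = \<one>" if "x \<in> carrier G" for x
    using rdiv[OF that one_closed] by blast
qed (rule m_closed one_closed assms l_one; assumption)+

text \<open>For \<open>u\<close> in \<open>A #> a\<close>, the coset axioms give
  \<open>u <# (b <# A) = A #> (u \<otimes> b)\<close>. Here \<open>u \<otimes> b\<close> is
  \<open>h \<otimes> (a \<otimes> b)\<close> with \<open>h\<close> in \<open>A\<close>, and
  \<open>h\<close> is absorbed into \<open>A\<close>.\<close>

lemma normal_subloop_coset_mult:
  assumes A: "normal_subloop A G" and a: "a \<in> carrier G" and b: "b \<in> carrier G"
  shows "(A #> a) <#> (A #> b) = A #> (a \<otimes> b)"
proof -
  interpret A: normal_subloop A G by (rule A)
  have r: "x \<in> A #> y \<longleftrightarrow> (\<exists>h\<in>A. x = h \<otimes> y)" for x y by (auto simp: r_coset_def)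
  have c: "x \<in> A \<Longrightarrow> x \<in> carrier G" for x using A.subset by blast
  show ?thesis
  proof (rule equalityI; rule subsetI)
    fix x assume "x \<in> (A #> a) <#> (A #> b)"
    then obtain u v where u: "u \<in> A #> a" and v: "v \<in> A #> b" and x: "x = u \<otimes> v" by (auto simp: set_mult_def)
    have uc: "u \<in> carrier G" using u a c m_closed by (auto simp: r)
    have "v \<in> b <# A" using v A.coset_eq[OF b] by simp
    then have "x \<in> u <# (b <# A)" unfolding x l_coset_def by blast
    then have 1: "x \<in> A #> (u \<otimes> b)" using A.l_coset_assoc[OF uc b] A.coset_eq[OF m_closed[OF uc b]] by simp
    have "u \<otimes> b \<in> (A #> a) #> b" using u unfolding r_coset_def by blast
    then obtain h where h: "h \<in> A" "u \<otimes> b = h \<otimes> (a \<otimes> b)" using A.r_coset_assoc[OF a b] r by auto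
    have "x \<in> (A #> h) #> (a \<otimes> b)"
      using 1 A.r_coset_assoc[OF c[OF h(1)] m_closed[OF a b]] h(2) by simp
    moreover have "A #> h \<subseteq> A" using A.m_closed h(1) by (auto simp: r)
    ultimately show "x \<in> A #> (a \<otimes> b)" unfolding r_coset_def by blast
  next
    fix x assume "x \<in> A #> (a \<otimes> b)"
    then have "x \<in> (A #> a) #> b" using A.r_coset_assoc[OF a b] by simp
    then obtain u where u: "u \<in> A #> a" "x = u \<otimes> b" unfolding r_coset_def by blast
    moreover have "b \<in> A #> b" using A.one_closed l_one[OF b] r by metis
    ultimately show "x \<in> (A #> a) <#> (A #> b)" by (auto simp: set_mult_def)
  qed
qed

lemma subloop_carrier: "subloop (carrier G) G"
  by (rule subloop.intro) (simp_all add: m_closed one_closed ldiv rdiv)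

lemma subloop_hull:
  assumes "S \<subseteq> carrier G" shows "subloop ((\<lambda>H. subloop H G) hull S) G"
proof -
  define F where "F = {H. subloop H G \<and> S \<subseteq> H}"
  have F: "subloop H G" if "H \<in> F" for H using that by (simp add: F_def)
  \<comment> \<open>The whole carrier keeps the family nonempty, so its intersection stays inside
    the carrier.\<close>
  have c: "carrier G \<in> F" using assms subloop_carrier by (simp add: F_def)
  have "subloop (\<Inter> F) G"
  proof
    show "\<Inter> F \<subseteq> carrier G" using c by blast
    show "\<one> \<in> \<Inter> F" using subloop.one_closed[OF F] by blast
    fix x y assume "x \<in> \<Inter> F" "y \<in> \<Inter> F"
    then have xy: "x \<in> H" "y \<in> H" if "H \<in> F" for H using that by blast+
    show "x \<otimes> y \<in> \<Inter> F" using subloop.m_closed[OF F xy] by blast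
    show "ldiv G x y \<in> \<Inter> F" using subloop.ldiv_closed[OF F xy] by blast
    show "rdiv G x y \<in> \<Inter> F" using subloop.rdiv_closed[OF F xy] by blast
  qed
  then show ?thesis unfolding hull_def F_def .
qed

end

section \<open>Transport along a bijection from a finite type\<close>

locale loop_copy = buchsteiner_algebra mult ld rd u1 + P: loop P
  for mult :: "'b \<Rightarrow> 'b \<Rightarrow> 'b" (infixl "\<cdot>" 70) and ld rd u1
    and P :: "('a, 'c) monoid_scheme" (structure) +
  fixes f :: "'b \<Rightarrow> 'a"
  assumes bij: "bij_betw f UNIV (carrier P)" and hom: "f (x \<cdot> y) = f x \<otimes> f y"
    and finite_type: "finite (UNIV :: 'b set)"
begin

lemma carrier_eq: "carrier P = range f" using bij by (simp add: bij_betw_def)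

lemma f_eq [simp]: "f x = f y \<longleftrightarrow> x = y" using bij by (auto simp: bij_betw_def inj_on_def)

lemma f_mem [simp]: "f x \<in> f ` V \<longleftrightarrow> x \<in> V" by (auto simp: image_iff)

lemma f_carrier [simp]: "f x \<in> carrier P" by (simp add: carrier_eq)

lemma f_one: "f u1 = \<one>"
proof -
  have "f u1 \<otimes> f u1 = \<one> \<otimes> f u1" by (simp add: P.l_one flip: hom)
  then show ?thesis by (simp add: P.cancel_right P.one_closed)
qed

lemma f_ldiv: "ldiv P (f x) (f y) = f (ld x y)"
  by (rule P.ldiv_eqI) (simp_all flip: hom)

lemma f_rdiv: "rdiv P (f y) (f x) = f (rd y x)"
  by (rule P.rdiv_eqI) (simp_all flip: hom)

lemma nucleus_eq: "nucleus P = f ` Nuc"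
  unfolding nucleus_def carrier_eq Nuc_def by (auto simp flip: hom)

abbreviation PV where "PV V \<equiv> P\<lparr>carrier := f ` V\<rparr>"

lemma PV_UNIV: "PV UNIV = P" by (simp flip: carrier_eq)

definition closed where "closed V \<longleftrightarrow> u1 \<in> V \<and> (\<forall>x\<in>V. \<forall>y\<in>V. x \<cdot> y \<in> V)"

text \<open>Translations by elements of \<open>V\<close> map \<open>V\<close> injectively into
  itself, hence onto it by finiteness.\<close>

lemma closed_div: assumes V: "closed V" "x \<in> V" "y \<in> V" shows "ld x y \<in> V" "rd y x \<in> V"
proof -
  have "(\<lambda>v. x \<cdot> v) ` V = V"
    by (rule endo_inj_surj[OF finite_subset[OF subset_UNIV finite_type]]) (use V in \<open>auto simp: closed_def inj_on_def\<close>)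
  then obtain z where "z \<in> V" "y = x \<cdot> z" using V(3) by blast
  then show "ld x y \<in> V" by simp
  have "(\<lambda>v. v \<cdot> x) ` V = V"
    by (rule endo_inj_surj[OF finite_subset[OF subset_UNIV finite_type]]) (use V in \<open>auto simp: closed_def inj_on_def\<close>)
  then obtain z where "z \<in> V" "y = z \<cdot> x" using V(3) by blast
  then show "rd y x \<in> V" by simp
qed

lemma subloop_f: assumes V: "closed V" shows "subloop (f ` V) P"
proof (rule subloop.intro)
  show "f ` V \<subseteq> carrier P" by auto
  show "\<one> \<in> f ` V" using V by (simp add: closed_def flip: f_one)
  fix a b assume "a \<in> f ` V" "b \<in> f ` V"
  then obtain x y where xy: "x \<in> V" "y \<in> V" "a = f x" "b = f y" by blast
  show "a \<otimes> b \<in> f ` V" using V xy by (simp add: closed_def flip: hom)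
  show "ldiv P a b \<in> f ` V" using closed_div(1)[OF V xy(1,2)] by (simp add: xy f_ldiv)
  show "rdiv P a b \<in> f ` V" using closed_div(2)[OF V xy(2,1)] by (simp add: xy f_rdiv)
qed

lemma closed_whole: "closed UNIV" by (simp add: closed_def)

lemma loop_PV: "closed V \<Longrightarrow> loop (PV V)" by (rule P.subloop_loop[OF subloop_f])

lemma subloop_PV: assumes V: "closed V" and K: "closed K" and KV: "K \<subseteq> V" shows "subloop (f ` K) (PV V)"
proof (rule subloop.intro)
  show "f ` K \<subseteq> carrier (PV V)" using KV by auto
  show "\<one>\<^bsub>PV V\<^esub> \<in> f ` K" using K by (simp add: closed_def flip: f_one)
  fix a b assume "a \<in> f ` K" "b \<in> f ` K"
  then obtain x y where xy: "x \<in> K" "y \<in> K" "a = f x" "b = f y" by blast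
  have xV: "f x \<in> f ` V" "f y \<in> f ` V" using xy KV by auto
  show "a \<otimes>\<^bsub>PV V\<^esub> b \<in> f ` K" using K xy by (simp add: closed_def flip: hom)
  show "ldiv (PV V) a b \<in> f ` K"
    using closed_div(1)[OF K xy(1,2)] P.subloop_div(1)[OF subloop_f[OF V] xV] by (simp add: xy f_ldiv)
  show "rdiv (PV V) a b \<in> f ` K"
    using closed_div(2)[OF K xy(2,1)] P.subloop_div(2)[OF subloop_f[OF V] xV(2,1)] by (simp add: xy f_rdiv)
qed

text \<open>Applied to \<open>W\<close>, and contrapositively to the whole loop, where it turns
  properness into \<open>proper\<close>.\<close>

lemma conjugacy_closed_PV:
  assumes V: "closed V" and S: "\<And>x y z. x \<in> V \<Longrightarrow> y \<in> V \<Longrightarrow> z \<in> V \<Longrightarrow> asc x y z = asc y x z"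
  shows "conjugacy_closed_loop (PV V)"
proof (rule loop.conjugacy_closedI[OF loop_PV[OF V]])
  have m: "x \<cdot> y \<in> V" if "x \<in> V" "y \<in> V" for x y using V that by (simp add: closed_def)
  fix a b assume "a \<in> carrier (PV V)" "b \<in> carrier (PV V)"
  then obtain x y where x: "x \<in> V" and y: "y \<in> V" and ab: "a = f x" "b = f y" by auto
  show "\<exists>w\<in>carrier (PV V). \<forall>u\<in>carrier (PV V).
      a \<otimes>\<^bsub>PV V\<^esub> (b \<otimes>\<^bsub>PV V\<^esub> u) = w \<otimes>\<^bsub>PV V\<^esub> (a \<otimes>\<^bsub>PV V\<^esub> u)"
  proof (rule bexI)
    show "f (rd (x \<cdot> y) x) \<in> carrier (PV V)" using closed_div(2)[OF V x m[OF x y]] by simp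
    show "\<forall>u\<in>carrier (PV V).
      a \<otimes>\<^bsub>PV V\<^esub> (b \<otimes>\<^bsub>PV V\<^esub> u) = f (rd (x \<cdot> y) x) \<otimes>\<^bsub>PV V\<^esub> (a \<otimes>\<^bsub>PV V\<^esub> u)"
      using lcc[OF S[OF x y]] by (simp add: ab flip: hom)
  qed
  show "\<exists>w\<in>carrier (PV V). \<forall>u\<in>carrier (PV V).
      (u \<otimes>\<^bsub>PV V\<^esub> b) \<otimes>\<^bsub>PV V\<^esub> a = (u \<otimes>\<^bsub>PV V\<^esub> a) \<otimes>\<^bsub>PV V\<^esub> w"
  proof (rule bexI)
    show "f (ld x (y \<cdot> x)) \<in> carrier (PV V)" using closed_div(1)[OF V x m[OF y x]] by simp
    show "\<forall>u\<in>carrier (PV V).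
      (u \<otimes>\<^bsub>PV V\<^esub> b) \<otimes>\<^bsub>PV V\<^esub> a = (u \<otimes>\<^bsub>PV V\<^esub> a) \<otimes>\<^bsub>PV V\<^esub> f (ld x (y \<cdot> x))"
      using rcc[OF S[OF x y]] by (simp add: ab flip: hom)
  qed
qed

end

section \<open>The subloop \<open>W\<close> and the characteristic subloops inside
  \<open>P\<close>\<close>

locale proper_loop_32 = loop_copy mult ld rd u1 P f + proper_buchsteiner_32 mult ld rd u1
  for mult :: "'b \<Rightarrow> 'b \<Rightarrow> 'b" (infixl "\<cdot>" 70) and ld rd u1
    and P :: "('a, 'c) monoid_scheme" (structure) and f :: "'b \<Rightarrow> 'a"
begin

lemma closed_W: "closed W" using subsetD[OF Nuc_W Nuc_unit] by (simp add: closed_def W_mult)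

lemma closed_ZQ: "closed ZQ" by (simp add: closed_def ZQ_mult)

text \<open>\<open>Nuc\<close> and the coset of \<open>u\<close> form a subloop \<open>E\<close>
  containing the generated one. Associators on \<open>E\<close> reduce to \<open>asc u u u\<close>,
  which is trivial on \<open>W\<close>.\<close>

lemma power_associative_W: "power_associative (PV W)"
  unfolding power_associative_def
proof
  fix a assume "a \<in> carrier (PV W)"
  then obtain u where u: "u \<in> W" "a = f u" by auto
  define E where "E = Nuc \<union> coset u"
  have E: "x \<in> Nuc \<or> (\<exists>n\<in>Nuc. x = u \<cdot> n)" if "x \<in> E" for x
    using that by (auto simp: E_def coset_def)
  have asc_E: "asc x y z = u1" if "x \<in> E" "y \<in> E" "z \<in> E" for x y z
    using E[OF that(1)] E[OF that(2)] E[OF that(3)]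
    by (elim disjE bexE) (simp_all add: asc_unit1 asc_unit2 asc_unit3 asc_coset1 asc_coset2 asc_coset3 asc_cube_W u(1))
  have "x \<cdot> y \<in> E" if "x \<in> E" "y \<in> E" for x y
  proof -
    have 1: "n \<cdot> (u \<cdot> m) \<in> coset u" if "n \<in> Nuc" "m \<in> Nuc" for n m
    proof -
      have "n \<cdot> (u \<cdot> m) = (u \<cdot> cj n u) \<cdot> m" unfolding mult_cj by (simp only: Nuc_l that)
      also have "\<dots> = u \<cdot> (cj n u \<cdot> m)" by (rule Nuc_m[OF cj_Nuc[OF that(1)]])
      finally show ?thesis unfolding coset_def using Nuc_mult[OF cj_Nuc[OF that(1)] that(2)] by simp
    qed
    have 2: "(u \<cdot> n) \<cdot> m \<in> coset u" if "n \<in> Nuc" "m \<in> Nuc" for n m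
      unfolding coset_def Nuc_m[OF that(1)] using Nuc_mult[OF that] by simp
    have 3: "(u \<cdot> n) \<cdot> (u \<cdot> m) \<in> Nuc" if "n \<in> Nuc" "m \<in> Nuc" for n m
    proof -
      have "n \<cdot> (u \<cdot> m) \<in> coset u" by (rule 1[OF that])
      then obtain r where r: "r \<in> Nuc" "n \<cdot> (u \<cdot> m) = u \<cdot> r" unfolding coset_def by blast
      have "(u \<cdot> n) \<cdot> (u \<cdot> m) = (u \<cdot> u) \<cdot> r" unfolding Nuc_m[OF that(1)] r(2) by (rule Nuc_r[OF r(1), symmetric])
      then show ?thesis using Nuc_mult[OF square_Nuc r(1)] by simp
    qed
    show ?thesis using E[OF that(1)] E[OF that(2)] unfolding E_def
      by (elim disjE bexE) (simp_all add: 1 2 3 Nuc_mult)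
  qed
  then have clE: "closed E" by (simp add: closed_def E_def)
  have EW: "E \<subseteq> W" using E u(1) Nuc_W W_mult by blast
  define L where "L = PV W"
  interpret L: loop L unfolding L_def by (rule loop_PV[OF closed_W])
  define H where "H = (\<lambda>H. subloop H L) hull {a}"
  have H: "subloop H L" unfolding H_def
    by (rule L.subloop_hull) (use u in \<open>simp add: L_def\<close>)
  have HE: "H \<subseteq> f ` E" unfolding H_def
    by (rule hull_minimal) (use u subloop_PV[OF closed_W clE EW] coset_self in \<open>simp_all add: L_def E_def\<close>)
  have "group (L\<lparr>carrier := H\<rparr>)"
  proof (rule loop.associative_loop_group[OF L.subloop_loop[OF H]])
    fix x y z assume "x \<in> carrier (L\<lparr>carrier := H\<rparr>)" "y \<in> carrier (L\<lparr>carrier := H\<rparr>)" "z \<in> carrier (L\<lparr>carrier := H\<rparr>)"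
    then have "x \<in> f ` E" "y \<in> f ` E" "z \<in> f ` E" using HE by auto
    then obtain x' y' z' where "x' \<in> E" "y' \<in> E" "z' \<in> E" "x = f x'" "y = f y'" "z = f z'" by blast
    then show "(x \<otimes>\<^bsub>L\<lparr>carrier := H\<rparr>\<^esub> y) \<otimes>\<^bsub>L\<lparr>carrier := H\<rparr>\<^esub> z = x \<otimes>\<^bsub>L\<lparr>carrier := H\<rparr>\<^esub> (y \<otimes>\<^bsub>L\<lparr>carrier := H\<rparr>\<^esub> z)"
      using mult_asc[of x' y' z'] asc_E by (simp add: L_def flip: hom)
  qed
  then show "group ((PV W)\<lparr>carrier := (\<lambda>H. subloop H (PV W)) hull {a}\<rparr>)" unfolding H_def L_def .
qed

subsection \<open>Quotients by the centre\<close>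

text \<open>Cosets of the centre do not depend on the ambient subloop, so these sets serve in the
  quotients of every \<open>PV V\<close>.\<close>

definition central_coset where "central_coset x = (\<lambda>z. f (z \<cdot> x)) ` ZQ"

lemma central_coset_eq: "central_coset x = central_coset y \<longleftrightarrow> ld x y \<in> ZQ"
proof
  assume "central_coset x = central_coset y"
  moreover have "f y \<in> central_coset y" unfolding central_coset_def by (rule image_eqI[of _ _ u1]) simp_all
  ultimately have "f y \<in> central_coset x" by (simp only:)
  then obtain z where "z \<in> ZQ" "y = z \<cdot> x" unfolding central_coset_def by auto
  then show "ld x y \<in> ZQ" by (simp add: ld_eq_iff ZQ_def)
next
  assume n: "ld x y \<in> ZQ"
  define n where "n = ld x y"
  have nZ: "n \<in> ZQ" using n by (simp add: n_def)
  have y: "y = n \<cdot> x" using nZ by (simp add: ZQ_def) (simp add: n_def)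
  have "central_coset y = (\<lambda>z. f (z \<cdot> x)) ` ((\<lambda>z. z \<cdot> n) ` ZQ)"
    unfolding central_coset_def y image_image by (rule image_cong) (simp_all add: Nuc_l ZQ_Nuc)
  also have "(\<lambda>z. z \<cdot> n) ` ZQ = ZQ"
    by (rule endo_inj_surj) (use ZQ_mult nZ in \<open>auto simp: inj_on_def\<close>)
  finally show "central_coset x = central_coset y" by (simp add: central_coset_def)
qed

lemma r_coset_ZQ: "f ` ZQ #> f x = central_coset x"
  unfolding r_coset_def central_coset_def by (auto simp: hom)

lemma central_coset_mult: "central_coset x <#> central_coset y = central_coset (x \<cdot> y)"
proof -
  have m: "(z \<cdot> x) \<cdot> (w \<cdot> y) = (z \<cdot> w) \<cdot> (x \<cdot> y)" if z: "z \<in> ZQ" and w: "w \<in> ZQ" for z w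
  proof -
    have "x \<cdot> (w \<cdot> y) = w \<cdot> (x \<cdot> y)"
      using w Nuc_m[OF ZQ_Nuc[OF w], of x y] Nuc_l[OF ZQ_Nuc[OF w], of x y] by (simp add: ZQ_def)
    then show ?thesis by (simp only: Nuc_l[OF ZQ_Nuc[OF z]])
  qed
  show ?thesis
  proof (rule equalityI; rule subsetI)
    fix a assume "a \<in> central_coset x <#> central_coset y"
    then obtain z w where zw: "z \<in> ZQ" "w \<in> ZQ" "a = f (z \<cdot> x) \<otimes> f (w \<cdot> y)"
      unfolding set_mult_def central_coset_def by auto
    then have "a = f ((z \<cdot> w) \<cdot> (x \<cdot> y))" by (simp add: m flip: hom)
    then show "a \<in> central_coset (x \<cdot> y)" unfolding central_coset_def using ZQ_mult[OF zw(1,2)] by blast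
  next
    fix a assume "a \<in> central_coset (x \<cdot> y)"
    then obtain z where z: "z \<in> ZQ" "a = f (z \<cdot> (x \<cdot> y))" unfolding central_coset_def by blast
    then have "a = f (z \<cdot> x) \<otimes> f (u1 \<cdot> y)" by (simp add: Nuc_l ZQ_Nuc flip: hom)
    then show "a \<in> central_coset x <#> central_coset y"
      unfolding set_mult_def central_coset_def using z(1) ZQ_unit by fastforce
  qed
qed

lemma carrier_Mod: "carrier (PV V Mod f ` ZQ) = central_coset ` V"
  unfolding FactGroup_def RCOSETS_def by (auto simp: r_coset_ZQ)

lemma mult_Mod: "central_coset x \<otimes>\<^bsub>PV V Mod f ` ZQ\<^esub> central_coset y = central_coset (x \<cdot> y)"
  by (simp add: FactGroup_def central_coset_mult)

lemma one_Mod: "\<one>\<^bsub>PV V Mod f ` ZQ\<^esub> = central_coset u1"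
  by (simp add: FactGroup_def central_coset_def)

text \<open>Associativity of the quotient is the centrality of associators.\<close>

lemma group_Mod: assumes V: "closed V" shows "group (PV V Mod f ` ZQ)"
proof (rule groupI, unfold carrier_Mod one_Mod)
  have m: "x \<cdot> y \<in> V" if "x \<in> V" "y \<in> V" for x y using V that by (simp add: closed_def)
  have u: "u1 \<in> V" using V by (simp add: closed_def)
  show "central_coset u1 \<in> central_coset ` V" using u by simp
  fix X assume "X \<in> central_coset ` V"
  then obtain x where x: "x \<in> V" "X = central_coset x" by blast
  show "central_coset u1 \<otimes>\<^bsub>PV V Mod f ` ZQ\<^esub> X = X" by (simp add: x central_coset_mult)
  show "\<exists>Y\<in>central_coset ` V. Y \<otimes>\<^bsub>PV V Mod f ` ZQ\<^esub> X = central_coset u1"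
    by (rule bexI[of _ "central_coset (rd u1 x)"]) (simp_all add: x central_coset_mult closed_div[OF V x(1) u])
  fix Y assume "Y \<in> central_coset ` V"
  then obtain y where y: "y \<in> V" "Y = central_coset y" by blast
  show "X \<otimes>\<^bsub>PV V Mod f ` ZQ\<^esub> Y \<in> central_coset ` V" by (simp add: x y central_coset_mult m)
  fix Z assume "Z \<in> central_coset ` V"
  then obtain z where z: "z \<in> V" "Z = central_coset z" by blast
  have "ld ((x \<cdot> y) \<cdot> z) (x \<cdot> (y \<cdot> z)) \<in> ZQ" by (simp add: mult_asc[of x y z] asc_ZQ)
  then show "X \<otimes>\<^bsub>PV V Mod f ` ZQ\<^esub> Y \<otimes>\<^bsub>PV V Mod f ` ZQ\<^esub> Z = X \<otimes>\<^bsub>PV V Mod f ` ZQ\<^esub> (Y \<otimes>\<^bsub>PV V Mod f ` ZQ\<^esub> Z)"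
    by (simp add: x y z central_coset_mult central_coset_eq)
qed

lemma central_coset_commute: "central_coset (x \<cdot> y) = central_coset (y \<cdot> x) \<longleftrightarrow> qcomm x y"
  using central_coset_eq[of "y \<cdot> x" "x \<cdot> y"] unfolding qcomm_def cm_def by auto

lemma centre_eq: "loop_centre P = f ` ZQ"
proof -
  have "a \<in> loop_centre P \<longleftrightarrow> a \<in> f ` ZQ" for a
  proof
    assume "a \<in> loop_centre P"
    then have "a \<in> f ` Nuc" and c: "\<forall>b\<in>carrier P. a \<otimes> b = b \<otimes> a" by (simp_all add: loop_centre_def nucleus_eq)
    then obtain n where n: "n \<in> Nuc" "a = f n" by blast
    then have "n \<cdot> x = x \<cdot> n" for x using c[rule_format, of "f x"] by (simp flip: hom)
    then show "a \<in> f ` ZQ" using n by (simp add: ZQ_def)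
  next
    assume "a \<in> f ` ZQ"
    then obtain n where "n \<in> ZQ" "a = f n" by blast
    then show "a \<in> loop_centre P"
      by (auto simp: loop_centre_def nucleus_eq ZQ_def carrier_eq simp flip: hom)
  qed
  then show ?thesis by blast
qed

lemma nucleus_group: "group G \<Longrightarrow> nucleus G = carrier G"
  unfolding nucleus_def by (auto simp: group.is_monoid monoid.m_assoc)

text \<open>The quotient by the centre is a group and equals its own nucleus, so only commutation
  remains, and that is \<open>qcomm\<close>.\<close>

lemma second_centre_eq: "second_centre P = f ` ZQ2"
proof -
  define M where "M = P Mod f ` ZQ"
  have M: "group M" "carrier M = range central_coset" "\<And>x y. central_coset x \<otimes>\<^bsub>M\<^esub> central_coset y = central_coset (x \<cdot> y)"
    using group_Mod[OF closed_whole] carrier_Mod[of UNIV] mult_Mod[where V = UNIV] by (simp_all only: PV_UNIV M_def)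
  have "central_coset x \<in> loop_centre M \<longleftrightarrow> x \<in> ZQ2" for x
    by (simp add: loop_centre_def nucleus_group[OF M(1)] M(2,3) central_coset_commute ZQ2_def)
  moreover have "f ` ZQ #>\<^bsub>P\<^esub> f x = central_coset x" for x by (rule r_coset_ZQ)
  ultimately show ?thesis
    unfolding second_centre_def centre_eq M_def[symmetric] carrier_eq by auto
qed

lemma normal_subloop_ZQ: "normal_subloop (f ` ZQ) P"
proof (intro normal_subloop.intro subloop_f closed_ZQ normal_subloop_axioms.intro)
  have l: "f x <# f ` ZQ = central_coset x" for x unfolding l_coset_def central_coset_def by (auto simp: ZQ_def simp flip: hom)
  have r: "f ` ZQ #> f x = central_coset x" for x unfolding r_coset_def central_coset_def by (auto simp flip: hom)
  fix a b assume "a \<in> carrier P" "b \<in> carrier P"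
  then obtain x y where ab: "a = f x" "b = f y" unfolding carrier_eq by blast
  have "f x <# central_coset y = central_coset (x \<cdot> y)"
  proof -
    have "x \<cdot> (z \<cdot> y) = z \<cdot> (x \<cdot> y)" if "z \<in> ZQ" for z
      using that Nuc_m[of z x y] Nuc_l[of z x y] by (simp add: ZQ_def)
    then show ?thesis unfolding l_coset_def central_coset_def by (auto simp flip: hom)
  qed
  then show "a <# (b <# f ` ZQ) = a \<otimes> b <# f ` ZQ" by (simp add: ab l flip: hom)
  have "central_coset x #> f y = central_coset (x \<cdot> y)"
    unfolding r_coset_def central_coset_def by (auto simp: Nuc_l ZQ_Nuc simp flip: hom)
  then show "f ` ZQ #> a #> b = f ` ZQ #> (a \<otimes> b)" by (simp add: ab r flip: hom)
next
  fix a assume "a \<in> carrier P"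
  then obtain x where "a = f x" unfolding carrier_eq by blast
  then show "a <# f ` ZQ = f ` ZQ #> a"
    unfolding r_coset_def l_coset_def by (auto simp: ZQ_def simp flip: hom)
qed

text \<open>In a group quotient both bracketings fall into one coset, so \<open>A\<close> contains
  every associator. Some associator differs from \<open>u1\<close> and is therefore the generator
  \<open>s\<close> of the centre.\<close>

lemma associator_subloop_least:
  assumes A: "normal_subloop A P" and G: "group (P Mod A)" shows "f ` ZQ \<subseteq> A"
proof -
  interpret A: normal_subloop A P by (rule A)
  obtain x y z where a: "asc x y z \<noteq> u1" using ex_asc by blast
  obtain s where s: "ZQ = {u1, s}" by (rule Nuc_structure) blast
  have as: "asc x y z = s" using a asc_ZQ[of x y z] unfolding s by blast
  have c: "A #> f v \<in> carrier (P Mod A)" for v by (auto simp: FactGroup_def RCOSETS_def)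
  have m: "(A #> f v) \<otimes>\<^bsub>P Mod A\<^esub> (A #> f w) = A #> f (v \<cdot> w)" for v w
    using P.normal_subloop_coset_mult[OF A, of "f v" "f w"] by (simp add: FactGroup_def hom)
  have "A #> f ((x \<cdot> y) \<cdot> z) = A #> f (x \<cdot> (y \<cdot> z))"
    using monoid.m_assoc[OF group.is_monoid[OF G] c c c, of x y z] by (simp only: m)
  moreover have "f (x \<cdot> (y \<cdot> z)) \<in> A #> f (x \<cdot> (y \<cdot> z))"
    unfolding r_coset_def using A.one_closed P.l_one[of "f (x \<cdot> (y \<cdot> z))"] by force
  ultimately have "f (x \<cdot> (y \<cdot> z)) \<in> f ((x \<cdot> y) \<cdot> z) <# A" using A.coset_eq[of "f ((x \<cdot> y) \<cdot> z)"] by simp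
  then obtain b where b: "b \<in> A" "f (x \<cdot> (y \<cdot> z)) = f ((x \<cdot> y) \<cdot> z) \<otimes> b" unfolding l_coset_def by blast
  then obtain v where v: "b = f v" using A.subset carrier_eq by blast
  have "v = s" using b(2) unfolding v mult_asc[of x y z] as by (simp flip: hom)
  then show ?thesis using b(1) A.one_closed by (simp add: s v f_one)
qed

lemma associator_subloop_eq: "associator_subloop P = f ` ZQ"
  unfolding associator_subloop_def
proof (rule Least_equality)
  show "normal_subloop (f ` ZQ) P \<and> group (P Mod f ` ZQ)"
    using normal_subloop_ZQ group_Mod[OF closed_whole] by (simp only: PV_UNIV)
qed (use associator_subloop_least in blast)

subsection \<open>The subloop of index two\<close>

lemma W_iff: "x \<in> W \<longleftrightarrow> (\<forall>n\<in>Nuc. n \<cdot> x = x \<cdot> n)"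
  unfolding W_def by (simp add: cj_def ld_eq_iff)

lemma centre_W: "loop_centre (PV W) = f ` Nuc"
proof -
  have "a \<in> loop_centre (PV W) \<longleftrightarrow> a \<in> f ` Nuc" for a
  proof
    assume a: "a \<in> loop_centre (PV W)"
    then have "a \<in> f ` W" and c: "\<forall>b\<in>f ` W. a \<otimes> b = b \<otimes> a" by (simp_all add: loop_centre_def nucleus_def)
    then obtain x where x: "x \<in> W" "a = f x" by blast
    have "x \<cdot> w = w \<cdot> x" if "w \<in> W" for w using c that by (simp add: x flip: hom)
    then show "a \<in> f ` Nuc" using W_centre[OF x(1)] x(2) by blast
  next
    assume "a \<in> f ` Nuc"
    then obtain n where n: "n \<in> Nuc" "a = f n" by blast
    have c: "n \<cdot> w = w \<cdot> n" if "w \<in> W" for w using that n(1) W_iff by blast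
    have "a \<in> f ` W" using n Nuc_W by auto
    then show "a \<in> loop_centre (PV W)" unfolding n(2)
      by (auto simp: loop_centre_def nucleus_def Nuc_l[OF n(1)] Nuc_m[OF n(1)] Nuc_r[OF n(1)]
          simp flip: hom intro: c)
  qed
  then show ?thesis by blast
qed

lemma rcosets_W: "card (rcosets (f ` W)) = 2"
proof -
  have c: "f ` W #> f x = f ` (if x \<in> W then W else - W)" for x
  proof -
    have "(\<lambda>w. w \<cdot> x) ` W = (if x \<in> W then W else - W)"
    proof (intro equalityI subsetI)
      fix v assume "v \<in> (if x \<in> W then W else - W)"
      then have "rd v x \<in> W" using W_mult[of "rd v x" x] by (simp split: if_splits)
      then have "rd v x \<cdot> x \<in> (\<lambda>w. w \<cdot> x) ` W" by (rule imageI)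
      then show "v \<in> (\<lambda>w. w \<cdot> x) ` W" by simp
    qed (auto simp: W_mult)
    moreover have "f ` W #> f x = f ` ((\<lambda>w. w \<cdot> x) ` W)" unfolding r_coset_def by (auto simp flip: hom)
    ultimately show ?thesis by simp
  qed
  obtain t where t: "t \<notin> W" by (rule ZQ2_structure) blast
  have u: "u1 \<in> W" using Nuc_W Nuc_unit by blast
  have "rcosets (f ` W) = {f ` W, f ` (- W)}"
  proof (rule equalityI)
    have "f ` W #> f x \<in> {f ` W, f ` (- W)}" for x unfolding c by (cases "x \<in> W") simp_all
    then show "rcosets (f ` W) \<subseteq> {f ` W, f ` (- W)}" unfolding RCOSETS_def carrier_eq by blast
    have "f ` W #> f u1 \<in> rcosets (f ` W)" "f ` W #> f t \<in> rcosets (f ` W)"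
      unfolding RCOSETS_def carrier_eq by blast+
    then show "{f ` W, f ` (- W)} \<subseteq> rcosets (f ` W)" using t u by (simp add: c)
  qed
  moreover have "f ` W \<noteq> f ` (- W)" using u f_mem[of u1 W] f_mem[of u1 "- W"] by blast
  ultimately show ?thesis by simp
qed

text \<open>\<open>Q\<close> centralizes the nucleus, so it lies in the image of \<open>W\<close>.
  Its two cosets cover \<open>P\<close> and neither is larger than \<open>Q\<close>, so
  \<open>Q\<close> has at least 16 elements.\<close>

lemma subloop_W_unique:
  assumes Q: "subloop Q P" and two: "card (rcosets Q) = 2" and c: "nucleus P = loop_centre (P\<lparr>carrier := Q\<rparr>)"
  shows "Q = f ` W"
proof (rule card_seteq)
  interpret Q: subloop Q P by (rule Q)
  show "finite (f ` W)" by simp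
  show "Q \<subseteq> f ` W"
  proof
    fix q assume q: "q \<in> Q"
    then obtain x where x: "q = f x" using Q.subset carrier_eq by blast
    have "n \<cdot> x = x \<cdot> n" if "n \<in> Nuc" for n
    proof -
      have "f n \<in> loop_centre (P\<lparr>carrier := Q\<rparr>)" using that by (simp add: nucleus_eq flip: c)
      then have "f n \<otimes> q = q \<otimes> f n" using q by (simp add: loop_centre_def)
      then show ?thesis by (simp add: x flip: hom)
    qed
    then show "q \<in> f ` W" using W_iff by (simp add: x)
  qed
  have inj: "inj_on f A" for A by (simp add: inj_on_def)
  have finC: "finite (carrier P)" by (simp add: carrier_eq)
  then have finQ: "finite Q" using Q.subset finite_subset by blast
  have le: "card X \<le> card Q" if "X \<in> rcosets Q" for X
  proof -
    obtain a where "X = (\<lambda>h. h \<otimes> a) ` Q" using \<open>X \<in> rcosets Q\<close> unfolding RCOSETS_def r_coset_def by auto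
    then show ?thesis using card_image_le[OF finQ] by simp
  qed
  have "carrier P \<subseteq> \<Union> (rcosets Q)"
  proof
    fix a assume a: "a \<in> carrier P"
    then have "a \<in> Q #> a" unfolding r_coset_def using Q.one_closed P.l_one by force
    then show "a \<in> \<Union> (rcosets Q)" unfolding RCOSETS_def using a by blast
  qed
  moreover have "finite (rcosets Q)" using finC by (simp add: RCOSETS_def)
  moreover have "finite X" if "X \<in> rcosets Q" for X
    using that finQ unfolding RCOSETS_def r_coset_def by auto
  ultimately have "card (carrier P) \<le> card (\<Union> (rcosets Q))" by (intro card_mono) auto
  also have "\<dots> \<le> (\<Sum>X\<in>rcosets Q. card X)" by (rule card_Union_le_sum_card)
  also have "\<dots> \<le> (\<Sum>X\<in>rcosets Q. card Q)" by (rule sum_mono) (rule le)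
  also have "\<dots> = 2 * card Q" by (simp add: two)
  finally have "32 \<le> 2 * card Q" by (simp add: carrier_eq card_image[OF inj] card_32)
  then show "card (f ` W) \<le> card Q" by (simp add: card_image[OF inj] card_W)
qed

lemma Mod_W_noncommutative: "\<not> comm_group (PV W Mod f ` ZQ)"
proof
  assume "comm_group (PV W Mod f ` ZQ)"
  then interpret M: comm_group "PV W Mod f ` ZQ" .
  obtain w1 w2 where w: "w1 \<in> W" "w2 \<in> W" "\<not> qcomm w1 w2" by (rule ZQ2_structure) blast
  have "central_coset w1 \<in> carrier (PV W Mod f ` ZQ)" "central_coset w2 \<in> carrier (PV W Mod f ` ZQ)"
    unfolding carrier_Mod using w by simp_all
  from M.m_comm[OF this] have "central_coset (w1 \<cdot> w2) = central_coset (w2 \<cdot> w1)" unfolding mult_Mod .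
  then show False using w(3) by (simp only: central_coset_commute)
qed

lemma strict_image: "f ` A \<subset> f ` C \<longleftrightarrow> A \<subset> C"
proof -
  have "f ` A \<subseteq> f ` C \<longleftrightarrow> A \<subseteq> C" for A C by auto
  then show ?thesis unfolding psubset_eq using f_eq by (metis subset_antisym subset_refl)
qed

lemma structure_theorem:
  defines "is_Q \<equiv> \<lambda>Q. subloop Q P
      \<and> power_associative (P\<lparr>carrier := Q\<rparr>)
      \<and> conjugacy_closed_loop (P\<lparr>carrier := Q\<rparr>)
      \<and> card (rcosets Q) = 2
      \<and> Q <#> second_centre P = carrier P
      \<and> Q \<inter> second_centre P = nucleus P
      \<and> nucleus P = loop_centre (P\<lparr>carrier := Q\<rparr>)"
  shows "{\<one>} \<subset> associator_subloop P" "associator_subloop P \<subset> nucleus P"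
    "nucleus P \<subset> second_centre P" "card (second_centre P) = 8"
    "associator_subloop P = loop_centre P" "\<exists>!Q. is_Q Q"
    "is_Q Q \<Longrightarrow> group (P\<lparr>carrier := Q\<rparr> Mod associator_subloop P)"
    "is_Q Q \<Longrightarrow> \<not> comm_group (P\<lparr>carrier := Q\<rparr> Mod associator_subloop P)"
proof -
  have inj: "inj_on f A" for A by (simp add: inj_on_def)
  obtain s where s: "ZQ = {u1, s}" "s \<noteq> u1" by (rule Nuc_structure) auto
  have "{u1} \<subset> ZQ" using s by blast
  then have "f ` {u1} \<subset> f ` ZQ" by (simp only: strict_image)
  then show "{\<one>} \<subset> associator_subloop P" by (simp add: associator_subloop_eq f_one)
  have "ZQ \<subset> Nuc" using ZQ_Nuc Nuc_not_central by blast
  then show "associator_subloop P \<subset> nucleus P" by (simp only: associator_subloop_eq nucleus_eq strict_image)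
  have "Nuc \<noteq> ZQ2" using card_ZQ2 card_Nuc by auto
  then have "Nuc \<subset> ZQ2" using Nuc_ZQ2 by blast
  then show "nucleus P \<subset> second_centre P" by (simp only: second_centre_eq nucleus_eq strict_image)
  show "card (second_centre P) = 8" by (simp add: second_centre_eq card_image[OF inj] card_ZQ2)
  show "associator_subloop P = loop_centre P" by (simp only: associator_subloop_eq centre_eq)
  have unique: "Q = f ` W" if "is_Q Q" for Q using that subloop_W_unique unfolding is_Q_def by blast
  show "\<exists>!Q. is_Q Q"
  proof (rule ex1I[of _ "f ` W"])
    have sym: "asc x y z = asc y x z" if "x \<in> W" "y \<in> W" "z \<in> W" for x y z
      using asc_sym_W[OF that] by (simp add: asc_sym_def)
    have "f ` W <#> f ` ZQ2 = range f"
    proof (rule equalityI)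
      show "f ` W <#> f ` ZQ2 \<subseteq> range f" unfolding set_mult_def by (auto simp flip: hom)
      show "range f \<subseteq> f ` W <#> f ` ZQ2"
      proof
        fix a assume "a \<in> range f"
        then obtain y where y: "a = f y" by blast
        obtain w z where "w \<in> W" "z \<in> ZQ2" "y = w \<cdot> z" by (rule W_ZQ2)
        then show "a \<in> f ` W <#> f ` ZQ2" unfolding set_mult_def y by (auto simp: hom)
      qed
    qed
    moreover have "f ` W \<inter> f ` ZQ2 = f ` Nuc"
      unfolding ZQ2_W[symmetric] by auto
    ultimately show "is_Q (f ` W)"
      unfolding is_Q_def second_centre_eq carrier_eq nucleus_eq centre_W
      by (intro conjI subloop_f closed_W power_associative_W conjugacy_closed_PV sym rcosets_W refl)
  qed (rule unique)
  show "group (P\<lparr>carrier := Q\<rparr> Mod associator_subloop P)"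
    "\<not> comm_group (P\<lparr>carrier := Q\<rparr> Mod associator_subloop P)" if "is_Q Q"
    using group_Mod[OF closed_W] Mod_W_noncommutative unfolding unique[OF that] associator_subloop_eq by blast+
qed

end

section \<open>Pulling the loop back to a type and the final assembly\<close>

lemma buchsteiner_loop_copy:
  fixes P :: "('a, 'c) monoid_scheme" (structure)
  assumes P: "buchsteiner_loop P" and finite: "finite (UNIV :: 'b set)"
    and bij: "bij_betw (f :: 'b \<Rightarrow> 'a) UNIV (carrier P)"
  obtains mult ld rd u1 where "loop_copy mult ld rd u1 P f"
proof -
  interpret P: buchsteiner_loop P by (rule P)
  define g where "g = inv_into UNIV f"
  have fg: "f (g a) = a" if "a \<in> carrier P" for a
    using bij that unfolding g_def bij_betw_def by (simp add: f_inv_into_f)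
  have fc: "f x \<in> carrier P" for x using bij by (auto simp: bij_betw_def)
  have feq: "f x = f y \<longleftrightarrow> x = y" for x y using bij by (auto simp: bij_betw_def inj_on_def)
  define mult where "mult x y = g (f x \<otimes> f y)" for x y
  define ld where "ld x y = g (ldiv P (f x) (f y))" for x y
  define rd where "rd x y = g (rdiv P (f x) (f y))" for x y
  define u1 where "u1 = g \<one>"
  have f: "f (mult x y) = f x \<otimes> f y" "f (ld x y) = ldiv P (f x) (f y)"
    "f (rd x y) = rdiv P (f x) (f y)" "f u1 = \<one>" for x y
    by (simp_all add: mult_def ld_def rd_def u1_def fg fc P.m_closed P.ldiv(1) P.rdiv(1) P.one_closed)
  have "buchsteiner_algebra mult ld rd u1"
  proof
    fix x y z
    show "mult x (ld x y) = y" "mult (rd x y) y = x" "mult u1 x = x" "mult x u1 = x"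
      unfolding feq[symmetric] f by (simp_all add: fc P.ldiv(2) P.rdiv(2) P.l_one P.r_one)
    show "ld x (mult x y) = y" unfolding feq[symmetric] f by (rule P.ldiv_eqI) (simp_all add: fc)
    show "rd (mult x y) y = x" unfolding feq[symmetric] f by (rule P.rdiv_eqI) (simp_all add: fc)
    show "ld x (mult (mult x y) z) = rd (mult y (mult z x)) x"
      unfolding feq[symmetric] f by (rule P.buchsteiner) (rule fc)+
  qed
  then have "loop_copy mult ld rd u1 P f"
    by (intro loop_copy.intro loop_copy_axioms.intro P.loop_axioms bij f(1) finite)
  then show thesis by (rule that)
qed

theorem theorem6p3:
  fixes P :: "('a, 'b) monoid_scheme" (structure)
  assumes "proper_buchsteiner_loop P" and "order P = 32"
  shows "{\<one>} \<subset> associator_subloop P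
    \<and> associator_subloop P \<subset> nucleus P
    \<and> nucleus P \<subset> second_centre P
    \<and> card (second_centre P) = 8
    \<and> associator_subloop P = loop_centre P
    \<and> (let is_Q = (\<lambda>Q. subloop Q P
              \<and> power_associative (P\<lparr>carrier := Q\<rparr>)
              \<and> conjugacy_closed_loop (P\<lparr>carrier := Q\<rparr>)
              \<and> card (rcosets Q) = 2
              \<and> Q <#> second_centre P = carrier P
              \<and> Q \<inter> second_centre P = nucleus P
              \<and> nucleus P = loop_centre (P\<lparr>carrier := Q\<rparr>))
       in (\<exists>!Q. is_Q Q)
        \<and> (\<forall>Q. is_Q Q \<longrightarrow>
              group (P\<lparr>carrier := Q\<rparr> Mod associator_subloop P)
            \<and> \<not> comm_group (P\<lparr>carrier := Q\<rparr> Mod associator_subloop P)))"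
proof -
  have P: "buchsteiner_loop P" "\<not> conjugacy_closed_loop P"
    using assms(1) by (simp_all add: proper_buchsteiner_loop_def)
  have "card (carrier P) = 32" using assms(2) by (simp add: order_def)
  \<comment> \<open>The numeral type \<open>32\<close> has exactly 32 elements and supplies the type
    that the loop fills.\<close>
  then have "finite (carrier P)" "card (UNIV :: 32 set) = card (carrier P)"
    by (simp_all add: card_ge_0_finite)
  then obtain f :: "32 \<Rightarrow> 'a" where f: "bij_betw f UNIV (carrier P)"
    using finite_same_card_bij[of "UNIV :: 32 set" "carrier P"] by auto
  obtain mult ld rd u1 where "loop_copy mult ld rd u1 P f"
    by (rule buchsteiner_loop_copy[OF P(1) _ f]) simp_all
  then interpret loop_copy mult ld rd u1 P f .
  \<comment> \<open>Otherwise all associators would be symmetric and \<open>P\<close> conjugacy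
    closed.\<close>
  have "\<exists>x y z. asc x y z \<noteq> asc y x z"
    using conjugacy_closed_PV[OF closed_whole] P(2) by (simp only: PV_UNIV) blast
  then interpret proper_loop_32 mult ld rd u1 P f by unfold_locales simp_all
  show ?thesis unfolding Let_def by (intro conjI allI impI structure_theorem; (elim conjE)?; assumption)
qed

end
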